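(* Assume that either ($n=2$ and $\omega\ne0$) or $n\ge3$. There exist constants $0<c_1<c_2$ and $m_0>0$ such that for all $m\ge m_0$ $$\frac{c_1}{\mu_m^{1/4}}\le\|\varphi_m^\pm\|_{L^2(M)}\le\frac{c_2}{\mu_m^{1/4}}.$$
   Context: Setting. $n\ge2$ is an integer, $K$ is a connected closed (compact, without boundary) smooth manifold of dimension $n-1$ with a smooth Riemannian metric $g_K$, $f:[0,1]\to(0,\infty)$ is smooth, and $M=[0,1]\times K$ carries the metric $g=f(x)[dx^2+g_K]$. The boundary is $\partial M=\Gamma_0\cup\Gamma_1$ with $\Gamma_j=\{j\}\times K$, equipped with the induced metric. $\Delta_g$ and $\Delta_K$ are the Laplace–Beltrami operators of $(M,g)$ and $(K,g_K)$ ($-\Delta\ge0$). $\omega\in\mathbb R$ is a fixed frequency not in the Dirichlet spectrum of $-\Delta_g$. $L^2(M)$ is taken with respect to the Riemannian volume of $g$. The Dirichlet-to-Neumann operator is $\Lambda_g(\omega)\psi=(\partial_\nu u)|_{\partial M}$ ($\nu$ the outward unit normal), where for $\psi\in H^{1/2}(\partial M)$, $u\in H^1(M)$ is the unique solution of $-\Delta_g u=\omega u$ on $M$, $u=\psi$ on $\partial M$. It is selfadjoint on $L^2(\partial M)$. $0=\mu_0<\mu_1\le\mu_2\le\cdots\to+\infty$ are the eigenvalues of $-\Delta_K$ counted with multiplicity and $(Y_m)_{m\ge0}$ is a fixed orthonormal basis of $L^2(K)$ with $-\Delta_KY_m=\mu_mY_m$. For each $m$ the two-dimensional space $\mathcal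 H_m$ of functions on $\partial M$ equal to $aY_m$ on $\Gamma_0$ and $bY_m$ on $\Gamma_1$ ($a,b\in\mathbb C$) is invariant under $\Lambda_g(\omega)$, and $\Lambda_g(\omega)|_{\mathcal H_m}$ has two distinct real eigenvalues, denoted $\lambda_m^-<\lambda_m^+$ (the Steklov eigenvalues). Let $\phi_m^\pm\in\mathcal H_m$ be an eigenfunction of $\Lambda_g(\omega)$ for $\lambda_m^\pm$ with $\|\phi_m^\pm\|_{L^2(\partial M)}=1$. The Steklov eigenfunction $\varphi_m^\pm$ is the solution of $-\Delta_g\varphi_m^\pm=\omega\varphi_m^\pm$ on $M$, $\varphi_m^\pm=\phi_m^\pm$ on $\partial M$. *)

theory Defs
  imports "HOL-Analysis.Analysis"
begin

section \<open>Smooth functions on subsets of Euclidean space\<close>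

text \<open>
  Derivatives are taken within \<open>S\<close>. Below, \<open>S\<close> is open, or \<open>[0,1]\<close>, or \<open>[0,1]\<close> times an open set;
  in all these cases derivatives within \<open>S\<close> are unique, and on the faces \<open>x = 0, 1\<close> they are
  one-sided, so that \<open>smooth_on\<close> means smooth up to the boundary.
\<close>

definition pd :: "'a set \<Rightarrow> ('a::euclidean_space \<Rightarrow> 'b::real_normed_vector) \<Rightarrow> 'a \<Rightarrow> 'a \<Rightarrow> 'b" where
  "pd S h a z = frechet_derivative h (at z within S) a"

primrec Ck_on :: "nat \<Rightarrow> 'a set \<Rightarrow> ('a::euclidean_space \<Rightarrow> 'b::real_normed_vector) \<Rightarrow> bool" where
  "Ck_on 0 S h \<longleftrightarrow> continuous_on S h"
| "Ck_on (Suc k) S h \<longleftrightarrow> h differentiable_on S \<and> (\<forall>a\<in>Basis. Ck_on k S (pd S h a))"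

definition smooth_on :: "'a set \<Rightarrow> ('a::euclidean_space \<Rightarrow> 'b::real_normed_vector) \<Rightarrow> bool" where
  "smooth_on S h \<longleftrightarrow> (\<forall>k. Ck_on k S h)"


section \<open>Riemannian manifolds given by an atlas\<close>

text \<open>
  A manifold with underlying set in the type \<open>'p\<close>, modelled on \<open>'e\<close>, is given by an indexed atlas:
  \<open>coord R i\<close> is a chart on \<open>patch R i\<close>, and \<open>gform R i z v w\<close> is the metric at the point with
  coordinates \<open>z\<close> in the \<open>i\<close>-th chart, evaluated on the coordinate tangent vectors \<open>v\<close>, \<open>w\<close>.
\<close>

record ('i, 'p, 'e) riem =
  idx :: "'i set"
  patch :: "'i \<Rightarrow> 'p set"
  coord :: "'i \<Rightarrow> 'p \<Rightarrow> 'e"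
  gform :: "'i \<Rightarrow> 'e \<Rightarrow> 'e \<Rightarrow> 'e \<Rightarrow> real"

definition points :: "('i, 'p, 'e) riem \<Rightarrow> 'p set" where
  "points R = (\<Union>i\<in>idx R. patch R i)"

definition cimage :: "('i, 'p, 'e) riem \<Rightarrow> 'i \<Rightarrow> 'e set" where
  "cimage R i = coord R i ` patch R i"

definition param :: "('i, 'p, 'e) riem \<Rightarrow> 'i \<Rightarrow> 'e \<Rightarrow> 'p" where
  "param R i = inv_into (patch R i) (coord R i)"

definition smooth_atlas :: "('i, 'p::topological_space, 'e::euclidean_space) riem \<Rightarrow> bool" where
  "smooth_atlas R \<longleftrightarrow>
     (\<forall>i\<in>idx R. open (patch R i) \<and> open (cimage R i) \<and>
        homeomorphism (patch R i) (cimage R i) (coord R i) (param R i)) \<and>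
     (\<forall>i\<in>idx R. \<forall>j\<in>idx R.
        smooth_on (coord R i ` (patch R i \<inter> patch R j)) (coord R j \<circ> param R i))"

definition riemannian_metric :: "('i, 'p, 'e::euclidean_space) riem \<Rightarrow> bool" where
  "riemannian_metric R \<longleftrightarrow>
     (\<forall>i\<in>idx R. \<forall>z\<in>cimage R i.
        bilinear (gform R i z) \<and>
        (\<forall>v w. gform R i z v w = gform R i z w v) \<and>
        (\<forall>v. v \<noteq> 0 \<longrightarrow> gform R i z v v > 0)) \<and>
     (\<forall>i\<in>idx R. \<forall>v w. smooth_on (cimage R i) (\<lambda>z. gform R i z v w)) \<and>
     (\<forall>i\<in>idx R. \<forall>j\<in>idx R. \<forall>p\<in>patch R i \<inter> patch R j. \<forall>v w.
        (let D = frechet_derivative (coord R j \<circ> param R i) (at (coord R i p))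
         in gform R i (coord R i p) v w = gform R j (coord R j p) (D v) (D w)))"

text \<open>
  Connected closed Riemannian manifold whose underlying set is the whole type; Hausdorffness and
  second countability are provided by the type classes, and the dimension is \<open>DIM('e)\<close>.
\<close>

definition closed_connected_riemannian_manifold ::
    "('i, 'p::{t2_space, second_countable_topology}, 'e::euclidean_space) riem \<Rightarrow> bool" where
  "closed_connected_riemannian_manifold R \<longleftrightarrow>
     points R = UNIV \<and> compact (UNIV :: 'p set) \<and> connected (UNIV :: 'p set) \<and>
     smooth_atlas R \<and> riemannian_metric R"

definition smooth_fun :: "('i, 'p, 'e::euclidean_space) riem \<Rightarrow> ('p \<Rightarrow> complex) \<Rightarrow> bool" where
  "smooth_fun R u \<longleftrightarrow> (\<forall>i\<in>idx R. smooth_on (cimage R i) (u \<circ> param R i))"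

text \<open>Determinant and inverse of the Gram matrix of a positive definite form, indexed by \<open>Basis\<close>.\<close>

definition gram_det :: "('e::euclidean_space \<Rightarrow> 'e \<Rightarrow> real) \<Rightarrow> real" where
  "gram_det G = (\<Sum>\<sigma> | \<sigma> permutes (Basis :: 'e set). of_int (sign \<sigma>) * (\<Prod>a\<in>Basis. G a (\<sigma> a)))"

text \<open>
  The vector dual to the coordinate covector \<open>a\<close> has components \<open>g\<^sup>a\<^sup>b\<close>.
\<close>

definition gram_inv :: "('e::euclidean_space \<Rightarrow> 'e \<Rightarrow> real) \<Rightarrow> 'e \<Rightarrow> 'e \<Rightarrow> real" where
  "gram_inv G a b = (THE v. \<forall>w. G v w = w \<bullet> a) \<bullet> b"

definition vdens :: "('i, 'p, 'e::euclidean_space) riem \<Rightarrow> 'i \<Rightarrow> 'e \<Rightarrow> real" where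
  "vdens R i z = sqrt (gram_det (gform R i z))"

text \<open>
  \<open>V\<close> is the Riemannian volume measure of \<open>R\<close>, a Borel measure on the underlying set. On a
  manifold with a countable atlas there is exactly one such \<open>V\<close>.
\<close>

definition riemannian_volume ::
    "('i, 'p::topological_space, 'e::euclidean_space) riem \<Rightarrow> 'p measure \<Rightarrow> bool" where
  "riemannian_volume R V \<longleftrightarrow>
     space V = points R \<and> sets V = sets (restrict_space borel (points R)) \<and>
     (\<forall>i\<in>idx R. \<forall>B\<in>sets V. B \<subseteq> patch R i \<longrightarrow>
        emeasure V B = (\<integral>\<^sup>+z. ennreal (vdens R i z) * indicator (coord R i ` B) z \<partial>lborel))"

text \<open>
  Laplace--Beltrami operator
  \<open>\<Delta>u = |g|\<^sup>-\<^sup>1\<^sup>/\<^sup>2 \<Sum>\<^sub>a \<partial>\<^sub>a (|g|\<^sup>1\<^sup>/\<^sup>2 \<Sum>\<^sub>b g\<^sup>a\<^sup>b \<partial>\<^sub>b u)\<close>; the relation \<open>has_laplacian R u h\<close>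
  says \<open>\<Delta>u = h\<close>, the expression being the same in every chart.
\<close>

definition laplacian_in_chart ::
    "('i, 'p, 'e::euclidean_space) riem \<Rightarrow> 'i \<Rightarrow> ('p \<Rightarrow> complex) \<Rightarrow> 'e \<Rightarrow> complex" where
  "laplacian_in_chart R i u z =
     (\<Sum>a\<in>Basis. pd (cimage R i)
        (\<lambda>y. vdens R i y *\<^sub>R
           (\<Sum>b\<in>Basis. gram_inv (gform R i y) a b *\<^sub>R pd (cimage R i) (u \<circ> param R i) b y)) a z)
     /\<^sub>R vdens R i z"

definition has_laplacian ::
    "('i, 'p, 'e::euclidean_space) riem \<Rightarrow> ('p \<Rightarrow> complex) \<Rightarrow> ('p \<Rightarrow> complex) \<Rightarrow> bool" where
  "has_laplacian R u h \<longleftrightarrow>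
     smooth_fun R u \<and> (\<forall>i\<in>idx R. \<forall>p\<in>patch R i. laplacian_in_chart R i u (coord R i p) = h p)"

text \<open>
  Hermitian product \<open>\<langle>\<nabla>u, \<nabla>v\<rangle>\<^sub>g = \<Sum>\<^sub>a\<^sub>b g\<^sup>a\<^sup>b \<partial>\<^sub>a u cnj (\<partial>\<^sub>b v)\<close> of the gradients; its value does not depend
  on the chart chosen at \<open>p\<close>.
\<close>

definition grad_inner ::
    "('i, 'p, 'e::euclidean_space) riem \<Rightarrow> ('p \<Rightarrow> complex) \<Rightarrow> ('p \<Rightarrow> complex) \<Rightarrow> 'p \<Rightarrow> complex" where
  "grad_inner R u v p =
     (let i = (SOME i. i \<in> idx R \<and> p \<in> patch R i); z = coord R i p in
      \<Sum>a\<in>Basis. \<Sum>b\<in>Basis. gram_inv (gform R i z) a b *\<^sub>R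
        (pd (cimage R i) (u \<circ> param R i) a z * cnj (pd (cimage R i) (v \<circ> param R i) b z)))"


section \<open>Square integrable functions and orthonormal bases\<close>

definition L2_fun :: "'p measure \<Rightarrow> ('p \<Rightarrow> complex) \<Rightarrow> bool" where
  "L2_fun V u \<longleftrightarrow> u \<in> borel_measurable V \<and> integrable V (\<lambda>p. (norm (u p))\<^sup>2)"

definition L2_norm :: "'p measure \<Rightarrow> ('p \<Rightarrow> complex) \<Rightarrow> real" where
  "L2_norm V u = sqrt (\<integral>p. (norm (u p))\<^sup>2 \<partial>V)"

definition L2_inner :: "'p measure \<Rightarrow> ('p \<Rightarrow> complex) \<Rightarrow> ('p \<Rightarrow> complex) \<Rightarrow> complex" where
  "L2_inner V u v = (\<integral>p. u p * cnj (v p) \<partial>V)"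

definition orthonormal_basis :: "'p measure \<Rightarrow> (nat \<Rightarrow> 'p \<Rightarrow> complex) \<Rightarrow> bool" where
  "orthonormal_basis V Y \<longleftrightarrow>
     (\<forall>m. L2_fun V (Y m)) \<and>
     (\<forall>m k. L2_inner V (Y m) (Y k) = (if m = k then 1 else 0)) \<and>
     (\<forall>h. L2_fun V h \<longrightarrow>
        (\<lambda>N. L2_norm V (\<lambda>p. h p - (\<Sum>m<N. L2_inner V h (Y m) * Y m p))) \<longlonglongrightarrow> 0)"

definition energy ::
    "('i, 'p, 'e::euclidean_space) riem \<Rightarrow> 'p measure \<Rightarrow> ('p \<Rightarrow> complex) \<Rightarrow> ('p \<Rightarrow> complex) \<Rightarrow> complex"
  where "energy R V u v = (\<integral>p. grad_inner R u v p \<partial>V)"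

text \<open>
  \<open>H\<^sup>1\<close> is the completion of the functions smooth up to the boundary for the norm
  \<open>(\<parallel>u\<parallel>\<^sup>2 + \<parallel>\<nabla>u\<parallel>\<^sup>2)\<^sup>1\<^sup>/\<^sup>2\<close>, realised inside \<open>L\<^sup>2\<close>: \<open>H1_approx R V u U\<close> says that the smooth functions
  \<open>U k\<close> converge to \<open>u\<close> in \<open>H\<^sup>1\<close>, and \<open>H1_energy R V u v c\<close> that \<open>\<integral> \<langle>\<nabla>u, \<nabla>v\<rangle> = c\<close>, for
  \<open>u\<close> in \<open>H\<^sup>1\<close> and smooth \<open>v\<close>. The value \<open>c\<close> does not depend on the approximating sequence.
\<close>

definition H1_approx ::
    "('i, 'p, 'e::euclidean_space) riem \<Rightarrow> 'p measure \<Rightarrow> ('p \<Rightarrow> complex) \<Rightarrow> (nat \<Rightarrow> 'p \<Rightarrow> complex) \<Rightarrow> bool"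
  where
  "H1_approx R V u U \<longleftrightarrow>
     L2_fun V u \<and> (\<forall>k. smooth_fun R (U k)) \<and>
     (\<lambda>k. L2_norm V (\<lambda>p. U k p - u p)) \<longlonglongrightarrow> 0 \<and>
     (\<forall>e>0. \<exists>N. \<forall>k\<ge>N. \<forall>l\<ge>N.
        norm (energy R V (\<lambda>p. U k p - U l p) (\<lambda>p. U k p - U l p)) < e)"

definition H1_energy ::
    "('i, 'p, 'e::euclidean_space) riem \<Rightarrow> 'p measure \<Rightarrow> ('p \<Rightarrow> complex) \<Rightarrow> ('p \<Rightarrow> complex) \<Rightarrow> complex \<Rightarrow> bool"
  where
  "H1_energy R V u v c \<longleftrightarrow> (\<exists>U. H1_approx R V u U \<and> (\<lambda>k. energy R V (U k) v) \<longlonglongrightarrow> c)"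


section \<open>The cylinder \<open>[0,1] \<times> K\<close> with metric \<open>f(x) [dx\<^sup>2 + g\<^sub>K]\<close>\<close>

definition cylinder ::
    "(real \<Rightarrow> real) \<Rightarrow> ('i, 'k, 'e) riem \<Rightarrow> ('i, real \<times> 'k, real \<times> 'e) riem" where
  "cylinder f K =
     \<lparr> idx = idx K,
       patch = (\<lambda>i. {0..1} \<times> patch K i),
       coord = (\<lambda>i (x, p). (x, coord K i p)),
       gform = (\<lambda>i (x, z) (s, v) (t, w). f x * (s * t + gform K i z v w)) \<rparr>"

text \<open>The boundary \<open>{0,1} \<times> K\<close> with the metric induced from the cylinder.\<close>

definition cylinder_boundary ::
    "(real \<Rightarrow> real) \<Rightarrow> ('i, 'k, 'e::euclidean_space) riem \<Rightarrow> (real \<times> 'i, real \<times> 'k, 'e) riem" where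
  "cylinder_boundary f K =
     \<lparr> idx = {0, 1} \<times> idx K,
       patch = (\<lambda>(j, i). {j} \<times> patch K i),
       coord = (\<lambda>(j, i) (x, p). coord K i p),
       gform = (\<lambda>(j, i) z v w. gform (cylinder f K) i (j, z) (0, v) (0, w)) \<rparr>"

text \<open>
  In the following, \<open>VM\<close> and \<open>VB\<close> stand for the volume measures of the cylinder and its boundary.
  A function on the boundary is a function on \<open>real \<times> 'k\<close> of which only the values on
  \<open>{0,1} \<times> K\<close> matter.
\<close>

definition has_trace ::
    "(real \<Rightarrow> real) \<Rightarrow> ('i, 'k, 'e::euclidean_space) riem \<Rightarrow> (real \<times> 'k) measure \<Rightarrow> (real \<times> 'k) measure \<Rightarrow>
     (real \<times> 'k \<Rightarrow> complex) \<Rightarrow> (real \<times> 'k \<Rightarrow> complex) \<Rightarrow> bool" where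
  "has_trace f K VM VB u \<psi> \<longleftrightarrow>
     L2_fun VB \<psi> \<and>
     (\<exists>U. H1_approx (cylinder f K) VM u U \<and> (\<lambda>k. L2_norm VB (\<lambda>q. U k q - \<psi> q)) \<longlonglongrightarrow> 0)"

text \<open>Smooth functions with compact support in the open cylinder.\<close>

definition test_fun ::
    "(real \<Rightarrow> real) \<Rightarrow> ('i, 'k::topological_space, 'e::euclidean_space) riem \<Rightarrow> (real \<times> 'k \<Rightarrow> complex) \<Rightarrow> bool"
  where
  "test_fun f K v \<longleftrightarrow>
     smooth_fun (cylinder f K) v \<and>
     (let S = closure {q \<in> points (cylinder f K). v q \<noteq> 0} in compact S \<and> S \<subseteq> {0<..<1} \<times> UNIV)"

text \<open>
  \<open>u \<in> H\<^sup>1(M)\<close> is the (weak) solution of \<open>-\<Delta>\<^sub>g u = \<omega> u\<close> on \<open>M\<close>, \<open>u = \<psi>\<close> on \<open>\<partial>M\<close>. Such \<open>u\<close> exists only for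
  \<open>\<psi> \<in> H\<^sup>1\<^sup>/\<^sup>2(\<partial>M)\<close>, the space of traces.
\<close>

definition dirichlet_solution ::
    "(real \<Rightarrow> real) \<Rightarrow> ('i, 'k::topological_space, 'e::euclidean_space) riem \<Rightarrow>
     (real \<times> 'k) measure \<Rightarrow> (real \<times> 'k) measure \<Rightarrow> real \<Rightarrow>
     (real \<times> 'k \<Rightarrow> complex) \<Rightarrow> (real \<times> 'k \<Rightarrow> complex) \<Rightarrow> bool" where
  "dirichlet_solution f K VM VB \<omega> \<psi> u \<longleftrightarrow>
     has_trace f K VM VB u \<psi> \<and>
     (\<forall>v. test_fun f K v \<longrightarrow> H1_energy (cylinder f K) VM u v (of_real \<omega> * L2_inner VM u v))"

definition dirichlet_spectrum ::
    "(real \<Rightarrow> real) \<Rightarrow> ('i, 'k::topological_space, 'e::euclidean_space) riem \<Rightarrow>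
     (real \<times> 'k) measure \<Rightarrow> (real \<times> 'k) measure \<Rightarrow> real set" where
  "dirichlet_spectrum f K VM VB =
     {\<omega>. \<exists>u. dirichlet_solution f K VM VB \<omega> (\<lambda>q. 0) u \<and> \<not> (AE q in VM. u q = 0)}"

text \<open>
  \<open>has_DN f K VM VB \<omega> \<psi> h\<close> says \<open>\<Lambda>\<^sub>g(\<omega>) \<psi> = h\<close>. The normal derivative \<open>h = \<partial>\<^sub>\<nu> u\<close> of the solution
  \<open>u \<in> H\<^sup>1(M)\<close> is characterised by Green's formula
  \<open>\<integral>\<^sub>M \<langle>\<nabla>u, \<nabla>v\<rangle> = \<omega> \<integral>\<^sub>M u cnj v + \<integral>\<^sub>\<partial>\<^sub>M h cnj v\<close>
  for \<open>v\<close> smooth up to the boundary.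
\<close>

definition has_DN ::
    "(real \<Rightarrow> real) \<Rightarrow> ('i, 'k::topological_space, 'e::euclidean_space) riem \<Rightarrow>
     (real \<times> 'k) measure \<Rightarrow> (real \<times> 'k) measure \<Rightarrow> real \<Rightarrow>
     (real \<times> 'k \<Rightarrow> complex) \<Rightarrow> (real \<times> 'k \<Rightarrow> complex) \<Rightarrow> bool" where
  "has_DN f K VM VB \<omega> \<psi> h \<longleftrightarrow>
     L2_fun VB h \<and>
     (\<exists>u. dirichlet_solution f K VM VB \<omega> \<psi> u \<and>
       (\<forall>v. smooth_fun (cylinder f K) v \<longrightarrow>
          H1_energy (cylinder f K) VM u v (of_real \<omega> * L2_inner VM u v + L2_inner VB h v)))"

text \<open>The two-dimensional space of boundary functions \<open>a Y\<close> on \<open>{0} \<times> K\<close>, \<open>b Y\<close> on \<open>{1} \<times> K\<close>.\<close>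

definition mode_space :: "('k \<Rightarrow> complex) \<Rightarrow> (real \<times> 'k \<Rightarrow> complex) set" where
  "mode_space Y = {\<psi>. \<exists>a b. \<forall>p. \<psi> (0, p) = a * Y p \<and> \<psi> (1, p) = b * Y p}"

text \<open>
  \<open>\<phi>\<close> is a normalised eigenfunction of \<open>\<Lambda>\<^sub>g(\<omega>)\<close> in the mode space of \<open>Y\<close> for the
  eigenvalue \<open>l\<close>.
\<close>

definition normalised_DN_eigenfunction ::
    "(real \<Rightarrow> real) \<Rightarrow> ('i, 'k::topological_space, 'e::euclidean_space) riem \<Rightarrow>
     (real \<times> 'k) measure \<Rightarrow> (real \<times> 'k) measure \<Rightarrow> real \<Rightarrow> ('k \<Rightarrow> complex) \<Rightarrow>
     real \<Rightarrow> (real \<times> 'k \<Rightarrow> complex) \<Rightarrow> bool" where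
  "normalised_DN_eigenfunction f K VM VB \<omega> Y l \<phi> \<longleftrightarrow>
     \<phi> \<in> mode_space Y \<and> L2_norm VB \<phi> = 1 \<and>
     has_DN f K VM VB \<omega> \<phi> (\<lambda>q. of_real l * \<phi> q)"

end

theory Submission
  imports Defs "Jordan_Normal_Form.Determinant"
begin

text \<open>
  Let \<open>\<phi>\<close> equal \<open>a Y\<close> on \<open>{0} \<times> K\<close> and \<open>b Y\<close> on \<open>{1} \<times> K\<close>, where \<open>-\<Delta>\<^sub>K Y = \<mu> Y\<close>. Separation of variables
  solves the Dirichlet problem: with \<open>N = dim K + 1\<close> and \<open>P = f\<^sup>N\<^sup>/\<^sup>2\<^sup>-\<^sup>1\<close>, the function \<open>w(x) Y(p)\<close> is a
  solution as soon as \<open>(P w')' = P (\<mu> - \<omega> f) w\<close>, \<open>w(0) = a\<close>, \<open>w(1) = b\<close>. Since \<open>\<omega>\<close> is not in the Dirichlet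
  spectrum, the given solution agrees with it almost everywhere, and its norm is that of \<open>w\<close> in
  \<open>L\<^sup>2([0,1], f\<^sup>N\<^sup>/\<^sup>2 dx)\<close>. So the bounds hold for every normalised element of the mode space, and in
  particular for the Steklov eigenfunctions.

  For large \<open>\<mu>\<close> the coefficient \<open>\<mu> - \<omega> f\<close> is comparable with \<open>\<mu> = \<kappa>\<^sup>2\<close>, and \<open>w\<close> is \<open>a\<close> times a solution
  concentrated near \<open>0\<close> plus \<open>b\<close> times one concentrated near \<open>1\<close>. The profile \<open>y\<close> with \<open>y(0) = 0\<close>,
  \<open>y(1) = 1\<close> is controlled by the functions \<open>(P y')\<^sup>2 - c \<kappa>\<^sup>2 y\<^sup>2\<close>, which are monotone for small and for
  large \<open>c\<close>: \<open>P y'\<close> is at least a multiple of \<open>\<kappa> y\<close> and at most a multiple of \<open>\<kappa>\<close>. Hence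
  \<open>\<integral> y\<^sup>2\<close> is at most a constant times \<open>1/\<kappa>\<close>, while \<open>y\<close> stays above \<open>3/4\<close> on an interval of length
  proportional to \<open>1/\<kappa>\<close> at \<open>1\<close> and is small on \<open>[0, 1/2]\<close> (\<open>growing_solution\<close>). The
  reflected profile is treated in the same way, the two hardly interact, and \<open>\<integral> |w|\<^sup>2\<close> is comparable with
  \<open>(|a|\<^sup>2 + |b|\<^sup>2) / \<kappa>\<close> (\<open>two_point_solution\<close>). The square root gives the power \<open>\<mu>\<^sup>-\<^sup>1\<^sup>/\<^sup>4\<close>.

  The remaining work is to justify the separation of variables from the definitions by charts.
  The gradient product does not depend on the chart (\<open>chart_grad_independent\<close>), the volumes of the cylinder
  and of its boundary are products with the volume of \<open>K\<close> (\<open>cylinder_volume_product\<close>,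
  \<open>boundary_volume_product\<close>), Green's formula holds for \<open>Y\<close> on \<open>K\<close> (\<open>green\<close>, by a partition of unity), and
  with the fundamental theorem of calculus in \<open>x\<close> it yields the weak equation for \<open>w Y\<close>
  (\<open>separated_weak_solution\<close>). As \<open>w Y\<close> is smooth up to the boundary, the constant sequence approximates it
  in \<open>H\<^sup>1\<close>, and uniqueness (\<open>dirichlet_solution_unique\<close>) is immediate.
\<close>

section \<open>Determinants and inverses of Gram matrices\<close>

text \<open>The symbol is needed for the inner product of Euclidean spaces.\<close>

no_notation scalar_prod (infix "\<bullet>" 70)

text \<open>
  Determinants indexed by an arbitrary finite set: Gram determinants are indexed by \<open>Basis\<close>, whereas
  Cramer's rule and the kernel criterion are theorems about matrices indexed by \<open>{0..<n}\<close>.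
\<close>

definition det_on :: "'b set \<Rightarrow> ('b \<Rightarrow> 'b \<Rightarrow> real) \<Rightarrow> real" where
  "det_on S A = (\<Sum>\<sigma> | \<sigma> permutes S. of_int (sign \<sigma>) * (\<Prod>a\<in>S. A a (\<sigma> a)))"

lemma gram_det_eq_det_on: "gram_det G = det_on Basis G"
  by (simp add: gram_det_def det_on_def)

lemma det_on_reindex:
  assumes "finite S" and e: "bij_betw e S T"
  shows "det_on T A = det_on S (\<lambda>i j. A (e i) (e j))"
proof -
  have inj: "inj_on e S" and T: "T = e ` S"
    using e by (auto simp: bij_betw_def)
  define h where "h = inv_into S e"
  have h: "bij_betw h T S" using e by (simp add: h_def bij_betw_inv_into)
  have he: "h (e x) = x" if "x \<in> S" for x using that inj by (simp add: h_def)
  have eh: "e (h y) = y" if "y \<in> T" for y using that T by (auto simp: h_def f_inv_into_f)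
  show ?thesis
    unfolding det_on_def
  proof (rule sum.reindex_bij_witness[where i="map_permutation S e" and j="map_permutation T h"])
    fix p assume "p \<in> {\<sigma>. \<sigma> permutes T}"
    then have p: "p permutes T" by simp
    have injh: "inj_on h T" using h by (simp add: bij_betw_def)
    show "map_permutation S e (map_permutation T h p) = p"
      by (rule map_permutation_compose_inv[OF h p]) (use eh in auto)
    show "map_permutation T h p \<in> {\<sigma>. \<sigma> permutes S}"
      using map_permutation_permutes[OF h p] by simp
    have sg: "sign (map_permutation T h p) = sign p"
      by (rule sign_map_permutation[OF injh p]) (simp add: T assms)
    have "(\<Prod>a\<in>T. A a (p a)) = (\<Prod>i\<in>S. A (e i) (p (e i)))"
      unfolding T by (rule prod.reindex_cong[OF inj]) auto
    also have "\<dots> = (\<Prod>i\<in>S. A (e i) (e (map_permutation T h p i)))"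
    proof (rule prod.cong[OF refl])
      fix i assume i: "i \<in> S"
      have "e i \<in> T" using i T by auto
      then have "map_permutation T h p (h (e i)) = h (p (e i))"
        by (rule map_permutation_apply[OF injh])
      then show "A (e i) (p (e i)) = A (e i) (e (map_permutation T h p i))"
        using i eh p \<open>e i \<in> T\<close> by (simp add: he permutes_in_image)
    qed
    finally show "real_of_int (sign (map_permutation T h p)) * (\<Prod>i\<in>S. A (e i) (e (map_permutation T h p i))) =
         real_of_int (sign p) * (\<Prod>a\<in>T. A a (p a))"
      by (simp add: sg)
  next
    fix p assume "p \<in> {\<sigma>. \<sigma> permutes S}"
    then have p: "p permutes S" by simp
    show "map_permutation T h (map_permutation S e p) = p"
      by (rule map_permutation_compose_inv[OF e p]) (use he in auto)
    show "map_permutation S e p \<in> {\<sigma>. \<sigma> permutes T}"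
      using map_permutation_permutes[OF e p] by simp
  qed
qed

lemma det_on_eq_det: "det_on {0..<n} A = Determinant.det (mat n n (\<lambda>(i, j). A i j))"
  unfolding det_on_def
  by (subst det_def'[where n=n], simp, intro sum.cong arg_cong2[where f="(*)"] prod.cong refl)
     (auto simp: permutes_in_image)

lemma det_on_scale: "det_on S (\<lambda>i j. c * A i j) = c ^ card S * det_on S A"
  by (simp add: det_on_def prod.distrib sum_distrib_left algebra_simps)

text \<open>
  A permutation that moves \<open>r\<close> picks a vanishing entry in the row of \<open>r\<close>; only the permutations of \<open>S\<close>
  contribute.
\<close>

lemma det_on_insert_block:
  assumes "finite S" "r \<notin> S" and row: "\<And>j. j \<in> S \<Longrightarrow> A r j = 0"
  shows "det_on (insert r S) A = A r r * det_on S A"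
proof -
  define F where "F \<sigma> = real_of_int (sign \<sigma>) * (\<Prod>a\<in>insert r S. A a (\<sigma> a))" for \<sigma>
  have "det_on (insert r S) A = (\<Sum>b\<in>insert r S. \<Sum>q | q permutes S. F (Transposition.transpose r b \<circ> q))"
    unfolding det_on_def F_def by (rule sum_over_permutations_insert[OF assms(1,2)])
  also have "\<dots> = (\<Sum>q | q permutes S. F (Transposition.transpose r r \<circ> q))"
  proof -
    have "(\<Sum>q | q permutes S. F (Transposition.transpose r b \<circ> q)) = 0" if "b \<in> S" for b
    proof (rule sum.neutral, rule ballI)
      fix q assume "q \<in> {q. q permutes S}"
      then have "q r = r" using assms(2) by (simp add: permutes_not_in)
      then have "A r ((Transposition.transpose r b \<circ> q) r) = 0" using row[OF that] by simp
      then have "(\<Prod>a\<in>insert r S. A a ((Transposition.transpose r b \<circ> q) a)) = 0"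
        by (subst prod.insert[OF assms(1,2)]) simp
      then show "F (Transposition.transpose r b \<circ> q) = 0" by (simp add: F_def)
    qed
    then have "(\<Sum>b\<in>S. \<Sum>q | q permutes S. F (Transposition.transpose r b \<circ> q)) = 0"
      by (intro sum.neutral) auto
    then show ?thesis
      by (subst sum.insert[OF assms(1,2)]) simp
  qed
  also have "\<dots> = (\<Sum>q | q permutes S. A r r * (real_of_int (sign q) * (\<Prod>a\<in>S. A a (q a))))"
  proof (rule sum.cong[OF refl])
    fix q assume "q \<in> {q. q permutes S}"
    then have "q r = r" using assms(2) by (simp add: permutes_not_in)
    then show "F (Transposition.transpose r r \<circ> q) = A r r * (real_of_int (sign q) * (\<Prod>a\<in>S. A a (q a)))"
      using assms(1,2) by (simp add: F_def)
  qed
  finally show ?thesis by (simp add: det_on_def sum_distrib_left)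
qed

definition posdef :: "('e::euclidean_space \<Rightarrow> 'e \<Rightarrow> real) \<Rightarrow> bool" where
  "posdef G \<longleftrightarrow> bilinear G \<and> (\<forall>v w. G v w = G w v) \<and> (\<forall>v. v \<noteq> 0 \<longrightarrow> G v v > 0)"

text \<open>
  Positivity makes the map from \<open>v\<close> to the vector representing \<open>G v\<close> injective, hence bijective.
\<close>

lemma posdef_sharp:
  assumes "posdef G"
  shows "\<exists>!v. \<forall>w. G v w = w \<bullet> a"
proof -
  have bl: "bilinear G" and sym: "\<And>v w. G v w = G w v" and pos: "\<And>v. v \<noteq> 0 \<Longrightarrow> G v v > 0"
    using assms by (auto simp: posdef_def)
  have l2: "linear (G v)" for v using bl by (simp add: bilinear_def)
  have l1: "linear (\<lambda>v. G v w)" for w using bl by (simp add: bilinear_def)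
  define L where "L v = (\<Sum>b\<in>Basis. G v b *\<^sub>R b)" for v
  have linL: "linear L"
    unfolding L_def
    by (intro linear_compose_sum ballI linear_scale_left[THEN linear_compose, unfolded o_def] linear_compose[OF l1, unfolded o_def]) (auto intro!: linearI simp: scaleR_add_left)
  have Lin: "L v \<bullet> w = G v w" for v w
  proof -
    have "G v w = G v (\<Sum>b\<in>Basis. (w \<bullet> b) *\<^sub>R b)" by (simp add: euclidean_representation)
    also have "\<dots> = (\<Sum>b\<in>Basis. (w \<bullet> b) * G v b)"
      by (simp add: linear_sum[OF l2] linear_cmul[OF l2])
    also have "\<dots> = L v \<bullet> w"
      by (simp add: L_def inner_sum_left mult.commute inner_commute[of w])
    finally show ?thesis by simp
  qed
  have "inj L"
  proof (subst linear_injective_0[OF linL], intro allI impI)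
    fix v assume "L v = 0"
    then have "G v v = 0" using Lin[of v v] by simp
    then show "v = 0" using pos[of v] by fastforce
  qed
  then have "surj L" using linear_injective_imp_surjective[OF linL] by simp
  then obtain v where v: "L v = a" by (metis surjD)
  show ?thesis
  proof (rule ex1I[of _ v])
    show "\<forall>w. G v w = w \<bullet> a" using Lin[of v] v by (simp add: inner_commute)
    fix v' assume "\<forall>w. G v' w = w \<bullet> a"
    then have "L v' \<bullet> w = L v \<bullet> w" for w using Lin[of v'] v by (simp add: inner_commute)
    then have "L v' = L v" by (metis inner_commute vector_eq_rdot)
    then show "v' = v" using \<open>inj L\<close> by (simp add: inj_eq)
  qed
qed

text \<open>
  The vector dual to the covector \<open>w \<mapsto> w \<bullet> a\<close>; its components are the entries of the inverse Gram matrix.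
\<close>

definition sharp :: "('e::euclidean_space \<Rightarrow> 'e \<Rightarrow> real) \<Rightarrow> 'e \<Rightarrow> 'e" where
  "sharp G a = (THE v. \<forall>w. G v w = w \<bullet> a)"

lemma gram_inv_sharp: "gram_inv G a b = sharp G a \<bullet> b"
  by (simp add: gram_inv_def sharp_def)

lemma sharp: "posdef G \<Longrightarrow> G (sharp G a) w = w \<bullet> a"
  unfolding sharp_def using theI'[OF posdef_sharp] by blast

lemma sharp_eqI: "posdef G \<Longrightarrow> (\<And>w. G v w = w \<bullet> a) \<Longrightarrow> sharp G a = v"
  unfolding sharp_def by (rule the1_equality[OF posdef_sharp]) auto

text \<open>
  A vanishing determinant yields a nonzero kernel vector of the Gram matrix, and the vector \<open>x\<close> with
  these components satisfies \<open>G x x = 0\<close>.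
\<close>

lemma posdef_gram_det_nonzero:
  assumes "posdef (G :: 'e::euclidean_space \<Rightarrow> 'e \<Rightarrow> real)"
  shows "gram_det G \<noteq> 0"
proof
  assume D0: "gram_det G = 0"
  have bl: "bilinear G" and pos: "\<And>v. v \<noteq> 0 \<Longrightarrow> G v v > 0"
    using assms by (auto simp: posdef_def)
  have l2: "linear (G v)" for v using bl by (simp add: bilinear_def)
  have l1: "linear (\<lambda>v. G v w)" for w using bl by (simp add: bilinear_def)
  define n where "n = DIM('e)"
  obtain e :: "nat \<Rightarrow> 'e" where e: "bij_betw e {0..<n} Basis"
    using ex_bij_betw_nat_finite[of "Basis :: 'e set"] by (auto simp: n_def)
  have inj: "inj_on e {0..<n}" and eB: "e ` {0..<n} = Basis" using e by (auto simp: bij_betw_def)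
  define A where "A = mat n n (\<lambda>(i, j). G (e i) (e j))"
  have A: "A \<in> carrier_mat n n" by (simp add: A_def)
  have "Determinant.det A = 0"
    using D0 by (simp add: A_def gram_det_eq_det_on det_on_reindex[OF _ e] det_on_eq_det)
  then obtain v where v: "v \<in> carrier_vec n" "v \<noteq> 0\<^sub>v n" "A *\<^sub>v v = 0\<^sub>v n"
    using det_0_iff_vec_prod_zero[OF A] by auto
  define x where "x = (\<Sum>j<n. vec_index v j *\<^sub>R e j)"
  have Gx: "G (e i) x = 0" if "i < n" for i
  proof -
    have "G (e i) x = (\<Sum>j<n. vec_index v j * G (e i) (e j))"
      by (simp add: x_def linear_sum[OF l2] linear_cmul[OF l2])
    also have "\<dots> = vec_index (A *\<^sub>v v) i"
      using that v(1) by (simp add: A_def mult_mat_vec_def scalar_prod_def lessThan_atLeast0 mult.commute)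
    finally show ?thesis using v(3) that by simp
  qed
  have "G x x = (\<Sum>j<n. vec_index v j * G (e j) x)"
    by (subst (1) x_def) (simp add: linear_sum[OF l1] linear_cmul[OF l1])
  also have "\<dots> = 0" using Gx by simp
  finally have "x = 0" using pos[of x] by fastforce
  have "vec_index v i = 0" if i: "i < n" for i
  proof -
    have "e j \<bullet> e i = (if j = i then 1 else 0)" if "j < n" for j
      using that i eB inj by (subst inner_Basis) (auto simp: inj_on_eq_iff)
    then have "x \<bullet> e i = (\<Sum>j<n. vec_index v j * (if j = i then 1 else 0))"
      by (simp add: x_def inner_sum_left)
    also have "\<dots> = vec_index v i" using i by (simp add: if_distrib sum.delta cong: if_cong)
    finally show ?thesis using \<open>x = 0\<close> by simp
  qed
  then have "v = 0\<^sub>v n" using v(1) by (intro eq_vecI) auto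
  then show False using v(2) by simp
qed

lemma gram_det_inner: "gram_det ((\<bullet>) :: 'e::euclidean_space \<Rightarrow> 'e \<Rightarrow> real) = 1"
proof -
  define n where "n = DIM('e)"
  obtain e :: "nat \<Rightarrow> 'e" where e: "bij_betw e {0..<n} Basis"
    using ex_bij_betw_nat_finite[of "Basis :: 'e set"] by (auto simp: n_def)
  have inj: "inj_on e {0..<n}" and eB: "e ` {0..<n} = Basis" using e by (auto simp: bij_betw_def)
  have "mat n n (\<lambda>(i, j). e i \<bullet> e j) = 1\<^sub>m n"
  proof (intro eq_matI)
    fix i j assume ij: "i < dim_row (1\<^sub>m n)" "j < dim_col (1\<^sub>m n)"
    then have "e i \<in> Basis" "e j \<in> Basis" "e i = e j \<longleftrightarrow> i = j"
      using eB inj by (auto simp: inj_on_eq_iff)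
    then show "mat n n (\<lambda>(i, j). e i \<bullet> e j) $$ (i, j) = 1\<^sub>m n $$ (i, j)"
      using ij by (simp add: inner_Basis)
  qed auto
  then show ?thesis
    by (simp add: gram_det_eq_det_on det_on_reindex[OF _ e] det_on_eq_det)
qed

text \<open>
  The forms on the segment from the inner product to \<open>G\<close> are positive definite, so the determinant has
  no zero on it and keeps the sign that it has for the inner product.
\<close>

lemma posdef_gram_det_pos:
  assumes "posdef G"
  shows "gram_det G > 0"
proof (rule ccontr)
  assume "\<not> gram_det G > 0"
  define H where "H t v w = t * G v w + (1 - t) * (v \<bullet> w)" for t v w
  have bl: "bilinear G" and sym: "\<And>v w. G v w = G w v" and pos: "\<And>v. v \<noteq> 0 \<Longrightarrow> G v v > 0"
    using assms by (auto simp: posdef_def)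
  have l2: "linear (G v)" for v using bl by (simp add: bilinear_def)
  have l1: "linear (\<lambda>v. G v w)" for w using bl by (simp add: bilinear_def)
  have H: "posdef (H t)" if "0 \<le> t" "t \<le> 1" for t
    unfolding posdef_def bilinear_def
  proof (intro conjI allI impI)
    show "linear (H t v)" for v
      unfolding H_def
      by (intro linearI) (simp_all add: linear_add[OF l2] linear_cmul[OF l2] algebra_simps inner_add_right)
    show "linear (\<lambda>v. H t v w)" for w
      unfolding H_def
      by (intro linearI) (simp_all add: linear_add[OF l1] linear_cmul[OF l1] algebra_simps inner_add_left)
    show "H t v w = H t w v" for v w by (simp add: H_def sym[of v w] inner_commute)
    fix v :: 'a assume v: "v \<noteq> 0"
    show "0 < H t v v"
    proof (cases "t = 0")
      case True then show ?thesis using v by (simp add: H_def)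
    next
      case False
      then have "0 < t * G v v" using pos[OF v] that by simp
      moreover have "0 \<le> (1 - t) * (v \<bullet> v)" using that by simp
      ultimately show ?thesis unfolding H_def by linarith
    qed
  qed
  have "\<exists>t\<ge>0. t \<le> 1 \<and> gram_det (H t) = 0"
  proof (rule IVT2')
    have "H 1 = G" "H 0 = (\<bullet>)" by (auto simp: H_def fun_eq_iff)
    then show "gram_det (H 1) \<le> 0" "0 \<le> gram_det (H 0)"
      using \<open>\<not> gram_det G > 0\<close> by (auto simp: gram_det_inner)
    show "continuous_on {0..1} (\<lambda>t. gram_det (H t))"
      unfolding gram_det_def H_def by (intro continuous_intros)
  qed simp
  then show False using H posdef_gram_det_nonzero by blast
qed

text \<open>
  Cramer's rule. It exhibits the inverse Gram matrix as a quotient of polynomials in the entries of \<open>G\<close>,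
  which is how smoothness of the metric passes to its inverse.
\<close>

lemma gram_inv_cramer:
  assumes "posdef (G :: 'e::euclidean_space \<Rightarrow> 'e \<Rightarrow> real)" "a \<in> Basis" "b \<in> Basis"
  shows "gram_inv G a b * gram_det G =
    det_on Basis (\<lambda>c d. if d = b then (if c = a then 1 else 0) else G c d)"
proof -
  have bl: "bilinear G" and sym: "\<And>v w. G v w = G w v"
    using assms by (auto simp: posdef_def)
  have l2: "linear (G v)" for v using bl by (simp add: bilinear_def)
  define n where "n = DIM('e)"
  obtain e :: "nat \<Rightarrow> 'e" where e: "bij_betw e {0..<n} Basis"
    using ex_bij_betw_nat_finite[of "Basis :: 'e set"] by (auto simp: n_def)
  have inj: "inj_on e {0..<n}" and eB: "e ` {0..<n} = Basis" using e by (auto simp: bij_betw_def)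
  obtain ka kb where ka: "ka < n" "e ka = a" and kb: "kb < n" "e kb = b"
    using assms(2,3) eB by (metis atLeastLessThan_iff imageE)
  have eq: "e i = e j \<longleftrightarrow> i = j" if "i < n" "j < n" for i j
    using inj that by (auto simp: inj_on_eq_iff)
  define A where "A = mat n n (\<lambda>(i, j). G (e i) (e j))"
  have A: "A \<in> carrier_mat n n" by (simp add: A_def)
  define x where "x = vec n (\<lambda>j. sharp G a \<bullet> e j)"
  have x: "x \<in> carrier_vec n" by (simp add: x_def)
  have Ax: "vec_index (A *\<^sub>v x) i = (if i = ka then 1 else 0)" if "i < n" for i
  proof -
    have "vec_index (A *\<^sub>v x) i = (\<Sum>j\<in>{0..<n}. (sharp G a \<bullet> e j) * G (e i) (e j))"
      using that by (simp add: A_def x_def mult_mat_vec_def scalar_prod_def mult.commute)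
    also have "\<dots> = (\<Sum>d\<in>Basis. (sharp G a \<bullet> d) * G (e i) d)"
      by (rule sum.reindex_bij_betw[OF e])
    also have "\<dots> = G (e i) (\<Sum>d\<in>Basis. (sharp G a \<bullet> d) *\<^sub>R d)"
      by (simp add: linear_sum[OF l2] linear_cmul[OF l2])
    also have "\<dots> = e i \<bullet> a"
      using sharp[OF assms(1), of a "e i"] sym by (simp add: euclidean_representation)
    also have "\<dots> = (if i = ka then 1 else 0)"
    proof -
      have "e i \<in> Basis" using that eB by auto
      moreover have "e i = a \<longleftrightarrow> i = ka" using that ka eq by auto
      ultimately show ?thesis using assms(2) by (simp add: inner_Basis)
    qed
    finally show ?thesis .
  qed
  have "vec_index x kb * Determinant.det A = Determinant.det (replace_col A (A *\<^sub>v x) kb)"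
    using cramer_lemma_mat[OF A x kb(1)] by simp
  also have "replace_col A (A *\<^sub>v x) kb = mat n n (\<lambda>(i, j).
      if e j = b then (if e i = a then 1 else 0) else G (e i) (e j))"
    unfolding replace_col_def using Ax ka kb eq by (intro eq_matI) (auto simp: A_def)
  finally show ?thesis
    using kb by (simp add: gram_inv_sharp x_def A_def gram_det_eq_det_on det_on_reindex[OF _ e] det_on_eq_det)
qed

lemma posdef_cyl:
  assumes "posdef G" "c > 0"
  shows "posdef (\<lambda>(s, v) (t, w). c * (s * t + G v w))"
proof -
  have bl: "bilinear G" and sym: "\<And>v w. G v w = G w v" and pos: "\<And>v. v \<noteq> 0 \<Longrightarrow> G v v > 0"
    using assms by (auto simp: posdef_def)
  have l2: "linear (G v)" for v using bl by (simp add: bilinear_def)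
  have l1: "linear (\<lambda>v. G v w)" for w using bl by (simp add: bilinear_def)
  have nn: "G v v \<ge> 0" for v using pos[of v] linear_0[OF l2] by (cases "v = 0") (auto intro: less_imp_le)
  show ?thesis
    unfolding posdef_def bilinear_def
  proof (intro conjI allI impI)
    fix q :: "real \<times> 'a"
    show "linear (\<lambda>r. (case q of (s, v) \<Rightarrow> \<lambda>(t, w). c * (s * t + G v w)) r)"
      by (rule linearI)
        (auto simp: linear_add[OF l2] linear_cmul[OF l2] algebra_simps split: prod.splits)
    show "linear (\<lambda>r. (case r of (s, v) \<Rightarrow> \<lambda>(t, w). c * (s * t + G v w)) q)"
      by (rule linearI)
        (auto simp: linear_add[OF l1] linear_cmul[OF l1] algebra_simps split: prod.splits)
    show "(case q of (s, v) \<Rightarrow> \<lambda>(t, w). c * (s * t + G v w)) r =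
      (case r of (s, v) \<Rightarrow> \<lambda>(t, w). c * (s * t + G v w)) q" for r
      by (auto simp: sym mult.commute split: prod.splits)
    assume "q \<noteq> 0"
    then obtain s v where q: "q = (s, v)" "s \<noteq> 0 \<or> v \<noteq> 0"
      by (cases q) (auto simp: zero_prod_def)
    have "0 < s * s + G v v"
    proof (cases "s = 0")
      case True then show ?thesis using q pos by auto
    next
      case False
      then have "0 < s * s" by (metis not_real_square_gt_zero)
      then show ?thesis using nn[of v] by linarith
    qed
    then show "0 < (case q of (s, v) \<Rightarrow> \<lambda>(t, w). c * (s * t + G v w)) q"
      using assms(2) by (simp add: q)
  qed
qed

lemma Basis_real_prod: "(Basis :: (real \<times> 'e::euclidean_space) set) = insert (1, 0) (Pair 0 ` Basis)"
  by (auto simp: Basis_prod_def)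

lemma gram_det_scale:
  "gram_det (\<lambda>v w. c * G v w) = c ^ DIM('e) * gram_det (G :: 'e::euclidean_space \<Rightarrow> 'e \<Rightarrow> real)"
  by (simp add: gram_det_eq_det_on det_on_scale)

text \<open>
  The direction \<open>(1, 0)\<close> is orthogonal to the others, so the determinant splits off one factor \<open>c\<close>.
\<close>

lemma gram_det_cyl:
  assumes "bilinear (G :: 'e::euclidean_space \<Rightarrow> 'e \<Rightarrow> real)"
  shows "gram_det (\<lambda>(s, v) (t, w). c * (s * t + G v w)) = c ^ (DIM('e) + 1) * gram_det G"
proof -
  have z: "G 0 w = 0" for w using assms by (rule bilinear_lzero)
  have bij: "bij_betw (Pair (0::real)) (Basis :: 'e set) (Pair 0 ` Basis)"
    by (auto simp: bij_betw_def inj_on_def)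
  have "gram_det (\<lambda>(s, v) (t, w). c * (s * t + G v w)) =
      det_on (insert (1, 0) (Pair 0 ` Basis)) (\<lambda>(s, v) (t, w). c * (s * t + G v w))"
    by (simp add: gram_det_eq_det_on Basis_real_prod)
  also have "\<dots> = c * det_on (Pair 0 ` Basis) (\<lambda>(s, v) (t, w). c * (s * t + G v w))"
    by (subst det_on_insert_block) (auto simp: z)
  also have "\<dots> = c * det_on Basis (\<lambda>v w. c * G v w)"
    by (subst det_on_reindex[OF _ bij]) auto
  finally show ?thesis by (simp add: det_on_scale gram_det_eq_det_on)
qed

lemma sharp_cyl:
  assumes "posdef G" "c > 0"
  shows "sharp (\<lambda>(s, v) (t, w). c * (s * t + G v w)) (s0, a) = (s0 / c, sharp G a /\<^sub>R c)"
proof (rule sharp_eqI[OF posdef_cyl[OF assms]])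
  fix w :: "real \<times> 'a"
  have l1: "linear (\<lambda>v. G v w)" for w using assms(1) by (simp add: posdef_def bilinear_def)
  show "(case (s0 / c, sharp G a /\<^sub>R c) of (s, v) \<Rightarrow> \<lambda>(t, w). c * (s * t + G v w)) w = w \<bullet> (s0, a)"
    using assms(2) by (cases w) (simp add: linear_cmul[OF l1] sharp[OF assms(1)] field_simps)
qed

lemma gram_inv_cyl:
  assumes "posdef G" "c > 0"
  shows "gram_inv (\<lambda>(s, v) (t, w). c * (s * t + G v w)) (s, a) (t, b) =
    (s * t + sharp G a \<bullet> b) / c"
  unfolding gram_inv_sharp sharp_cyl[OF assms] using assms(2) by (simp add: field_simps)

section \<open>Functions of class C^k relative to a set\<close>

text \<open>
  From every point, and for every coordinate axis, there are arbitrarily small steps along the axis that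
  stay in \<open>S\<close>; this makes derivatives within \<open>S\<close> unique.
\<close>

definition uniq_deriv :: "'a::euclidean_space set \<Rightarrow> bool" where
  "uniq_deriv S \<longleftrightarrow> (\<forall>z\<in>S. \<forall>i\<in>Basis. \<forall>e>0. \<exists>d. 0 < \<bar>d\<bar> \<and> \<bar>d\<bar> < e \<and> z + d *\<^sub>R i \<in> S)"

lemma frechet_derivative_within_eq:
  assumes "uniq_deriv S" "z \<in> S" "(h has_derivative D) (at z within S)"
  shows "frechet_derivative h (at z within S) = D"
proof -
  have "(h has_derivative frechet_derivative h (at z within S)) (at z within S)"
    using assms(3) differentiableI frechet_derivative_works by blast
  then show ?thesis
    using frechet_derivative_unique_within[OF _ assms(3)] assms(1,2)
    unfolding uniq_deriv_def by blast
qed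

lemma pd_eq:
  assumes "uniq_deriv S" "z \<in> S" "(h has_derivative D) (at z within S)"
  shows "pd S h a z = D a"
  by (simp add: pd_def frechet_derivative_within_eq[OF assms])

lemma has_derivative_pd:
  fixes h :: "'a::euclidean_space \<Rightarrow> 'b::real_normed_vector"
  assumes "h differentiable (at z within S)"
  shows "(h has_derivative (\<lambda>v. \<Sum>a\<in>Basis. (v \<bullet> a) *\<^sub>R pd S h a z)) (at z within S)"
proof -
  define D where "D = frechet_derivative h (at z within S)"
  have D: "(h has_derivative D) (at z within S)"
    using assms frechet_derivative_works D_def by blast
  then have "linear D" by (rule has_derivative_linear)
  have "D v = (\<Sum>a\<in>Basis. (v \<bullet> a) *\<^sub>R pd S h a z)" for v
  proof -
    have "D v = D (\<Sum>a\<in>Basis. (v \<bullet> a) *\<^sub>R a)" by (simp add: euclidean_representation)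
    then show ?thesis
      by (simp add: linear_sum[OF \<open>linear D\<close>] linear_cmul[OF \<open>linear D\<close>] pd_def D_def[symmetric])
  qed
  then have "D = (\<lambda>v. \<Sum>a\<in>Basis. (v \<bullet> a) *\<^sub>R pd S h a z)" by (rule ext)
  with D show ?thesis by (rule subst[rotated])
qed

lemma uniq_deriv_open:
  assumes "open S" shows "uniq_deriv S"
  unfolding uniq_deriv_def
proof (intro ballI allI impI)
  fix z i e assume z: "z \<in> S" "i \<in> (Basis :: 'a set)" "(e::real) > 0"
  obtain r where r: "r > 0" "ball z r \<subseteq> S" using assms z(1) openE by blast
  define d where "d = min r e / 2"
  have "0 < d" "d < e" "d < r" using r z by (auto simp: d_def min_def)
  then have "z + d *\<^sub>R i \<in> ball z r" using z(2) by (simp add: dist_norm)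
  then show "\<exists>d. 0 < \<bar>d\<bar> \<and> \<bar>d\<bar> < e \<and> z + d *\<^sub>R i \<in> S"
    using r \<open>0 < d\<close> \<open>d < e\<close> by (intro exI[of _ d]) auto
qed

lemma uniq_deriv_unit_interval: "uniq_deriv {0..1::real}"
  unfolding uniq_deriv_def
proof (intro ballI allI impI)
  fix z i e :: real assume z: "z \<in> {0..1}" "i \<in> Basis" "e > 0"
  define d where "d = (if z < 1/2 then min (1/2) (e/2) else - min (1/2) (e/2))"
  show "\<exists>d. 0 < \<bar>d\<bar> \<and> \<bar>d\<bar> < e \<and> z + d *\<^sub>R i \<in> {0..1}"
    using z by (intro exI[of _ d]) (auto simp: d_def min_def)
qed

lemma uniq_deriv_Times:
  assumes "uniq_deriv A" "uniq_deriv B" shows "uniq_deriv (A \<times> B)"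
  using assms unfolding uniq_deriv_def Basis_prod_def by fastforce

lemma Ck_on_cong_imp:
  assumes "\<And>z. z \<in> S \<Longrightarrow> h z = k z"
  shows "Ck_on n S h \<Longrightarrow> Ck_on n S k"
  using assms
proof (induction n arbitrary: h k)
  case 0 then show ?case using continuous_on_cong[of S S h k] by simp
next
  case (Suc n)
  have hd: "(h has_derivative D) (at z within S) = (k has_derivative D) (at z within S)"
    if "z \<in> S" for z D
    using Suc.prems(2) that by (metis has_derivative_transform)
  have "pd S h a z = pd S k a z" if "z \<in> S" for a z
    using hd[OF that] by (simp add: pd_def frechet_derivative_def)
  then have "Ck_on n S (pd S k a)" if "a \<in> Basis" for a
    using Suc.IH[of "pd S h a" "pd S k a"] Suc.prems(1) that by auto
  moreover have "k differentiable_on S"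
    using Suc.prems(1) hd by (auto simp: differentiable_on_def differentiable_def)
  ultimately show ?case by simp
qed

lemma Ck_on_cong:
  assumes "\<And>z. z \<in> S \<Longrightarrow> h z = k z"
  shows "Ck_on n S h \<longleftrightarrow> Ck_on n S k"
  using Ck_on_cong_imp[of S h k n] Ck_on_cong_imp[of S k h n] assms by auto

lemma Ck_on_Suc_lower: "Ck_on (Suc n) S h \<Longrightarrow> Ck_on n S h"
  by (induction n arbitrary: h) (auto intro: differentiable_imp_continuous_on)

lemma Ck_on_lower: "Ck_on n S h \<Longrightarrow> m \<le> n \<Longrightarrow> Ck_on m S h"
  by (induction n) (metis le_zero_eq, metis Ck_on_Suc_lower le_Suc_eq)

text \<open>
  A derivative found by any means may replace \<open>frechet_derivative\<close> in the recursive definition of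
  \<open>Ck_on\<close>; the closure properties below rest on this rule.
\<close>

lemma Ck_on_SucI:
  assumes "uniq_deriv S" "\<And>z. z \<in> S \<Longrightarrow> (h has_derivative D z) (at z within S)"
    and "\<And>a. a \<in> Basis \<Longrightarrow> Ck_on n S (\<lambda>z. D z a)"
  shows "Ck_on (Suc n) S h"
proof -
  have "Ck_on n S (pd S h a)" if "a \<in> Basis" for a
    using pd_eq[OF assms(1) _ assms(2)]
    by (intro Ck_on_cong_imp[OF _ assms(3)[OF that]]) auto
  then show ?thesis
    using assms(2) by (auto simp: differentiable_on_def differentiable_def)
qed

lemma Ck_on_Suc_has_derivative:
  assumes "Ck_on (Suc n) S h" "z \<in> S"
  shows "(h has_derivative frechet_derivative h (at z within S)) (at z within S)"
  using assms by (simp add: differentiable_on_def frechet_derivative_works[symmetric])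

lemma Ck_on_Suc_frechet_derivative:
  assumes "Ck_on (Suc n) S h" "a \<in> Basis"
  shows "Ck_on n S (\<lambda>z. frechet_derivative h (at z within S) a)"
  using assms by (simp add: pd_def[abs_def])

lemma Ck_on_1: "Ck_on 1 S h \<longleftrightarrow> h differentiable_on S \<and> (\<forall>a\<in>Basis. continuous_on S (pd S h a))"
  by simp

lemma Ck_on_continuous: "Ck_on n S h \<Longrightarrow> continuous_on S h"
  using Ck_on_lower[of n S h 0] by simp

lemma Ck_on_const: "uniq_deriv S \<Longrightarrow> Ck_on n S (\<lambda>z. c)"
proof (induction n arbitrary: c)
  case (Suc n)
  show ?case
    by (rule Ck_on_SucI[OF Suc.prems has_derivative_const]) (use Suc in auto)
qed auto

lemma Ck_on_add:
  assumes "uniq_deriv S" "Ck_on n S f" "Ck_on n S g"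
  shows "Ck_on n S (\<lambda>z. f z + g z)"
  using assms(2,3)
proof (induction n arbitrary: f g)
  case 0 then show ?case by (auto intro: continuous_intros)
next
  case (Suc n)
  show ?case
  proof (rule Ck_on_SucI[OF assms(1)])
    fix z assume "z \<in> S"
    then show "((\<lambda>z. f z + g z) has_derivative
       (\<lambda>v. frechet_derivative f (at z within S) v + frechet_derivative g (at z within S) v)) (at z within S)"
      using Suc.prems by (intro has_derivative_add Ck_on_Suc_has_derivative)
  next
    fix a :: 'a assume "a \<in> Basis"
    then show "Ck_on n S (\<lambda>z. frechet_derivative f (at z within S) a + frechet_derivative g (at z within S) a)"
      using Suc.IH[of "pd S f a" "pd S g a"] Suc.prems by (simp add: pd_def[abs_def])
  qed
qed

lemma (in bounded_bilinear) Ck_on: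
  fixes f :: "'d::euclidean_space \<Rightarrow> 'a" and g :: "'d \<Rightarrow> 'b"
  assumes "uniq_deriv S" "Ck_on n S f" "Ck_on n S g"
  shows "Ck_on n S (\<lambda>z. prod (f z) (g z))"
  using assms(2,3)
proof (induction n arbitrary: f g)
  case 0 then show ?case by (auto intro: continuous_on)
next
  case (Suc n)
  show ?case
  proof (rule Ck_on_SucI[OF assms(1)])
    fix z assume "z \<in> S"
    then show "((\<lambda>z. prod (f z) (g z)) has_derivative
       (\<lambda>v. prod (f z) (frechet_derivative g (at z within S) v) +
            prod (frechet_derivative f (at z within S) v) (g z))) (at z within S)"
      using Suc.prems by (intro FDERIV Ck_on_Suc_has_derivative)
  next
    fix a :: 'd assume "a \<in> Basis"
    then show "Ck_on n S (\<lambda>z. prod (f z) (frechet_derivative g (at z within S) a) +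
            prod (frechet_derivative f (at z within S) a) (g z))"
      using Suc.prems
      by (intro Ck_on_add[OF assms(1)] Suc.IH Ck_on_Suc_frechet_derivative Ck_on_Suc_lower[of n])
  qed
qed

lemma (in bounded_linear) Ck_on:
  fixes g :: "'d::euclidean_space \<Rightarrow> 'a"
  assumes "uniq_deriv S" "Ck_on n S g"
  shows "Ck_on n S (\<lambda>z. f (g z))"
  using assms(2)
proof (induction n arbitrary: g)
  case 0 then show ?case by (auto intro: continuous_on)
next
  case (Suc n)
  show ?case
  proof (rule Ck_on_SucI[OF assms(1)])
    fix z assume "z \<in> S"
    then show "((\<lambda>z. f (g z)) has_derivative (\<lambda>v. f (frechet_derivative g (at z within S) v))) (at z within S)"
      using Suc.prems by (intro has_derivative Ck_on_Suc_has_derivative)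
  next
    fix a :: 'd assume "a \<in> Basis"
    then show "Ck_on n S (\<lambda>z. f (frechet_derivative g (at z within S) a))"
      using Suc.IH[of "pd S g a"] Suc.prems by (simp add: pd_def[abs_def])
  qed
qed

lemmas Ck_on_mult = bounded_bilinear.Ck_on[OF bounded_bilinear_mult]
lemmas Ck_on_scaleR = bounded_bilinear.Ck_on[OF bounded_bilinear_scaleR]
lemmas Ck_on_of_real = bounded_linear.Ck_on[OF bounded_linear_of_real]
lemmas Ck_on_cnj = bounded_linear.Ck_on[OF bounded_linear_cnj]

lemma Ck_on_sum:
  assumes "uniq_deriv S" "\<And>i. i \<in> I \<Longrightarrow> Ck_on n S (f i)"
  shows "Ck_on n S (\<lambda>z. \<Sum>i\<in>I. f i z)"
  using assms(2)
  by (induction I rule: infinite_finite_induct) (auto intro: Ck_on_const Ck_on_add assms(1))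

lemma Ck_on_prod:
  fixes f :: "'i \<Rightarrow> 'a::euclidean_space \<Rightarrow> real"
  assumes "uniq_deriv S" "\<And>i. i \<in> I \<Longrightarrow> Ck_on n S (f i)"
  shows "Ck_on n S (\<lambda>z. \<Prod>i\<in>I. f i z)"
  using assms(2)
  by (induction I rule: infinite_finite_induct) (auto intro: Ck_on_const Ck_on_mult assms(1))

lemma Ck_on_powr:
  assumes "uniq_deriv S" "Ck_on n S f" "\<And>z. z \<in> S \<Longrightarrow> f z > (0::real)"
  shows "Ck_on n S (\<lambda>z. f z powr s)"
  using assms(2)
proof (induction n arbitrary: s)
  case 0 then show ?case using assms(3) by (force intro!: continuous_intros)
next
  case (Suc n)
  show ?case
  proof (rule Ck_on_SucI[OF assms(1)])
    fix z assume z: "z \<in> S"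
    then have "(f has_derivative frechet_derivative f (at z within S)) (at z within S)"
      using Suc.prems by (intro Ck_on_Suc_has_derivative) auto
    moreover have "((\<lambda>y. y powr s) has_derivative (\<lambda>h. h * (s * f z powr (s - 1)))) (at (f z))"
      using has_real_derivative_powr[OF assms(3)[OF z], of s, unfolded has_field_derivative_def]
      by (rule has_derivative_eq_rhs) (auto simp: fun_eq_iff mult_ac)
    ultimately show "((\<lambda>z. f z powr s) has_derivative
        (\<lambda>v. frechet_derivative f (at z within S) v * (s * f z powr (s - 1)))) (at z within S)"
      by (rule has_derivative_compose)
  next
    fix a :: 'a assume "a \<in> Basis"
    then show "Ck_on n S (\<lambda>z. frechet_derivative f (at z within S) a * (s * f z powr (s - 1)))"
      using Suc.IH[of "s - 1"] Suc.prems Ck_on_Suc_lower[OF Suc.prems] assms(1)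
      by (intro Ck_on_mult Ck_on_const) (auto simp: pd_def[abs_def])
  qed
qed

lemma Ck_on_inverse:
  assumes "uniq_deriv S" "Ck_on n S f" "\<And>z. z \<in> S \<Longrightarrow> f z > (0::real)"
  shows "Ck_on n S (\<lambda>z. inverse (f z))"
  using Ck_on_powr[OF assms, of "-1"] assms(3)
  by (subst Ck_on_cong[where k="\<lambda>z. f z powr -1"]) (auto simp: powr_minus less_imp_le)

lemma Ck_on_sqrt:
  assumes "uniq_deriv S" "Ck_on n S f" "\<And>z. z \<in> S \<Longrightarrow> f z > (0::real)"
  shows "Ck_on n S (\<lambda>z. sqrt (f z))"
  using Ck_on_powr[OF assms, of "1/2"] assms(3)
  by (subst Ck_on_cong[where k="\<lambda>z. f z powr (1/2)"]) (auto simp: powr_half_sqrt less_imp_le)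

lemma Ck_on_fst:
  fixes A :: "'a::euclidean_space set" and B :: "'b::euclidean_space set"
  assumes "uniq_deriv A" "uniq_deriv B" "Ck_on n A h"
  shows "Ck_on n (A \<times> B) (\<lambda>q. h (fst q))"
  using assms(3)
proof (induction n arbitrary: h)
  case 0 then show ?case by (auto intro!: continuous_on_compose2[OF _ continuous_on_fst])
next
  case (Suc n)
  show ?case
  proof (rule Ck_on_SucI[OF uniq_deriv_Times[OF assms(1,2)]])
    fix q assume q: "q \<in> A \<times> B"
    then have "(h has_derivative frechet_derivative h (at (fst q) within A)) (at (fst q) within A)"
      using Suc.prems by (intro Ck_on_Suc_has_derivative) auto
    then have "(h has_derivative frechet_derivative h (at (fst q) within A)) (at (fst q) within fst ` (A \<times> B))"
      by (rule has_derivative_subset) auto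
    then show "((\<lambda>q. h (fst q)) has_derivative (\<lambda>v. frechet_derivative h (at (fst q) within A) (fst v))) (at q within A \<times> B)"
      using has_derivative_in_compose[of fst fst q "A \<times> B" h] by (simp add: has_derivative_fst[OF has_derivative_ident])
  next
    fix a :: "'a \<times> 'b" assume "a \<in> Basis"
    then consider "fst a \<in> Basis" | "fst a = 0" by (auto simp: Basis_prod_def)
    then show "Ck_on n (A \<times> B) (\<lambda>q. frechet_derivative h (at (fst q) within A) (fst a))"
    proof cases
      case 1
      then show ?thesis using Suc.IH[OF Ck_on_Suc_frechet_derivative[OF Suc.prems]] by simp
    next
      case 2
      have "frechet_derivative h (at (fst q) within A) 0 = 0" if "q \<in> A \<times> B" for q
      proof -
        have "linear (frechet_derivative h (at (fst q) within A))"
          using Suc.prems that by (intro linear_frechet_derivative) (auto simp: differentiable_on_def)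
        then show ?thesis by (rule linear_0)
      qed
      then show ?thesis
        unfolding 2
        by (intro Ck_on_cong_imp[OF _ Ck_on_const[OF uniq_deriv_Times[OF assms(1,2)], of n 0]]) auto
    qed
  qed
qed

lemma Ck_on_snd:
  fixes A :: "'a::euclidean_space set" and B :: "'b::euclidean_space set"
  assumes "uniq_deriv A" "uniq_deriv B" "Ck_on n B h"
  shows "Ck_on n (A \<times> B) (\<lambda>q. h (snd q))"
  using assms(3)
proof (induction n arbitrary: h)
  case 0 then show ?case by (auto intro!: continuous_on_compose2[OF _ continuous_on_snd])
next
  case (Suc n)
  show ?case
  proof (rule Ck_on_SucI[OF uniq_deriv_Times[OF assms(1,2)]])
    fix q assume q: "q \<in> A \<times> B"
    then have "(h has_derivative frechet_derivative h (at (snd q) within B)) (at (snd q) within B)"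
      using Suc.prems by (intro Ck_on_Suc_has_derivative) auto
    then have "(h has_derivative frechet_derivative h (at (snd q) within B)) (at (snd q) within snd ` (A \<times> B))"
      by (rule has_derivative_subset) auto
    then show "((\<lambda>q. h (snd q)) has_derivative (\<lambda>v. frechet_derivative h (at (snd q) within B) (snd v))) (at q within A \<times> B)"
      using has_derivative_in_compose[of snd snd q "A \<times> B" h] by (simp add: has_derivative_snd[OF has_derivative_ident])
  next
    fix a :: "'a \<times> 'b" assume "a \<in> Basis"
    then consider "snd a \<in> Basis" | "snd a = 0" by (auto simp: Basis_prod_def)
    then show "Ck_on n (A \<times> B) (\<lambda>q. frechet_derivative h (at (snd q) within B) (snd a))"
    proof cases
      case 1
      then show ?thesis using Suc.IH[OF Ck_on_Suc_frechet_derivative[OF Suc.prems]] by simp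
    next
      case 2
      have "frechet_derivative h (at (snd q) within B) 0 = 0" if "q \<in> A \<times> B" for q
      proof -
        have "linear (frechet_derivative h (at (snd q) within B))"
          using Suc.prems that by (intro linear_frechet_derivative) (auto simp: differentiable_on_def)
        then show ?thesis by (rule linear_0)
      qed
      then show ?thesis
        unfolding 2
        by (intro Ck_on_cong_imp[OF _ Ck_on_const[OF uniq_deriv_Times[OF assms(1,2)], of n 0]]) auto
    qed
  qed
qed

lemma Ck_on_subset_1:
  assumes "uniq_deriv S" "uniq_deriv T" "T \<subseteq> S" "Ck_on 1 S h"
  shows "Ck_on 1 T h"
proof -
  have "Ck_on (Suc 0) T h"
  proof (rule Ck_on_SucI[OF assms(2)])
    fix z assume "z \<in> T"
    then have "h differentiable (at z within S)"
      using assms(3,4) by (auto simp: differentiable_on_def)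
    then show "(h has_derivative (frechet_derivative h (at z within S))) (at z within T)"
      using frechet_derivative_works has_derivative_subset assms(3) by blast
  next
    fix a :: 'a assume "a \<in> Basis"
    then show "Ck_on 0 T (\<lambda>z. frechet_derivative h (at z within S) a)"
      using assms(3,4) by (auto simp: pd_def[abs_def] intro: continuous_on_subset)
  qed
  then show ?thesis by simp
qed

lemma pd_compose:
  fixes g :: "'a::euclidean_space \<Rightarrow> 'b::euclidean_space"
  assumes "uniq_deriv S" "z \<in> S" "(g has_derivative D) (at z within S)" "g ` S \<subseteq> T"
    and "h differentiable (at (g z) within T)"
  shows "((h \<circ> g) has_derivative (\<lambda>v. \<Sum>b\<in>Basis. (D v \<bullet> b) *\<^sub>R pd T h b (g z))) (at z within S)"
    and "pd S (h \<circ> g) a z = (\<Sum>b\<in>Basis. (D a \<bullet> b) *\<^sub>R pd T h b (g z))"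
proof -
  have "(h has_derivative (\<lambda>v. \<Sum>a\<in>Basis. (v \<bullet> a) *\<^sub>R pd T h a (g z))) (at (g z) within g ` S)"
    by (rule has_derivative_subset[OF has_derivative_pd[OF assms(5)] assms(4)])
  from has_derivative_in_compose[OF assms(3) this]
  show *: "((h \<circ> g) has_derivative (\<lambda>v. \<Sum>b\<in>Basis. (D v \<bullet> b) *\<^sub>R pd T h b (g z))) (at z within S)"
    by (simp add: o_def)
  show "pd S (h \<circ> g) a z = (\<Sum>b\<in>Basis. (D a \<bullet> b) *\<^sub>R pd T h b (g z))"
    by (rule pd_eq[OF assms(1,2) *])
qed

lemma Ck_on_1_compose:
  fixes g :: "'a::euclidean_space \<Rightarrow> 'b::euclidean_space"
  assumes "uniq_deriv S" "Ck_on 1 S g" "g ` S \<subseteq> T" "Ck_on 1 T h"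
  shows "Ck_on 1 S (h \<circ> g)"
proof -
  have gd: "(g has_derivative frechet_derivative g (at z within S)) (at z within S)" if "z \<in> S" for z
    using assms(2) that frechet_derivative_works by (auto simp: differentiable_on_def)
  have hd: "h differentiable (at (g z) within T)" if "z \<in> S" for z
    using assms(3,4) that by (auto simp: differentiable_on_def)
  have gc: "continuous_on S g" by (rule Ck_on_continuous[OF assms(2)])
  have "Ck_on (Suc 0) S (h \<circ> g)"
  proof (rule Ck_on_SucI[OF assms(1) pd_compose(1)[OF assms(1) _ gd assms(3) hd]])
    fix a :: 'a assume a: "a \<in> Basis"
    have "continuous_on S (\<lambda>z. pd T h b (g z))" if "b \<in> Basis" for b
      using assms(3,4) that by (intro continuous_on_compose2[OF _ gc]) auto
    moreover have "continuous_on S (pd S g a)" using assms(2) a by simp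
    ultimately show "Ck_on 0 S (\<lambda>z. \<Sum>b\<in>Basis. (frechet_derivative g (at z within S) a \<bullet> b) *\<^sub>R pd T h b (g z))"
      by (auto simp: pd_def[abs_def] intro!: continuous_intros)
  qed
  then show ?thesis by simp
qed

section \<open>Inverse metrics under isometries and compactly supported functions\<close>

text \<open>
  The transformation law of the inverse metric. With \<open>v = \<Sum>\<^sub>a (D a \<bullet> c) sharp G a\<close> one has
  \<open>G v w = D w \<bullet> c\<close>, so \<open>D v\<close> represents \<open>c\<close> for \<open>H\<close>, because \<open>D\<close> is onto.
\<close>

lemma sharp_pullback:
  fixes G H :: "'e::euclidean_space \<Rightarrow> 'e \<Rightarrow> real"
  assumes G: "posdef G" and H: "posdef H" and D: "linear D"
    and GH: "\<And>v w. G v w = H (D v) (D w)"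
  shows "(\<Sum>a\<in>Basis. \<Sum>b\<in>Basis. (sharp G a \<bullet> b) * (D a \<bullet> c) * (D b \<bullet> d)) = sharp H c \<bullet> d"
proof -
  have l1: "linear (\<lambda>v. G v w)" for w using G by (simp add: posdef_def bilinear_def)
  have H0: "H 0 0 = 0" using H bilinear_lzero by (auto simp: posdef_def)
  have "inj D"
  proof (subst linear_injective_0[OF D], intro allI impI)
    fix v assume "D v = 0"
    then have "G v v = 0" using GH[of v v] H0 by simp
    then show "v = 0" using G by (fastforce simp: posdef_def)
  qed
  then have surj: "surj D" using linear_injective_imp_surjective[OF D] by simp
  define v where "v = (\<Sum>a\<in>Basis. (D a \<bullet> c) *\<^sub>R sharp G a)"
  have Db: "D s \<bullet> e = (\<Sum>b\<in>Basis. (s \<bullet> b) * (D b \<bullet> e))" for s e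
  proof -
    have "D s = D (\<Sum>b\<in>Basis. (s \<bullet> b) *\<^sub>R b)" by (simp add: euclidean_representation)
    then show ?thesis by (simp add: linear_sum[OF D] linear_cmul[OF D] inner_sum_left)
  qed
  have "G v w = D w \<bullet> c" for w
  proof -
    have "G v w = (\<Sum>a\<in>Basis. (D a \<bullet> c) * G (sharp G a) w)"
      by (simp add: v_def linear_sum[OF l1] linear_cmul[OF l1])
    also have "\<dots> = D w \<bullet> c" by (simp add: sharp[OF G] mult.commute Db[of w c])
    finally show ?thesis .
  qed
  then have "H (D v) w' = w' \<bullet> c" for w' using surj GH by (metis surjD)
  then have "sharp H c = D v" by (rule sharp_eqI[OF H])
  then have "sharp H c \<bullet> d = (\<Sum>a\<in>Basis. (D a \<bullet> c) * (D (sharp G a) \<bullet> d))"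
    by (simp add: v_def linear_sum[OF D] linear_cmul[OF D] inner_sum_left)
  also have "\<dots> = (\<Sum>a\<in>Basis. \<Sum>b\<in>Basis. (sharp G a \<bullet> b) * (D a \<bullet> c) * (D b \<bullet> d))"
    by (simp add: Db[of "sharp G _"] sum_distrib_left mult_ac)
  finally show ?thesis by simp
qed

lemma gram_inv_sym: "posdef G \<Longrightarrow> gram_inv G a b = gram_inv G b a"
  using sharp[of G a "sharp G b"] sharp[of G b "sharp G a"] inner_commute
  unfolding gram_inv_sharp posdef_def by metis

lemma Ck_on_det_on:
  assumes "uniq_deriv U" "\<And>a b. a \<in> S \<Longrightarrow> b \<in> S \<Longrightarrow> Ck_on n U (\<lambda>z. A z a b)"
  shows "Ck_on n U (\<lambda>z. det_on S (A z))"
  unfolding det_on_def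
  using assms by (intro Ck_on_sum Ck_on_mult Ck_on_const Ck_on_prod) (auto simp: permutes_in_image)

lemma pd_open: "open S \<Longrightarrow> z \<in> S \<Longrightarrow> pd S h a z = frechet_derivative h (at z) a"
  using at_within_open[of z S] by (simp add: pd_def)

lemma Ck_on_1_Un:
  assumes "open A" "open B" "Ck_on 1 A f" "Ck_on 1 B f"
  shows "Ck_on 1 (A \<union> B) f"
proof -
  have "f differentiable_on (A \<union> B)"
    unfolding differentiable_on_def
  proof
    fix z assume z: "z \<in> A \<union> B"
    then have "f differentiable (at z)"
    proof
      assume "z \<in> A"
      then show ?thesis using assms(3) at_within_open[OF _ assms(1), of z] by (auto simp: differentiable_on_def)
    next
      assume "z \<in> B"
      then show ?thesis using assms(4) at_within_open[OF _ assms(2), of z] by (auto simp: differentiable_on_def)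
    qed
    then show "f differentiable (at z within A \<union> B)"
      by (rule differentiable_at_withinI)
  qed
  moreover have "continuous_on (A \<union> B) (pd (A \<union> B) f a)" if "a \<in> Basis" for a
  proof (rule continuous_on_open_Un[OF assms(1,2)])
    have c: "continuous_on A (pd A f a)" "continuous_on B (pd B f a)" using assms(3,4) that by auto
    show "continuous_on A (pd (A \<union> B) f a)"
      by (rule continuous_on_eq[OF c(1)]) (use assms(1,2) in \<open>simp add: pd_open open_Un\<close>)
    show "continuous_on B (pd (A \<union> B) f a)"
      by (rule continuous_on_eq[OF c(2)]) (use assms(1,2) in \<open>simp add: pd_open open_Un\<close>)
  qed
  ultimately show ?thesis by simp
qed

text \<open>
  The square of the positive part is \<open>C\<^sup>1\<close> on the real line, also at \<open>0\<close>. Cutoff functions of this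
  class suffice because Green's formula involves only first derivatives of the test function.
\<close>

lemma Ck_on_1_bump: "Ck_on 1 UNIV (\<lambda>z. (max 0 (r\<^sup>2 - (z - c) \<bullet> (z - c)))\<^sup>2 :: real)"
  for c :: "'e::euclidean_space"
proof -
  have m: "((\<lambda>t. (max 0 t)\<^sup>2) has_real_derivative 2 * max 0 t) (at t)" for t :: real
  proof -
    consider "t < 0" | "t = 0" | "t > 0" by linarith
    then show ?thesis
    proof cases
      case 1
      have "((\<lambda>t::real. 0) has_real_derivative 2 * max 0 t) (at t)" using 1 by simp
      then show ?thesis
        by (rule has_field_derivative_transform_within_open[where S="{..<0}"]) (use 1 in auto)
    next
      case 3
      have "((\<lambda>t::real. t\<^sup>2) has_real_derivative 2 * max 0 t) (at t)"
        using 3 by (auto intro!: derivative_eq_intros)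
      then show ?thesis
        by (rule has_field_derivative_transform_within_open[where S="{0<..}"]) (use 3 in auto)
    next
      case 2
      have "((\<lambda>h. ((max 0 (0 + h))\<^sup>2 - (max 0 0)\<^sup>2) / h) \<longlongrightarrow> 0) (at (0::real))"
      proof (rule Lim_null_comparison[where g="\<lambda>h. \<bar>h\<bar>"])
        have *: "max 0 h * max 0 h \<le> \<bar>h\<bar> * \<bar>h\<bar>" for h :: real by (auto simp: max_def)
        show "\<forall>\<^sub>F h in at 0. norm (((max 0 (0 + h))\<^sup>2 - (max 0 0)\<^sup>2) / h) \<le> \<bar>h :: real\<bar>"
          using * by (auto simp: eventually_at_filter power2_eq_square pos_divide_le_eq abs_mult)
        show "((\<lambda>h. \<bar>h::real\<bar>) \<longlongrightarrow> 0) (at 0)" by (rule tendsto_eq_intros refl | simp)+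
      qed
      then show ?thesis unfolding DERIV_def 2 by simp
    qed
  qed
  have "Ck_on (Suc 0) UNIV (\<lambda>z. (max 0 (r\<^sup>2 - (z - c) \<bullet> (z - c)))\<^sup>2 :: real)"
  proof (rule Ck_on_SucI[OF uniq_deriv_open[OF open_UNIV]])
    fix z
    have "((\<lambda>z. r\<^sup>2 - (z - c) \<bullet> (z - c)) has_derivative (\<lambda>v. - 2 * ((z - c) \<bullet> v))) (at z)"
      by (auto intro!: derivative_eq_intros simp: inner_commute)
    from has_derivative_compose[OF this m[unfolded has_field_derivative_def]]
    show "((\<lambda>z. (max 0 (r\<^sup>2 - (z - c) \<bullet> (z - c)))\<^sup>2) has_derivative
       (\<lambda>v. 2 * max 0 (r\<^sup>2 - (z - c) \<bullet> (z - c)) * (- 2 * ((z - c) \<bullet> v)))) (at z within UNIV)"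
      by simp
  next
    fix a :: 'e
    show "Ck_on 0 UNIV (\<lambda>z. 2 * max 0 (r\<^sup>2 - (z - c) \<bullet> (z - c)) * (- 2 * ((z - c) \<bullet> a)))"
      by (auto intro!: continuous_intros)
  qed
  then show ?thesis by simp
qed

lemma frechet_derivative_zero_on_open:
  assumes "open W" "z \<in> W" "\<And>y. y \<in> W \<Longrightarrow> f y = 0"
  shows "frechet_derivative f (at z) = (\<lambda>v. 0)"
proof -
  have "(f has_derivative (\<lambda>v. 0)) (at z)"
    by (rule has_derivative_transform_within_open[OF has_derivative_const[of 0] assms(1,2)])
      (use assms(3) in auto)
  then show ?thesis using frechet_derivative_at by metis
qed

text \<open>
  By translation invariance of the Lebesgue measure every difference quotient of \<open>f\<close> has integral \<open>0\<close>;
  the quotients are bounded and supported in a common ball, so the integrals converge to that of the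
  partial derivative.
\<close>

lemma integral_pd_eq_zero:
  fixes f :: "'e::euclidean_space \<Rightarrow> complex"
  assumes f: "Ck_on 1 UNIV f" and supp: "\<And>z. z \<notin> cball c r \<Longrightarrow> f z = 0" and a: "a \<in> Basis"
  shows "integrable lborel (pd UNIV f a)" "(\<integral>z. pd UNIV f a z \<partial>lborel) = 0"
proof -
  have fd: "(f has_derivative frechet_derivative f (at z)) (at z)" for z
    using f by (simp add: differentiable_on_def frechet_derivative_works[symmetric])
  have cf: "continuous_on UNIV f" by (rule Ck_on_continuous[OF f])
  define g where "g = pd UNIV f a"
  have cg: "continuous_on UNIV g" using f a by (simp add: g_def)
  have g: "g z = frechet_derivative f (at z) a" for z by (simp add: g_def pd_def)
  have gsupp: "g z = 0" if "z \<notin> cball c r" for z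
    unfolding g using frechet_derivative_zero_on_open[OF open_Compl[OF closed_cball], of z c r f] that supp
    by simp
  have int_cont: "integrable lborel h" if "continuous_on UNIV h" "\<And>z. z \<notin> cball c s \<Longrightarrow> h z = 0"
    for h :: "'e \<Rightarrow> complex" and s
  proof -
    have "integrable lborel (\<lambda>x. indicator (cball c s) x *\<^sub>R h x)"
      by (intro borel_integrable_compact continuous_on_subset[OF that(1)]) auto
    also have "(\<lambda>x. indicator (cball c s) x *\<^sub>R h x) = h"
      using that(2) by (auto simp: indicator_def fun_eq_iff)
    finally show ?thesis .
  qed
  have "bounded (g ` cball c r)"
    by (intro compact_imp_bounded compact_continuous_image continuous_on_subset[OF cg]) auto
  then obtain M0 where M0: "\<And>z. z \<in> cball c r \<Longrightarrow> norm (g z) \<le> M0" unfolding bounded_iff by blast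
  define M where "M = max 0 M0"
  have M: "norm (g z) \<le> M" for z
    using M0[of z] gsupp[of z] by (cases "z \<in> cball c r") (auto simp: M_def)
  have lip: "norm (f (z + t *\<^sub>R a) - f z) \<le> M * t" if "0 \<le> t" for z t
  proof -
    have d: "((\<lambda>s. f (z + s *\<^sub>R a)) has_derivative (\<lambda>h. h *\<^sub>R g (z + s *\<^sub>R a))) (at s within {0..t})" for s
    proof -
      have "((\<lambda>s. z + s *\<^sub>R a) has_derivative (\<lambda>h. h *\<^sub>R a)) (at s within {0..t})"
        by (auto intro!: derivative_eq_intros)
      from has_derivative_compose[OF this fd]
      show ?thesis
        by (simp add: g linear_cmul[OF has_derivative_linear[OF fd]])
    qed
    have on: "onorm (\<lambda>h. h *\<^sub>R w) \<le> M" if "norm w \<le> M" for w :: complex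
    proof (rule onorm_bound)
      show "0 \<le> M" by (simp add: M_def)
      show "norm (h *\<^sub>R w) \<le> M * norm h" for h :: real
        using mult_left_mono[OF that, of "\<bar>h\<bar>"] by (simp add: mult.commute)
    qed
    have "norm ((\<lambda>s. f (z + s *\<^sub>R a)) t - (\<lambda>s. f (z + s *\<^sub>R a)) 0) \<le> M * norm (t - 0)"
      by (rule differentiable_bound[OF convex_real_interval(5)[of 0 t] d on[OF M]]) (use that in auto)
    then show ?thesis using that by simp
  qed
  define F where "F n z = of_nat (Suc n) * (f (z + (1 / real (Suc n)) *\<^sub>R a) - f z)" for n z
  have shift: "integrable lborel (\<lambda>z. f (z + t *\<^sub>R a))" "(\<integral>z. f (z + t *\<^sub>R a) \<partial>lborel) = (\<integral>z. f z \<partial>lborel)" for t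
  proof -
    have fi: "integrable lborel f" by (rule int_cont[OF cf supp])
    have e: "distr lborel borel ((+) (t *\<^sub>R a)) = lborel" by (rule lborel_distr_plus)
    have fm: "f \<in> borel_measurable borel" by (rule borel_measurable_continuous_onI[OF cf])
    show "integrable lborel (\<lambda>z. f (z + t *\<^sub>R a))"
      using fi integrable_distr_eq[of "(+) (t *\<^sub>R a)" lborel borel f] fm by (simp add: e add.commute)
    show "(\<integral>z. f (z + t *\<^sub>R a) \<partial>lborel) = (\<integral>z. f z \<partial>lborel)"
      using integral_distr[of "(+) (t *\<^sub>R a)" lborel borel f] fm by (simp add: e add.commute)
  qed
  have fi: "integrable lborel f" by (rule int_cont[OF cf supp])
  have intF: "(\<integral>z. F n z \<partial>lborel) = 0" for n
    unfolding F_def using shift[of "1 / real (Suc n)"] fi by (simp add: Bochner_Integration.integral_diff)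
  have lim: "(\<lambda>n. F n z) \<longlonglongrightarrow> g z" for z
  proof -
    define h where "h n = (1 / real (Suc n)) *\<^sub>R a" for n
    have "filterlim h (at 0) sequentially"
      unfolding filterlim_at
    proof
      show "\<forall>\<^sub>F n in sequentially. h n \<in> UNIV \<and> h n \<noteq> 0" using a by (auto simp: h_def)
      have "h \<longlonglongrightarrow> 0 *\<^sub>R a"
        unfolding h_def by (intro tendsto_scaleR tendsto_const) (rule LIMSEQ_Suc[OF lim_1_over_n])
      then show "h \<longlonglongrightarrow> 0" by simp
    qed
    moreover have "(\<lambda>y. norm (f (z + y) - f z - frechet_derivative f (at z) y) / norm y) \<midarrow>0\<rightarrow> 0"
      using fd[of z] by (simp add: has_derivative_at)
    ultimately have "(\<lambda>n. norm (f (z + h n) - f z - frechet_derivative f (at z) (h n)) / norm (h n)) \<longlonglongrightarrow> 0"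
      by (rule filterlim_compose[rotated])
    moreover have "norm (f (z + h n) - f z - frechet_derivative f (at z) (h n)) / norm (h n) = norm (F n z - g z)" for n
    proof -
      have "F n z - g z = of_nat (Suc n) * (f (z + h n) - f z - frechet_derivative f (at z) (h n))"
        by (simp add: F_def g h_def linear_cmul[OF has_derivative_linear[OF fd]] scaleR_conv_of_real
            field_simps del: of_nat_Suc)
      then show ?thesis using a by (simp add: h_def norm_mult del: of_nat_Suc)
    qed
    ultimately have "(\<lambda>n. norm (F n z - g z)) \<longlonglongrightarrow> 0" by simp
    then show ?thesis by (simp add: LIM_zero_cancel tendsto_norm_zero_iff)
  qed
  have bound: "norm (F n z) \<le> indicator (cball c (r + 1)) z *\<^sub>R M" for n z
  proof (cases "z \<in> cball c (r + 1)")
    case True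
    have "norm (F n z) \<le> real (Suc n) * (M * (1 / real (Suc n)))"
      unfolding F_def norm_mult norm_of_nat by (intro mult_left_mono lip) auto
    then show ?thesis using True by simp
  next
    case False
    have "z + (1 / real (Suc n)) *\<^sub>R a \<notin> cball c r"
    proof
      assume "z + (1 / real (Suc n)) *\<^sub>R a \<in> cball c r"
      then have "dist c (z + (1 / real (Suc n)) *\<^sub>R a) \<le> r" by simp
      moreover have "dist (z + (1 / real (Suc n)) *\<^sub>R a) z \<le> 1"
        using a by (simp add: dist_norm divide_le_eq)
      ultimately have "dist c z \<le> r + 1" using dist_triangle[of c z] by (smt (verit))
      then show False using False by simp
    qed
    moreover have "z \<notin> cball c r" using False by auto
    ultimately show ?thesis using supp False by (simp add: F_def)
  qed
  have "(\<lambda>n. \<integral>z. F n z \<partial>lborel) \<longlonglongrightarrow> (\<integral>z. g z \<partial>lborel)"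
  proof (rule integral_dominated_convergence[where w="\<lambda>z. indicator (cball c (r + 1)) z *\<^sub>R M"])
    show "g \<in> borel_measurable lborel" using borel_measurable_continuous_onI[OF cg] by simp
    show "F n \<in> borel_measurable lborel" for n
    proof -
      have "continuous_on UNIV (F n)"
        unfolding F_def by (intro continuous_intros continuous_on_compose2[OF cf]) auto
      then show ?thesis using borel_measurable_continuous_onI by simp
    qed
    show "integrable lborel (\<lambda>z. indicator (cball c (r + 1)) z *\<^sub>R M)"
      by (intro borel_integrable_compact) auto
  qed (use lim bound in auto)
  then show "(\<integral>z. pd UNIV f a z \<partial>lborel) = 0"
    unfolding intF g_def[symmetric] using LIMSEQ_unique tendsto_const by metis
  show "integrable lborel (pd UNIV f a)" unfolding g_def[symmetric] by (rule int_cont[OF cg gsupp])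
qed

section \<open>Charts and gradients on the closed manifold\<close>

text \<open>
  The value of \<open>grad_inner\<close> depends a priori on the chart chosen in its definition; here the chart is a
  parameter, so that independence can be stated.
\<close>

definition chart_grad ::
    "('i, 'p, 'e::euclidean_space) riem \<Rightarrow> 'i \<Rightarrow> ('p \<Rightarrow> complex) \<Rightarrow> ('p \<Rightarrow> complex) \<Rightarrow> 'e \<Rightarrow> complex" where
  "chart_grad R i u v z =
     (\<Sum>a\<in>Basis. \<Sum>b\<in>Basis. gram_inv (gform R i z) a b *\<^sub>R
        (pd (cimage R i) (u \<circ> param R i) a z * cnj (pd (cimage R i) (v \<circ> param R i) b z)))"

text \<open>
  The approximating and test functions enter only through first derivatives, and multiplication by the
  \<open>C\<^sup>1\<close> cutoff functions used below preserves this class but not smoothness.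
\<close>

definition C1_fun :: "('i, 'p, 'e::euclidean_space) riem \<Rightarrow> ('p \<Rightarrow> complex) \<Rightarrow> bool" where
  "C1_fun R u \<longleftrightarrow> (\<forall>i\<in>idx R. Ck_on 1 (cimage R i) (u \<circ> param R i))"

lemma smooth_fun_imp_C1_fun: "smooth_fun R u \<Longrightarrow> C1_fun R u"
  unfolding smooth_fun_def C1_fun_def smooth_on_def by blast

locale closed_manifold =
  fixes K :: "('i, 'k::{t2_space, second_countable_topology}, 'e::euclidean_space) riem"
    and VK :: "'k measure"
  assumes manifold: "closed_connected_riemannian_manifold K" and vol: "riemannian_volume K VK"
begin

lemma compact_UNIV: "compact (UNIV :: 'k set)"
  using manifold by (simp add: closed_connected_riemannian_manifold_def)

lemma points_UNIV: "points K = UNIV"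
  using manifold by (simp add: closed_connected_riemannian_manifold_def)

lemma ex_chart: "\<exists>i\<in>idx K. p \<in> patch K i"
  using points_UNIV by (auto simp: points_def)

lemma chart:
  assumes "i \<in> idx K"
  shows "open (patch K i)" "open (cimage K i)"
    "homeomorphism (patch K i) (cimage K i) (coord K i) (param K i)"
  using manifold assms by (auto simp: closed_connected_riemannian_manifold_def smooth_atlas_def)

lemma uniq_cimage: "i \<in> idx K \<Longrightarrow> uniq_deriv (cimage K i)"
  by (rule uniq_deriv_open[OF chart(2)])

lemma param_coord: "i \<in> idx K \<Longrightarrow> p \<in> patch K i \<Longrightarrow> param K i (coord K i p) = p"
  using chart(3) by (metis homeomorphism_apply1)

lemma coord_param: "i \<in> idx K \<Longrightarrow> z \<in> cimage K i \<Longrightarrow> coord K i (param K i z) = z"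
  using chart(3) by (metis homeomorphism_apply2)

lemma param_in: "i \<in> idx K \<Longrightarrow> z \<in> cimage K i \<Longrightarrow> param K i z \<in> patch K i"
  using chart(3) by (metis homeomorphism_image2 image_eqI)

lemma coord_in: "p \<in> patch K i \<Longrightarrow> coord K i p \<in> cimage K i"
  by (simp add: cimage_def)

lemma continuous_coord: "i \<in> idx K \<Longrightarrow> continuous_on (patch K i) (coord K i)"
  using chart(3) by (simp add: homeomorphism_def)

lemma continuous_param: "i \<in> idx K \<Longrightarrow> continuous_on (cimage K i) (param K i)"
  using chart(3) by (simp add: homeomorphism_def)

lemma open_coord_image:
  assumes "i \<in> idx K" "open V" "V \<subseteq> patch K i"
  shows "open (coord K i ` V)"
proof -
  have "coord K i ` V = cimage K i \<inter> param K i -` V"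
    using assms(1,3) by (auto simp: param_coord coord_in) (metis IntI coord_param image_eqI)
  then show ?thesis
    using continuous_open_preimage[OF continuous_param chart(2)] assms(1,2) by simp
qed

lemma open_param_image:
  assumes "i \<in> idx K" "open V" "V \<subseteq> cimage K i"
  shows "open (param K i ` V)"
proof -
  have "param K i ` V = patch K i \<inter> coord K i -` V"
    using assms(1,3) by (auto simp: coord_param param_in subset_iff) (metis image_eqI param_coord)
  then show ?thesis
    using continuous_open_preimage[OF continuous_coord chart(1)] assms(1,2) by simp
qed

lemma metric: "riemannian_metric K"
  using manifold by (simp add: closed_connected_riemannian_manifold_def)

lemma posdef_gform: "i \<in> idx K \<Longrightarrow> z \<in> cimage K i \<Longrightarrow> posdef (gform K i z)"
  using metric unfolding riemannian_metric_def posdef_def by blast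

lemma smooth_gform: "i \<in> idx K \<Longrightarrow> Ck_on n (cimage K i) (\<lambda>z. gform K i z v w)"
  using metric unfolding riemannian_metric_def smooth_on_def by blast

lemma gform_transition:
  assumes "i \<in> idx K" "j \<in> idx K" "p \<in> patch K i" "p \<in> patch K j"
  shows "gform K i (coord K i p) v w = gform K j (coord K j p)
    (frechet_derivative (coord K j \<circ> param K i) (at (coord K i p)) v)
    (frechet_derivative (coord K j \<circ> param K i) (at (coord K i p)) w)"
  using metric assms unfolding riemannian_metric_def Let_def by blast

lemma smooth_transition:
  "i \<in> idx K \<Longrightarrow> j \<in> idx K \<Longrightarrow>
    Ck_on n (coord K i ` (patch K i \<inter> patch K j)) (coord K j \<circ> param K i)"
  using manifold
  by (auto simp: closed_connected_riemannian_manifold_def smooth_atlas_def smooth_on_def)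

lemma open_overlap: "i \<in> idx K \<Longrightarrow> j \<in> idx K \<Longrightarrow> open (coord K i ` (patch K i \<inter> patch K j))"
  by (rule open_coord_image) (auto intro: chart(1))

lemma Ck_on_gram_det: "i \<in> idx K \<Longrightarrow> Ck_on n (cimage K i) (\<lambda>z. gram_det (gform K i z))"
  unfolding gram_det_eq_det_on by (intro Ck_on_det_on uniq_cimage smooth_gform)

lemma gram_det_pos: "i \<in> idx K \<Longrightarrow> z \<in> cimage K i \<Longrightarrow> gram_det (gform K i z) > 0"
  by (rule posdef_gram_det_pos[OF posdef_gform])

lemma Ck_on_vdens: "i \<in> idx K \<Longrightarrow> Ck_on n (cimage K i) (vdens K i)"
  unfolding vdens_def[abs_def] by (intro Ck_on_sqrt uniq_cimage Ck_on_gram_det gram_det_pos)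

lemma vdens_pos: "i \<in> idx K \<Longrightarrow> z \<in> cimage K i \<Longrightarrow> vdens K i z > 0"
  unfolding vdens_def using gram_det_pos by simp

text \<open>
  By Cramer's rule and positivity of the Gram determinant.
\<close>

lemma Ck_on_gram_inv:
  assumes i: "i \<in> idx K" and ab: "a \<in> Basis" "b \<in> Basis"
  shows "Ck_on n (cimage K i) (\<lambda>z. gram_inv (gform K i z) a b)"
proof -
  have "Ck_on n (cimage K i) (\<lambda>z.
      det_on Basis (\<lambda>c d. if d = b then (if c = a then 1 else 0) else gform K i z c d) *
      inverse (gram_det (gform K i z)))"
  proof (intro Ck_on_mult Ck_on_det_on Ck_on_inverse uniq_cimage i Ck_on_gram_det gram_det_pos)
    fix c d :: 'e
    show "Ck_on n (cimage K i) (\<lambda>z. if d = b then (if c = a then 1 else 0) else gform K i z c d)"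
      by (cases "d = b") (auto intro: Ck_on_const uniq_cimage i smooth_gform)
  qed auto
  then show ?thesis
  proof (rule Ck_on_cong_imp[rotated])
    fix z assume z: "z \<in> cimage K i"
    show "det_on Basis (\<lambda>c d. if d = b then (if c = a then 1 else 0) else gform K i z c d) *
        inverse (gram_det (gform K i z)) = gram_inv (gform K i z) a b"
      using gram_inv_cramer[OF posdef_gform[OF i z] ab] gram_det_pos[OF i z]
      by (simp add: field_simps)
  qed
qed

lemma C1_fun_D: "C1_fun K u \<Longrightarrow> i \<in> idx K \<Longrightarrow> Ck_on 1 (cimage K i) (u \<circ> param K i)"
  by (simp add: C1_fun_def)

lemma continuous_C1_fun:
  assumes "C1_fun K u" shows "continuous_on UNIV u"
proof -
  have "continuous_on (\<Union>i\<in>idx K. patch K i) u"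
  proof (rule continuous_on_open_UN)
    fix i assume i: "i \<in> idx K"
    have "continuous_on (patch K i) ((u \<circ> param K i) \<circ> coord K i)"
      by (rule continuous_on_compose[OF continuous_coord[OF i]])
        (use Ck_on_continuous[OF C1_fun_D[OF assms i]] in \<open>simp only: cimage_def\<close>)
    then show "continuous_on (patch K i) u"
      by (rule continuous_on_eq) (simp add: param_coord i)
  qed (use chart in auto)
  then show ?thesis using points_UNIV by (simp add: points_def)
qed

lemma continuous_on_chartwise:
  fixes F :: "'k \<Rightarrow> complex"
  assumes "\<And>i. i \<in> idx K \<Longrightarrow> continuous_on (cimage K i) (G i)"
    and "\<And>i p. i \<in> idx K \<Longrightarrow> p \<in> patch K i \<Longrightarrow> F p = G i (coord K i p)"
  shows "continuous_on UNIV F"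
proof -
  have "continuous_on (\<Union>i\<in>idx K. patch K i) F"
  proof (rule continuous_on_open_UN)
    fix i assume i: "i \<in> idx K"
    have "continuous_on (patch K i) (G i \<circ> coord K i)"
      by (rule continuous_on_compose[OF continuous_coord[OF i]])
        (use assms(1)[OF i] in \<open>simp only: cimage_def\<close>)
    then show "continuous_on (patch K i) F"
      by (rule continuous_on_eq) (simp add: assms(2)[OF i])
  qed (use chart in auto)
  then show ?thesis using points_UNIV by (simp add: points_def)
qed

text \<open>
  By the chain rule the partial derivatives in the two charts are related by the derivative \<open>D\<close> of the
  transition map, which is an isometry of the two coordinate expressions of the metric; the factors \<open>D\<close> are
  absorbed by \<open>sharp_pullback\<close>.
\<close>

lemma chart_grad_independent:
  assumes u: "C1_fun K u" and v: "C1_fun K v" and i: "i \<in> idx K" and j: "j \<in> idx K"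
    and p: "p \<in> patch K i" "p \<in> patch K j"
  shows "chart_grad K i u v (coord K i p) = chart_grad K j u v (coord K j p)"
proof -
  define W where "W = coord K i ` (patch K i \<inter> patch K j)"
  define \<tau> where "\<tau> = coord K j \<circ> param K i"
  define z where "z = coord K i p"
  define z' where "z' = coord K j p"
  define D where "D = frechet_derivative \<tau> (at z)"
  have W: "open W" "z \<in> W" "W \<subseteq> cimage K i"
    using open_overlap[OF i j] p by (auto simp: W_def z_def cimage_def)
  have z: "z \<in> cimage K i" "z' \<in> cimage K j" using p by (auto simp: z_def z'_def coord_in)
  have \<tau>z: "\<tau> z = z'" using p i by (simp add: \<tau>_def z_def z'_def param_coord)
  have \<tau>W: "\<tau> ` W \<subseteq> cimage K j" using i by (auto simp: \<tau>_def W_def param_coord coord_in)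
  have "\<tau> differentiable (at z within W)"
    using smooth_transition[OF i j, of 1] W(2)
    unfolding Ck_on_1 W_def[symmetric] \<tau>_def[symmetric] differentiable_on_def by blast
  then have dD: "(\<tau> has_derivative D) (at z within W)"
    unfolding at_within_open[OF W(2,1)] by (simp add: D_def frechet_derivative_works[symmetric])
  then have lD: "linear D" by (rule has_derivative_linear)
  have pdc: "pd (cimage K i) (h \<circ> param K i) a z = (\<Sum>c\<in>Basis. (D a \<bullet> c) *\<^sub>R pd (cimage K j) (h \<circ> param K j) c z')"
    if "C1_fun K h" for h a
  proof -
    have hd: "(h \<circ> param K j) differentiable (at (\<tau> z) within cimage K j)"
      using C1_fun_D[OF that j] z(2) by (simp add: \<tau>z differentiable_on_def)
    have "(((h \<circ> param K j) \<circ> \<tau>) has_derivative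
        (\<lambda>w. \<Sum>c\<in>Basis. (D w \<bullet> c) *\<^sub>R pd (cimage K j) (h \<circ> param K j) c (\<tau> z))) (at z within W)"
      by (rule pd_compose(1)[OF uniq_deriv_open[OF W(1)] W(2) dD \<tau>W hd])
    then have "(((h \<circ> param K j) \<circ> \<tau>) has_derivative
        (\<lambda>w. \<Sum>c\<in>Basis. (D w \<bullet> c) *\<^sub>R pd (cimage K j) (h \<circ> param K j) c (\<tau> z))) (at z)"
      using at_within_open[OF W(2,1)] by simp
    then have "((h \<circ> param K i) has_derivative
        (\<lambda>w. \<Sum>c\<in>Basis. (D w \<bullet> c) *\<^sub>R pd (cimage K j) (h \<circ> param K j) c (\<tau> z))) (at z)"
      by (rule has_derivative_transform_within_open[OF _ W(1,2)])
        (use i j in \<open>auto simp: W_def \<tau>_def param_coord\<close>)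
    from frechet_derivative_at[OF this] show ?thesis
      using pd_open[OF chart(2)[OF i] z(1)] by (simp add: \<tau>z fun_eq_iff)
  qed
  define G where "G = gform K i z"
  define H where "H = gform K j z'"
  have GH: "G v w = H (D v) (D w)" for v w
    using gform_transition[OF i j p] by (simp add: G_def H_def D_def z_def z'_def \<tau>_def)
  have pG: "posdef G" "posdef H" using posdef_gform i j z by (auto simp: G_def H_def)
  define \<alpha> where "\<alpha> c = pd (cimage K j) (u \<circ> param K j) c z'" for c
  define \<beta> where "\<beta> c = pd (cimage K j) (v \<circ> param K j) c z'" for c
  \<comment> \<open>Expand, and sum first over the indices that belong to chart \<open>i\<close>.\<close>
  have "chart_grad K i u v z = (\<Sum>a\<in>Basis. \<Sum>b\<in>Basis. of_real (sharp G a \<bullet> b) *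
       ((\<Sum>c\<in>Basis. of_real (D a \<bullet> c) * \<alpha> c) * (\<Sum>d\<in>Basis. of_real (D b \<bullet> d) * cnj (\<beta> d))))"
    by (simp add: chart_grad_def pdc[OF u] pdc[OF v] G_def gram_inv_sharp \<alpha>_def \<beta>_def scaleR_conv_of_real)
  also have "\<dots> = (\<Sum>a\<in>Basis. \<Sum>b\<in>Basis. \<Sum>c\<in>Basis. \<Sum>d\<in>Basis.
       of_real ((sharp G a \<bullet> b) * (D a \<bullet> c) * (D b \<bullet> d)) * (\<alpha> c * cnj (\<beta> d)))"
    by (intro sum.cong refl, simp only: sum_product, simp only: sum_distrib_left, intro sum.cong refl)
      (simp add: mult_ac)
  also have "\<dots> = (\<Sum>c\<in>Basis. \<Sum>d\<in>Basis. \<Sum>a\<in>Basis. \<Sum>b\<in>Basis.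
       of_real ((sharp G a \<bullet> b) * (D a \<bullet> c) * (D b \<bullet> d)) * (\<alpha> c * cnj (\<beta> d)))"
    (is "(\<Sum>a\<in>_. \<Sum>b\<in>_. \<Sum>c\<in>_. \<Sum>d\<in>_. ?T a b c d) = _")
  proof -
    have "(\<Sum>a\<in>Basis. \<Sum>b\<in>Basis. \<Sum>c\<in>Basis. \<Sum>d\<in>Basis. ?T a b c d) =
        (\<Sum>a\<in>Basis. \<Sum>c\<in>Basis. \<Sum>b\<in>Basis. \<Sum>d\<in>Basis. ?T a b c d)"
      by (intro sum.cong refl sum.swap)
    also have "\<dots> = (\<Sum>c\<in>Basis. \<Sum>a\<in>Basis. \<Sum>b\<in>Basis. \<Sum>d\<in>Basis. ?T a b c d)"
      by (rule sum.swap)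
    also have "\<dots> = (\<Sum>c\<in>Basis. \<Sum>a\<in>Basis. \<Sum>d\<in>Basis. \<Sum>b\<in>Basis. ?T a b c d)"
      by (intro sum.cong refl sum.swap)
    also have "\<dots> = (\<Sum>c\<in>Basis. \<Sum>d\<in>Basis. \<Sum>a\<in>Basis. \<Sum>b\<in>Basis. ?T a b c d)"
      by (intro sum.cong refl sum.swap)
    finally show ?thesis .
  qed
  also have "\<dots> = (\<Sum>c\<in>Basis. \<Sum>d\<in>Basis. of_real (sharp H c \<bullet> d) * (\<alpha> c * cnj (\<beta> d)))"
  proof -
    have "sharp H c \<bullet> d = (\<Sum>a\<in>Basis. \<Sum>b\<in>Basis. (sharp G a \<bullet> b) * (D a \<bullet> c) * (D b \<bullet> d))" for c d
      by (rule sharp_pullback[OF pG lD GH, symmetric])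
    then show ?thesis by (simp only: of_real_sum sum_distrib_right)
  qed
  also have "\<dots> = chart_grad K j u v z'"
    by (simp add: chart_grad_def H_def gram_inv_sharp \<alpha>_def \<beta>_def scaleR_conv_of_real)
  finally show ?thesis by (simp add: z_def z'_def)
qed

lemma grad_inner_chart:
  assumes "C1_fun K u" "C1_fun K v" "i \<in> idx K" "p \<in> patch K i"
  shows "grad_inner K u v p = chart_grad K i u v (coord K i p)"
proof -
  define j where "j = (SOME i. i \<in> idx K \<and> p \<in> patch K i)"
  have j: "j \<in> idx K \<and> p \<in> patch K j"
    unfolding j_def by (rule someI_ex) (use assms(3,4) in blast)
  have "grad_inner K u v p = chart_grad K j u v (coord K j p)"
    by (simp add: grad_inner_def chart_grad_def j_def Let_def)
  then show ?thesis using chart_grad_independent[OF assms(1,2)] assms(3,4) j by metis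
qed

lemma continuous_chart_grad:
  assumes "C1_fun K u" "C1_fun K v" "i \<in> idx K"
  shows "continuous_on (cimage K i) (chart_grad K i u v)"
proof -
  have "continuous_on (cimage K i) (\<lambda>z. gram_inv (gform K i z) a b)"
    if "a \<in> Basis" "b \<in> Basis" for a b
    by (rule Ck_on_continuous[OF Ck_on_gram_inv[OF assms(3) that, of 0]])
  moreover have "continuous_on (cimage K i) (pd (cimage K i) (u \<circ> param K i) a)"
    "continuous_on (cimage K i) (pd (cimage K i) (v \<circ> param K i) a)" if "a \<in> Basis" for a
    using C1_fun_D[OF assms(1,3)] C1_fun_D[OF assms(2,3)] that unfolding Ck_on_1 by blast+
  ultimately show ?thesis
    unfolding chart_grad_def[abs_def]
    by (intro continuous_on_sum continuous_on_scaleR continuous_on_mult continuous_on_cnj) simp_all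
qed

lemma continuous_grad_inner:
  assumes "C1_fun K u" "C1_fun K v"
  shows "continuous_on UNIV (grad_inner K u v)"
  by (rule continuous_on_chartwise[of "\<lambda>i. chart_grad K i u v", OF continuous_chart_grad[OF assms]
      grad_inner_chart[OF assms]])

lemma C1_fun_mult: "C1_fun K u \<Longrightarrow> C1_fun K v \<Longrightarrow> C1_fun K (\<lambda>p. u p * v p)"
  unfolding C1_fun_def o_def by (intro ballI Ck_on_mult uniq_cimage; blast)

lemma C1_fun_sum: "(\<And>t. t \<in> T \<Longrightarrow> C1_fun K (u t)) \<Longrightarrow> C1_fun K (\<lambda>p. \<Sum>t\<in>T. u t p)"
  unfolding C1_fun_def o_def by (intro ballI Ck_on_sum uniq_cimage; blast)

lemma grad_inner_sum_right:
  assumes u: "C1_fun K u" and v: "\<And>t. t \<in> T \<Longrightarrow> C1_fun K (v t)"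
  shows "grad_inner K u (\<lambda>p. \<Sum>t\<in>T. v t p) p = (\<Sum>t\<in>T. grad_inner K u (v t) p)"
proof -
  obtain i where i: "i \<in> idx K" "p \<in> patch K i" using ex_chart by blast
  define z where "z = coord K i p"
  have z: "z \<in> cimage K i" using i by (simp add: z_def coord_in)
  have pds: "pd (cimage K i) ((\<lambda>p. \<Sum>t\<in>T. v t p) \<circ> param K i) b z = (\<Sum>t\<in>T. pd (cimage K i) (v t \<circ> param K i) b z)" for b
  proof -
    have "((\<lambda>y. \<Sum>t\<in>T. (v t \<circ> param K i) y) has_derivative
        (\<lambda>w. \<Sum>t\<in>T. frechet_derivative (v t \<circ> param K i) (at z within cimage K i) w)) (at z within cimage K i)"
      using Ck_on_Suc_has_derivative[OF C1_fun_D[OF v i(1), unfolded One_nat_def] z]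
      by (intro has_derivative_sum) (simp add: o_def)
    from pd_eq[OF uniq_cimage[OF i(1)] z this] show ?thesis by (simp add: pd_def o_def)
  qed
  have "grad_inner K u (\<lambda>p. \<Sum>t\<in>T. v t p) p = chart_grad K i u (\<lambda>p. \<Sum>t\<in>T. v t p) z"
    unfolding z_def by (rule grad_inner_chart[OF u C1_fun_sum[OF v] i])
  also have "\<dots> = (\<Sum>a\<in>Basis. \<Sum>b\<in>Basis. \<Sum>t\<in>T. gram_inv (gform K i z) a b *\<^sub>R
        (pd (cimage K i) (u \<circ> param K i) a z * cnj (pd (cimage K i) (v t \<circ> param K i) b z)))"
    by (simp add: chart_grad_def pds sum_distrib_left scaleR_sum_right)
  also have "\<dots> = (\<Sum>a\<in>Basis. \<Sum>t\<in>T. \<Sum>b\<in>Basis. gram_inv (gform K i z) a b *\<^sub>R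
        (pd (cimage K i) (u \<circ> param K i) a z * cnj (pd (cimage K i) (v t \<circ> param K i) b z)))"
    by (intro sum.cong refl sum.swap)
  also have "\<dots> = (\<Sum>t\<in>T. chart_grad K i u (v t) z)"
    unfolding chart_grad_def by (rule sum.swap)
  also have "\<dots> = (\<Sum>t\<in>T. grad_inner K u (v t) p)"
    by (intro sum.cong refl) (simp add: grad_inner_chart[OF u v i] z_def)
  finally show ?thesis .
qed

section \<open>The Riemannian volume of the closed manifold\<close>

lemma sets_VK: "sets VK = sets borel"
  using vol by (simp add: riemannian_volume_def points_UNIV sets_restrict_space)

lemma space_VK: "space VK = UNIV"
  using vol by (simp add: riemannian_volume_def points_UNIV)

lemma emeasure_VK_chart:
  assumes "i \<in> idx K" "B \<in> sets borel" "B \<subseteq> patch K i"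
  shows "emeasure VK B = (\<integral>\<^sup>+z. ennreal (vdens K i z) * indicator (coord K i ` B) z \<partial>lborel)"
  using vol assms by (simp add: riemannian_volume_def sets_VK)

definition chart_meas :: "'i \<Rightarrow> 'e measure" where
  "chart_meas i = density (restrict_space lborel (cimage K i)) (\<lambda>z. ennreal (vdens K i z))"

lemma measurable_vdens:
  assumes "i \<in> idx K"
  shows "vdens K i \<in> borel_measurable (restrict_space borel (cimage K i))"
  by (rule borel_measurable_continuous_on_restrict[OF Ck_on_continuous[OF Ck_on_vdens[OF assms, of 0]]])

lemma measurable_param:
  assumes "i \<in> idx K"
  shows "param K i \<in> restrict_space borel (cimage K i) \<rightarrow>\<^sub>M restrict_space borel (patch K i)"
  by (rule measurable_restrict_space2)
    (auto simp: space_restrict_space param_in assms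
      intro: borel_measurable_continuous_on_restrict[OF continuous_param[OF assms]])

text \<open>
  The defining property of the volume is a formula for the measure of Borel subsets of a patch. Read as
  an equality of measures it gives the change of variables formula for integrals.
\<close>

lemma restrict_VK_patch:
  assumes i: "i \<in> idx K"
  shows "restrict_space VK (patch K i) = distr (chart_meas i) (restrict_space borel (patch K i)) (param K i)"
proof (rule measure_eqI)
  have patch: "patch K i \<in> sets borel" "cimage K i \<in> sets borel" using chart[OF i] by auto
  show s: "sets (restrict_space VK (patch K i)) = sets (distr (chart_meas i) (restrict_space borel (patch K i)) (param K i))"
    by (simp add: sets_restrict_space sets_VK)
  fix B assume "B \<in> sets (restrict_space VK (patch K i))"
  then have B: "B \<in> sets borel" "B \<subseteq> patch K i"
    using patch by (auto simp: sets_restrict_space sets_VK)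
  have m: "param K i \<in> chart_meas i \<rightarrow>\<^sub>M restrict_space borel (patch K i)"
    unfolding chart_meas_def
    using measurable_param[OF i] by (simp add: measurable_cong_sets[OF sets_density refl]
      cong: measurable_cong_sets sets_restrict_space_cong)
  have "emeasure (distr (chart_meas i) (restrict_space borel (patch K i)) (param K i)) B
      = emeasure (chart_meas i) (param K i -` B \<inter> space (chart_meas i))"
    using B patch by (intro emeasure_distr m) (auto simp: sets_restrict_space)
  also have "param K i -` B \<inter> space (chart_meas i) = coord K i ` B"
    using B(2) i by (auto simp: chart_meas_def space_restrict_space param_coord coord_in subset_iff)
      (metis coord_param image_eqI)
  also have "emeasure (chart_meas i) (coord K i ` B) =
      (\<integral>\<^sup>+z. ennreal (vdens K i z) * indicator (coord K i ` B) z \<partial>restrict_space lborel (cimage K i))"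
    unfolding chart_meas_def
  proof (rule emeasure_density)
    show "(\<lambda>z. ennreal (vdens K i z)) \<in> borel_measurable (restrict_space lborel (cimage K i))"
      using measurable_vdens[OF i] by (simp cong: measurable_cong_sets sets_restrict_space_cong)
    have "param K i -` B \<inter> space (restrict_space borel (cimage K i)) \<in> sets (restrict_space borel (cimage K i))"
      using B patch by (intro measurable_sets[OF measurable_param[OF i]]) (auto simp: sets_restrict_space)
    also have "param K i -` B \<inter> space (restrict_space borel (cimage K i)) = coord K i ` B"
      using B(2) i by (auto simp: space_restrict_space param_coord coord_in subset_iff)
        (metis coord_param image_eqI)
    finally show "coord K i ` B \<in> sets (restrict_space lborel (cimage K i))"
      by (simp add: sets_restrict_space)
  qed
  also have "\<dots> = (\<integral>\<^sup>+z. ennreal (vdens K i z) * indicator (coord K i ` B) z * indicator (cimage K i) z \<partial>lborel)"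
    using patch by (subst nn_integral_restrict_space) auto
  also have "\<dots> = (\<integral>\<^sup>+z. ennreal (vdens K i z) * indicator (coord K i ` B) z \<partial>lborel)"
    using B(2) by (intro nn_integral_cong) (auto simp: indicator_def coord_in)
  also have "\<dots> = emeasure VK B" by (rule emeasure_VK_chart[OF i B, symmetric])
  also have "\<dots> = emeasure (restrict_space VK (patch K i)) B"
    using B patch by (subst emeasure_restrict_space) (auto simp: sets_VK space_VK)
  finally show "emeasure (restrict_space VK (patch K i)) B =
      emeasure (distr (chart_meas i) (restrict_space borel (patch K i)) (param K i)) B" by simp
qed

lemma integral_chart:
  fixes h :: "'k \<Rightarrow> complex"
  assumes i: "i \<in> idx K" and h: "continuous_on UNIV h" and supp: "\<And>p. p \<notin> patch K i \<Longrightarrow> h p = 0"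
  shows "(\<integral>p. h p \<partial>VK) = (\<integral>z. indicator (cimage K i) z *\<^sub>R (vdens K i z *\<^sub>R h (param K i z)) \<partial>lborel)"
proof -
  have patch: "patch K i \<in> sets borel" "cimage K i \<in> sets borel" using chart[OF i] by auto
  have hm: "h \<in> borel_measurable borel" by (rule borel_measurable_continuous_onI[OF h])
  have hp: "h \<in> borel_measurable (restrict_space borel (patch K i))"
    by (rule measurable_restrict_space1[OF hm])
  have m: "param K i \<in> chart_meas i \<rightarrow>\<^sub>M restrict_space borel (patch K i)"
    unfolding chart_meas_def
    using measurable_param[OF i] by (simp add: measurable_cong_sets[OF sets_density refl]
      cong: measurable_cong_sets sets_restrict_space_cong)
  have "(\<integral>p. h p \<partial>VK) = (\<integral>p. indicator (patch K i) p *\<^sub>R h p \<partial>VK)"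
    using supp by (intro Bochner_Integration.integral_cong) (auto simp: indicator_def)
  also have "\<dots> = (\<integral>p. h p \<partial>restrict_space VK (patch K i))"
    using patch by (subst integral_restrict_space) (auto simp: sets_VK space_VK)
  also have "\<dots> = (\<integral>z. h (param K i z) \<partial>chart_meas i)"
    unfolding restrict_VK_patch[OF i] by (rule integral_distr[OF m hp])
  also have "\<dots> = (\<integral>z. vdens K i z *\<^sub>R h (param K i z) \<partial>restrict_space lborel (cimage K i))"
    unfolding chart_meas_def
  proof (rule integral_density)
    show "(\<lambda>z. h (param K i z)) \<in> borel_measurable (restrict_space lborel (cimage K i))"
      using measurable_compose[OF measurable_param[OF i] hp]
      by (simp cong: measurable_cong_sets sets_restrict_space_cong)
    show "vdens K i \<in> borel_measurable (restrict_space lborel (cimage K i))"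
      using measurable_vdens[OF i] by (simp cong: measurable_cong_sets sets_restrict_space_cong)
    show "AE z in restrict_space lborel (cimage K i). 0 \<le> vdens K i z"
      by (rule AE_I2) (auto simp: space_restrict_space intro: less_imp_le[OF vdens_pos[OF i]])
  qed
  also have "\<dots> = (\<integral>z. indicator (cimage K i) z *\<^sub>R (vdens K i z *\<^sub>R h (param K i z)) \<partial>lborel)"
    using patch by (subst integral_restrict_space) auto
  finally show ?thesis .
qed

text \<open>
  The closed balls lie inside the images of the charts: compactness of their preimages bounds the volume of
  \<open>K\<close> and provides the supports for a partition of unity.
\<close>

lemma finite_ball_cover:
  obtains T :: "('i \<times> 'e \<times> real) set" where "finite T"
    "\<And>i c r. (i, c, r) \<in> T \<Longrightarrow> i \<in> idx K \<and> 0 < r \<and> cball c r \<subseteq> cimage K i"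
    "(\<Union>(i, c, r)\<in>T. param K i ` ball c r) = UNIV"
proof -
  define A where "A = {(i, c, r). i \<in> idx K \<and> 0 < r \<and> cball c r \<subseteq> cimage K i}"
  have "\<exists>T\<subseteq>A. finite T \<and> UNIV \<subseteq> (\<Union>t\<in>T. (\<lambda>(i, c, r). param K i ` ball c r) t)"
  proof (rule compactE_image[OF compact_UNIV, of A "\<lambda>(i, c, r). param K i ` ball c r"])
    fix t assume "t \<in> A"
    then show "open ((\<lambda>(i, c, r). param K i ` ball c r) t)"
      using ball_subset_cball by (force simp: A_def intro!: open_param_image)
  next
    show "UNIV \<subseteq> (\<Union>t\<in>A. (\<lambda>(i, c, r). param K i ` ball c r) t)"
    proof
      fix p :: 'k
      obtain i where i: "i \<in> idx K" "p \<in> patch K i" using ex_chart by blast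
      obtain r where r: "r > 0" "cball (coord K i p) r \<subseteq> cimage K i"
        using chart(2)[OF i(1)] coord_in[OF i(2)] open_contains_cball by blast
      then have "(i, coord K i p, r) \<in> A" using i by (simp add: A_def)
      moreover have "p \<in> param K i ` ball (coord K i p) r"
        using r param_coord[OF i] by (metis centre_in_ball image_eqI)
      ultimately show "p \<in> (\<Union>t\<in>A. (\<lambda>(i, c, r). param K i ` ball c r) t)" by fastforce
    qed
  qed blast
  then obtain T where "T \<subseteq> A" "finite T" "UNIV \<subseteq> (\<Union>t\<in>T. (\<lambda>(i, c, r). param K i ` ball c r) t)" by blast
  then show ?thesis by (intro that[of T]) (auto simp: A_def)
qed

lemma finite_measure_VK: "finite_measure VK"
proof
  obtain T :: "('i \<times> 'e \<times> real) set" where T: "finite T"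
    "\<And>i c r. (i, c, r) \<in> T \<Longrightarrow> i \<in> idx K \<and> 0 < r \<and> cball c r \<subseteq> cimage K i"
    "(\<Union>(i, c, r)\<in>T. param K i ` ball c r) = UNIV"
    by (rule finite_ball_cover) blast
  have fin: "emeasure VK ((\<lambda>(i, c, r). param K i ` ball c r) t) < \<infinity>"
    and meas: "(\<lambda>(i, c, r). param K i ` ball c r) t \<in> sets VK" if "t \<in> T" for t
  proof -
    obtain i c r where t: "t = (i, c, r)" by (cases t)
    have i: "i \<in> idx K" and r: "cball c r \<subseteq> cimage K i" using T(2) that t by auto
    have sub: "ball c r \<subseteq> cimage K i" using r ball_subset_cball by blast
    have op: "open (param K i ` ball c r)" by (rule open_param_image[OF i open_ball sub])
    then show "(\<lambda>(i, c, r). param K i ` ball c r) t \<in> sets VK" by (simp add: t sets_VK)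
    have "compact (vdens K i ` cball c r)"
      using Ck_on_continuous[OF Ck_on_vdens[OF i, of 0]] r
      by (intro compact_continuous_image) (auto intro: continuous_on_subset)
    then obtain M where M: "\<And>z. z \<in> cball c r \<Longrightarrow> vdens K i z \<le> M"
      using compact_imp_bounded bounded_imp_bdd_above unfolding bdd_above_def by (meson imageI)
    have ci: "coord K i ` (param K i ` ball c r) = ball c r"
      using sub coord_param[OF i] by (force simp: image_image)
    have "emeasure VK (param K i ` ball c r) =
        (\<integral>\<^sup>+z. ennreal (vdens K i z) * indicator (ball c r) z \<partial>lborel)"
      using op sub i by (subst emeasure_VK_chart[OF i]) (auto simp: ci param_in)
    also have "\<dots> \<le> (\<integral>\<^sup>+z. ennreal M * indicator (ball c r) z \<partial>lborel)"
      using M by (intro nn_integral_mono) (auto simp: indicator_def intro!: ennreal_leI)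
    also have "\<dots> = ennreal M * emeasure lborel (ball c r)"
      by (subst nn_integral_cmult_indicator) auto
    also have "\<dots> < \<infinity>"
      using emeasure_bounded_finite[OF bounded_ball, of c r] by (simp add: ennreal_mult_less_top)
    finally show "emeasure VK ((\<lambda>(i, c, r). param K i ` ball c r) t) < \<infinity>" by (simp add: t)
  qed
  have "emeasure VK (space VK) = emeasure VK (\<Union>t\<in>T. (\<lambda>(i, c, r). param K i ` ball c r) t)"
    using T(3) by (simp add: space_VK)
  also have "\<dots> \<le> (\<Sum>t\<in>T. emeasure VK ((\<lambda>(i, c, r). param K i ` ball c r) t))"
    by (rule emeasure_subadditive_finite[OF T(1)]) (use meas in auto)
  also have "\<dots> < \<infinity>" using fin T(1) by (simp add: less_top)
  finally show "emeasure VK (space VK) \<noteq> \<infinity>" by simp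
qed

lemma integrable_continuous:
  fixes h :: "'k \<Rightarrow> complex"
  assumes "continuous_on UNIV h" shows "integrable VK h"
proof -
  interpret finite_measure VK by (rule finite_measure_VK)
  have "bounded (range h)" by (intro compact_imp_bounded compact_continuous_image assms compact_UNIV)
  then obtain B where "\<And>p. norm (h p) \<le> B" unfolding bounded_iff by blast
  then show ?thesis
    by (intro integrable_const_bound[of _ B])
      (auto simp: measurable_cong_sets[OF sets_VK refl] intro: borel_measurable_continuous_onI assms)
qed

end

section \<open>Green's formula on the closed manifold\<close>

context closed_manifold
begin

text \<open>
  In another chart \<open>j\<close>, the function is a composition with the transition map on the overlap and
  vanishes off the compact set; these two open sets cover the image of \<open>j\<close>.
\<close>

lemma C1_fun_extend_by_zero:
  assumes i: "i \<in> idx K" and c: "cball c r \<subseteq> cimage K i"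
    and supp: "\<And>p. p \<notin> param K i ` cball c r \<Longrightarrow> h p = 0"
    and h: "Ck_on 1 (cimage K i) (h \<circ> param K i)"
  shows "C1_fun K h"
  unfolding C1_fun_def
proof
  fix j assume j: "j \<in> idx K"
  define S where "S = param K i ` cball c r"
  have "compact S"
    unfolding S_def
    by (intro compact_continuous_image continuous_on_subset[OF continuous_param[OF i] c] compact_cball)
  then have S: "closed S" by (rule compact_imp_closed)
  have Sp: "S \<subseteq> patch K i" using c param_in[OF i] by (auto simp: S_def)
  define A where "A = coord K j ` (patch K j \<inter> patch K i)"
  define B where "B = coord K j ` (patch K j - S)"
  have oA: "open A" unfolding A_def by (rule open_overlap[OF j i])
  have oB: "open B" unfolding B_def
    using chart(1)[OF j] S by (intro open_coord_image[OF j] open_Diff) auto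
  have "cimage K j = A \<union> B" using Sp by (auto simp: A_def B_def cimage_def)
  moreover have "Ck_on 1 A (h \<circ> param K j)"
  proof -
    have "Ck_on 1 A ((h \<circ> param K i) \<circ> (coord K i \<circ> param K j))"
    proof (rule Ck_on_1_compose[OF uniq_deriv_open[OF oA] _ _ h])
      show "Ck_on 1 A (coord K i \<circ> param K j)" unfolding A_def by (rule smooth_transition[OF j i])
      show "(coord K i \<circ> param K j) ` A \<subseteq> cimage K i"
        using j by (auto simp: A_def param_coord coord_in)
    qed
    then show ?thesis
      by (rule Ck_on_cong_imp[rotated]) (use i j in \<open>auto simp: A_def param_coord\<close>)
  qed
  moreover have "Ck_on 1 B (h \<circ> param K j)"
    by (rule Ck_on_cong_imp[OF _ Ck_on_const[OF uniq_deriv_open[OF oB], of 1 0]])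
      (use j supp in \<open>auto simp: B_def param_coord S_def\<close>)
  ultimately show "Ck_on 1 (cimage K j) (h \<circ> param K j)" using Ck_on_1_Un[OF oA oB] by simp
qed

definition bump :: "'i \<Rightarrow> 'e \<Rightarrow> real \<Rightarrow> 'k \<Rightarrow> real" where
  "bump i c r p = (if p \<in> patch K i then
     (max 0 (r\<^sup>2 - (coord K i p - c) \<bullet> (coord K i p - c)))\<^sup>2 else 0)"

lemma bump_support:
  assumes i: "i \<in> idx K" and r: "0 < r" and c: "cball c r \<subseteq> cimage K i"
    and p: "p \<notin> param K i ` cball c r"
  shows "bump i c r p = 0"
proof (cases "p \<in> patch K i")
  case True
  have "coord K i p \<notin> cball c r" using p param_coord[OF i True] by (metis image_eqI)
  then have "r < norm (coord K i p - c)" by (simp add: dist_norm norm_minus_commute)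
  then have "r\<^sup>2 \<le> (norm (coord K i p - c))\<^sup>2" using r by (intro power_mono) auto
  then show ?thesis by (simp add: bump_def power2_norm_eq_inner)
qed (simp add: bump_def)

lemma C1_fun_bump:
  assumes i: "i \<in> idx K" and r: "0 < r" and c: "cball c r \<subseteq> cimage K i"
  shows "C1_fun K (\<lambda>p. of_real (bump i c r p))"
proof (rule C1_fun_extend_by_zero[OF i c])
  fix p assume p: "p \<notin> param K i ` cball c r"
  show "complex_of_real (bump i c r p) = 0" using bump_support[OF i r c p] by simp
next
  have "Ck_on 1 (cimage K i) (\<lambda>z. complex_of_real ((max 0 (r\<^sup>2 - (z - c) \<bullet> (z - c)))\<^sup>2))"
    by (rule Ck_on_of_real[OF uniq_cimage[OF i] Ck_on_subset_1[OF uniq_deriv_open[OF open_UNIV]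
          uniq_cimage[OF i] subset_UNIV Ck_on_1_bump]])
  then show "Ck_on 1 (cimage K i) ((\<lambda>p. complex_of_real (bump i c r p)) \<circ> param K i)"
    by (rule Ck_on_cong_imp[rotated]) (use i in \<open>auto simp: bump_def coord_param param_in\<close>)
qed

lemma bump_nonneg: "0 \<le> bump i c r p"
  by (simp add: bump_def)

lemma bump_pos:
  assumes i: "i \<in> idx K" and p: "p \<in> param K i ` ball c r" and c: "cball c r \<subseteq> cimage K i"
  shows "0 < bump i c r p"
proof -
  obtain z where z: "p = param K i z" "z \<in> ball c r" using p by auto
  then have zi: "z \<in> cimage K i" using c ball_subset_cball by blast
  have "norm (z - c) < r" using z(2) by (simp add: dist_norm norm_minus_commute)
  then have "(norm (z - c))\<^sup>2 < r\<^sup>2" by (intro power_strict_mono) auto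
  then have "0 < r\<^sup>2 - (z - c) \<bullet> (z - c)" by (simp add: power2_norm_eq_inner)
  then show ?thesis using i zi by (simp add: bump_def z(1) param_in coord_param)
qed

text \<open>
  A partition of unity: the bump functions of a finite cover have a positive sum \<open>S\<close>, and \<open>v\<close> is the sum
  of the functions \<open>b v / S\<close>.
\<close>

lemma localization:
  assumes v: "C1_fun K v"
  obtains T :: "('i \<times> 'e \<times> real) set" and h where "finite T"
    "\<And>t. t \<in> T \<Longrightarrow> C1_fun K (h t)" "\<And>p. v p = (\<Sum>t\<in>T. h t p)"
    "\<And>i c r. (i, c, r) \<in> T \<Longrightarrow> i \<in> idx K \<and> 0 < r \<and> cball c r \<subseteq> cimage K i \<and>
      (\<forall>p. p \<notin> param K i ` cball c r \<longrightarrow> h (i, c, r) p = 0)"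
proof -
  obtain T :: "('i \<times> 'e \<times> real) set" where T: "finite T"
    "\<And>i c r. (i, c, r) \<in> T \<Longrightarrow> i \<in> idx K \<and> 0 < r \<and> cball c r \<subseteq> cimage K i"
    "(\<Union>(i, c, r)\<in>T. param K i ` ball c r) = UNIV"
    by (rule finite_ball_cover) blast
  define b where "b t p = (case t of (i, c, r) \<Rightarrow> bump i c r p)" for t p
  define S where "S p = (\<Sum>t\<in>T. b t p)" for p
  have b1: "C1_fun K (\<lambda>p. of_real (b t p))" if "t \<in> T" for t
    using C1_fun_bump T(2) that by (cases t) (auto simp: b_def)
  have b0: "0 \<le> b t p" for t p by (cases t) (simp add: b_def bump_nonneg)
  have Spos: "0 < S p" for p
  proof -
    have "p \<in> (\<Union>(i, c, r)\<in>T. param K i ` ball c r)" using T(3) by simp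
    then obtain i c r where t: "(i, c, r) \<in> T" "p \<in> param K i ` ball c r" by blast
    have "0 < b (i, c, r) p" using bump_pos T(2)[OF t(1)] t(2) by (simp add: b_def)
    also have "\<dots> \<le> S p" unfolding S_def by (rule member_le_sum[OF t(1)]) (use b0 T(1) in auto)
    finally show ?thesis .
  qed
  have "C1_fun K (\<lambda>p. complex_of_real (inverse (S p)))"
    unfolding C1_fun_def
  proof
    fix i assume i: "i \<in> idx K"
    have "Ck_on 1 (cimage K i) (\<lambda>z. Re (\<Sum>t\<in>T. complex_of_real (b t (param K i z))))"
      using C1_fun_D[OF C1_fun_sum[OF b1] i]
      by (intro bounded_linear.Ck_on[OF bounded_linear_Re] uniq_cimage i) (simp add: o_def)
    then have "Ck_on 1 (cimage K i) (\<lambda>z. S (param K i z))" by (simp add: S_def)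
    then have "Ck_on 1 (cimage K i) (\<lambda>z. complex_of_real (inverse (S (param K i z))))"
      by (intro Ck_on_of_real Ck_on_inverse uniq_cimage i Spos)
    then show "Ck_on 1 (cimage K i) ((\<lambda>p. complex_of_real (inverse (S p))) \<circ> param K i)"
      by (simp only: o_def)
  qed
  then have h1: "C1_fun K (\<lambda>p. of_real (b t p) * (v p * of_real (inverse (S p))))" if "t \<in> T" for t
    using b1[OF that] v by (intro C1_fun_mult)
  show ?thesis
  proof (rule that[of T "\<lambda>t p. of_real (b t p) * (v p * of_real (inverse (S p)))"])
    show "v p = (\<Sum>t\<in>T. of_real (b t p) * (v p * of_real (inverse (S p))))" for p
    proof -
      have "(\<Sum>t\<in>T. of_real (b t p) * (v p * of_real (inverse (S p)))) = of_real (S p) * (v p * of_real (inverse (S p)))"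
        by (simp only: S_def of_real_sum sum_distrib_right)
      then show ?thesis using Spos[of p] by (simp add: field_simps)
    qed
  next
    fix i c r assume t: "(i, c, r) \<in> T"
    show "i \<in> idx K \<and> 0 < r \<and> cball c r \<subseteq> cimage K i \<and> (\<forall>p. p \<notin> param K i ` cball c r \<longrightarrow>
        of_real (b (i, c, r) p) * (v p * of_real (inverse (S p))) = 0)"
      using T(2)[OF t] bump_support by (simp add: b_def)
  qed (use T(1) h1 in auto)
qed

lemma grad_inner_zero_off_support:
  assumes u: "C1_fun K u" and h: "C1_fun K h" and S: "closed S" and supp: "\<And>p. p \<notin> S \<Longrightarrow> h p = 0"
    and p: "p \<notin> S"
  shows "grad_inner K u h p = 0"
proof -
  obtain i where i: "i \<in> idx K" "p \<in> patch K i" using ex_chart by blast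
  define W where "W = coord K i ` (patch K i - S)"
  have W: "open W" "coord K i p \<in> W"
    using i p chart(1)[OF i(1)] S by (auto simp: W_def intro!: open_coord_image[OF i(1)] open_Diff)
  have "frechet_derivative (h \<circ> param K i) (at (coord K i p)) = (\<lambda>v. 0)"
    by (rule frechet_derivative_zero_on_open[OF W]) (use i supp in \<open>auto simp: W_def param_coord\<close>)
  then have "pd (cimage K i) (h \<circ> param K i) b (coord K i p) = 0" for b
    by (simp only: pd_open[OF chart(2)[OF i(1)] coord_in[OF i(2)]])
  then show ?thesis by (simp add: grad_inner_chart[OF u h i] chart_grad_def)
qed

text \<open>
  The divergence theorem in one chart. With the field
  \<open>F\<^sub>a = |g|\<^sup>1\<^sup>/\<^sup>2 \<Sum>\<^sub>b g\<^sup>a\<^sup>b \<partial>\<^sub>b Y\<close>, the divergence of \<open>F cnj h\<close> is the integrand times the volume density. The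
  field \<open>F cnj h\<close> has compact support in the chart, so its divergence has integral \<open>0\<close>.
\<close>

lemma green_local:
  assumes Y: "has_laplacian K Y (\<lambda>p. - of_real m * Y p)" and h: "C1_fun K h"
    and i: "i \<in> idx K" and c: "cball c r \<subseteq> cimage K i"
    and supp: "\<And>p. p \<notin> param K i ` cball c r \<Longrightarrow> h p = 0"
  shows "(\<integral>p. grad_inner K Y h p - of_real m * (Y p * cnj (h p)) \<partial>VK) = 0"
proof -
  have sY: "smooth_fun K Y" using Y by (simp add: has_laplacian_def)
  then have Y1: "C1_fun K Y" by (rule smooth_fun_imp_C1_fun)
  define U where "U = cimage K i"
  define y where "y = Y \<circ> param K i"
  define g where "g = h \<circ> param K i"
  define F where "F a z = vdens K i z *\<^sub>R (\<Sum>b\<in>Basis. gram_inv (gform K i z) a b *\<^sub>R pd U y b z)" for a z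
  have oU: "open U" using chart(2)[OF i] by (simp add: U_def)
  have uU: "uniq_deriv U" by (rule uniq_deriv_open[OF oU])
  have g1: "Ck_on 1 U g" using C1_fun_D[OF h i] by (simp only: U_def g_def)
  have F1: "Ck_on 1 U (F a)" if a: "a \<in> Basis" for a
  proof -
    have "Ck_on 2 U y" using sY i by (simp add: smooth_fun_def smooth_on_def U_def y_def del: Ck_on.simps)
    then have "Ck_on 1 U (pd U y b)" if "b \<in> Basis" for b
      using that by (simp add: numeral_2_eq_2)
    then show ?thesis
      unfolding F_def[abs_def]
      by (intro Ck_on_scaleR Ck_on_sum uU; (simp add: U_def Ck_on_vdens Ck_on_gram_inv i a del: Ck_on.simps One_nat_def)?)
  qed
  have lap: "(\<Sum>a\<in>Basis. pd U (F a) a z) = - (vdens K i z * m) *\<^sub>R y z" if z: "z \<in> U" for z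
  proof -
    have "laplacian_in_chart K i Y (coord K i (param K i z)) = - of_real m * Y (param K i z)"
      using Y i param_in[OF i] z unfolding has_laplacian_def U_def by blast
    then have "(\<Sum>a\<in>Basis. pd U (F a) a z) /\<^sub>R vdens K i z = - of_real m * y z"
      using z by (simp add: laplacian_in_chart_def F_def[abs_def] U_def y_def coord_param[OF i])
    then have "vdens K i z *\<^sub>R ((\<Sum>a\<in>Basis. pd U (F a) a z) /\<^sub>R vdens K i z) = vdens K i z *\<^sub>R (- of_real m * y z)"
      by simp
    then have "(\<Sum>a\<in>Basis. pd U (F a) a z) = vdens K i z *\<^sub>R (- of_real m * y z)"
      using vdens_pos[OF i, of z] z by (simp add: U_def)
    then show ?thesis by (simp add: scaleR_conv_of_real)
  qed
  have gsupp: "g z = 0" if "z \<in> U" "z \<notin> cball c r" for z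
  proof -
    have "param K i z \<notin> param K i ` cball c r"
      using that c coord_param[OF i] by (auto simp: U_def) (metis coord_param i subsetD mem_cball)
    then show ?thesis using supp by (simp add: g_def)
  qed
  define \<Phi> where "\<Phi> a z = (if z \<in> U then F a z * cnj (g z) else 0)" for a z
  have \<Phi>1: "Ck_on 1 UNIV (\<Phi> a)" and \<Phi>s: "\<And>z. z \<notin> cball c r \<Longrightarrow> \<Phi> a z = 0" if a: "a \<in> Basis" for a
  proof -
    show 0: "\<Phi> a z = 0" if "z \<notin> cball c r" for z using gsupp that by (simp add: \<Phi>_def)
    have "Ck_on 1 U (\<lambda>z. F a z * cnj (g z))" by (intro Ck_on_mult Ck_on_cnj uU F1 a g1)
    then have 1: "Ck_on 1 U (\<Phi> a)" by (rule Ck_on_cong_imp[rotated]) (simp add: \<Phi>_def)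
    have o: "open (- cball c r)" by auto
    have 2: "Ck_on 1 (- cball c r) (\<Phi> a)"
      by (rule Ck_on_cong_imp[OF _ Ck_on_const[OF uniq_deriv_open[OF o], of 1 0]]) (use 0 in auto)
    have "U \<union> - cball c r = UNIV" using c by (auto simp: U_def)
    then show "Ck_on 1 UNIV (\<Phi> a)" using Ck_on_1_Un[OF oU o 1 2] by simp
  qed
  have pd\<Phi>: "pd UNIV (\<Phi> a) a z = F a z * cnj (pd U g a z) + pd U (F a) a z * cnj (g z)"
    if a: "a \<in> Basis" and z: "z \<in> U" for a z
  proof -
    have dF: "(F a has_derivative frechet_derivative (F a) (at z within U)) (at z within U)"
      by (rule Ck_on_Suc_has_derivative[OF F1[OF a, unfolded One_nat_def] z])
    have dg: "(g has_derivative frechet_derivative g (at z within U)) (at z within U)"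
      by (rule Ck_on_Suc_has_derivative[OF g1[unfolded One_nat_def] z])
    have "((\<lambda>z. F a z * cnj (g z)) has_derivative
        (\<lambda>v. F a z * cnj (frechet_derivative g (at z within U) v) +
             frechet_derivative (F a) (at z within U) v * cnj (g z))) (at z within U)"
      by (intro has_derivative_mult dF bounded_linear.has_derivative[OF bounded_linear_cnj] dg)
    then have "((\<lambda>z. F a z * cnj (g z)) has_derivative
        (\<lambda>v. F a z * cnj (frechet_derivative g (at z within U) v) +
             frechet_derivative (F a) (at z within U) v * cnj (g z))) (at z)"
      using at_within_open[OF z oU] by simp
    then have "(\<Phi> a has_derivative
        (\<lambda>v. F a z * cnj (frechet_derivative g (at z within U) v) +
             frechet_derivative (F a) (at z within U) v * cnj (g z))) (at z)"
      by (rule has_derivative_transform_within_open[OF _ oU z]) (simp add: \<Phi>_def)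
    then show ?thesis
      using pd_eq[OF uniq_deriv_open[OF open_UNIV] UNIV_I] by (simp add: pd_def)
  qed
  define S where "S = param K i ` cball c r"
  have "compact S"
    unfolding S_def
    by (intro compact_continuous_image continuous_on_subset[OF continuous_param[OF i] c] compact_cball)
  then have S: "closed S" by (rule compact_imp_closed)
  define H where "H p = grad_inner K Y h p - of_real m * (Y p * cnj (h p))" for p
  have cH: "continuous_on UNIV H"
    unfolding H_def using continuous_C1_fun[OF Y1] continuous_C1_fun[OF h]
    by (intro continuous_intros continuous_grad_inner Y1 h)
  have H0: "H p = 0" if "p \<notin> patch K i" for p
  proof -
    have "p \<notin> S" using that c param_in[OF i] by (auto simp: S_def)
    then show ?thesis
      using grad_inner_zero_off_support[OF Y1 h S supp[folded S_def], of p] supp[folded S_def, of p]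
      by (simp add: H_def)
  qed
  \<comment> \<open>The product rule for the divergence, with the Laplace equation inserted.\<close>
  have key: "indicator U z *\<^sub>R (vdens K i z *\<^sub>R H (param K i z)) = (\<Sum>a\<in>Basis. pd UNIV (\<Phi> a) a z)" for z
  proof (cases "z \<in> U")
    case True
    have zi: "z \<in> cimage K i" using True by (simp add: U_def)
    have "grad_inner K Y h (param K i z) = chart_grad K i Y h z"
      using grad_inner_chart[OF Y1 h i param_in[OF i zi]] by (simp add: coord_param[OF i zi])
    also have "\<dots> = (\<Sum>a\<in>Basis. \<Sum>b\<in>Basis. gram_inv (gform K i z) b a *\<^sub>R (pd U y a z * cnj (pd U g b z)))"
      using gram_inv_sym[OF posdef_gform[OF i zi]] by (simp add: chart_grad_def U_def y_def g_def)
    also have "\<dots> = (\<Sum>b\<in>Basis. \<Sum>a\<in>Basis. gram_inv (gform K i z) b a *\<^sub>R (pd U y a z * cnj (pd U g b z)))"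
      by (rule sum.swap)
    finally have "vdens K i z *\<^sub>R grad_inner K Y h (param K i z) = (\<Sum>a\<in>Basis. F a z * cnj (pd U g a z))"
      by (simp add: F_def scaleR_sum_right sum_distrib_right)
    then have "vdens K i z *\<^sub>R H (param K i z) =
        (\<Sum>a\<in>Basis. F a z * cnj (pd U g a z)) + (\<Sum>a\<in>Basis. pd U (F a) a z) * cnj (g z)"
      unfolding lap[OF True] H_def
      by (simp add: scaleR_diff_right y_def g_def scaleR_conv_of_real algebra_simps)
    also have "\<dots> = (\<Sum>a\<in>Basis. pd UNIV (\<Phi> a) a z)"
      by (simp add: pd\<Phi>[OF _ True] sum.distrib sum_distrib_right)
    finally show ?thesis using True by simp
  next
    case False
    then have "z \<notin> cball c r" using c by (auto simp: U_def)
    then have "frechet_derivative (\<Phi> a) (at z) = (\<lambda>v. 0)" if "a \<in> Basis" for a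
      using frechet_derivative_zero_on_open[OF open_Compl[OF closed_cball], of z c r "\<Phi> a"] \<Phi>s[OF that]
      by simp
    then show ?thesis using False by (simp add: pd_def)
  qed
  have "(\<integral>p. H p \<partial>VK) = (\<integral>z. indicator U z *\<^sub>R (vdens K i z *\<^sub>R H (param K i z)) \<partial>lborel)"
    unfolding U_def by (rule integral_chart[OF i cH H0])
  also have "\<dots> = (\<integral>z. (\<Sum>a\<in>Basis. pd UNIV (\<Phi> a) a z) \<partial>lborel)" by (simp only: key)
  also have "\<dots> = (\<Sum>a\<in>Basis. \<integral>z. pd UNIV (\<Phi> a) a z \<partial>lborel)"
    by (rule Bochner_Integration.integral_sum) (rule integral_pd_eq_zero(1)[OF \<Phi>1 \<Phi>s])
  also have "\<dots> = 0" by (rule sum.neutral) (auto intro: integral_pd_eq_zero(2)[OF \<Phi>1 \<Phi>s])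
  finally show ?thesis by (simp add: H_def)
qed

text \<open>
  Both sides are additive in \<open>v\<close>, so the local formula applies to the pieces of \<open>localization\<close>.
\<close>

theorem green:
  assumes Y: "has_laplacian K Y (\<lambda>p. - of_real m * Y p)" and v: "C1_fun K v"
  shows "(\<integral>p. grad_inner K Y v p \<partial>VK) = of_real m * (\<integral>p. Y p * cnj (v p) \<partial>VK)"
proof -
  have Y1: "C1_fun K Y" using Y by (simp add: has_laplacian_def smooth_fun_imp_C1_fun)
  obtain T :: "('i \<times> 'e \<times> real) set" and h where T: "finite T"
    "\<And>t. t \<in> T \<Longrightarrow> C1_fun K (h t)" "\<And>p. v p = (\<Sum>t\<in>T. h t p)"
    "\<And>i c r. (i, c, r) \<in> T \<Longrightarrow> i \<in> idx K \<and> 0 < r \<and> cball c r \<subseteq> cimage K i \<and>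
      (\<forall>p. p \<notin> param K i ` cball c r \<longrightarrow> h (i, c, r) p = 0)"
    by (rule localization[OF v]) blast
  have vs: "v = (\<lambda>p. \<Sum>t\<in>T. h t p)" using T(3) by (simp add: fun_eq_iff)
  have z: "(\<integral>p. grad_inner K Y (h t) p - of_real m * (Y p * cnj (h t p)) \<partial>VK) = 0" if t: "t \<in> T" for t
  proof -
    obtain i c r where "t = (i, c, r)" by (cases t)
    then show ?thesis using T(4) t green_local[OF Y T(2)[OF t], of i c r] by auto
  qed
  have c: "continuous_on UNIV (\<lambda>p. grad_inner K Y (h t) p - of_real m * (Y p * cnj (h t p)))" if "t \<in> T" for t
    using continuous_C1_fun[OF Y1] continuous_C1_fun[OF T(2)[OF that]]
    by (intro continuous_intros continuous_grad_inner Y1 T(2) that)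
  have gs: "grad_inner K Y (\<lambda>p. \<Sum>t\<in>T. h t p) p = (\<Sum>t\<in>T. grad_inner K Y (h t) p)" for p
    by (rule grad_inner_sum_right[OF Y1]) (rule T(2))
  have "(\<integral>p. grad_inner K Y v p - of_real m * (Y p * cnj (v p)) \<partial>VK) =
      (\<integral>p. (\<Sum>t\<in>T. grad_inner K Y (h t) p - of_real m * (Y p * cnj (h t p))) \<partial>VK)"
    unfolding vs by (simp add: gs sum_subtractf sum_distrib_left)
  also have "\<dots> = (\<Sum>t\<in>T. \<integral>p. grad_inner K Y (h t) p - of_real m * (Y p * cnj (h t p)) \<partial>VK)"
    by (rule Bochner_Integration.integral_sum) (rule integrable_continuous[OF c])
  also have "\<dots> = 0" using z by simp
  finally have "(\<integral>p. grad_inner K Y v p - of_real m * (Y p * cnj (v p)) \<partial>VK) = 0" .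
  moreover have "integrable VK (grad_inner K Y v)"
    by (rule integrable_continuous[OF continuous_grad_inner[OF Y1 v]])
  moreover have "integrable VK (\<lambda>p. of_real m * (Y p * cnj (v p)))"
    using continuous_C1_fun[OF Y1] continuous_C1_fun[OF v]
    by (intro integrable_continuous continuous_intros)
  ultimately show ?thesis by (simp add: Bochner_Integration.integral_diff)
qed

end

section \<open>Measures that are products with the volume of K\<close>

text \<open>
  A measure \<open>V\<close> on \<open>S \<times> K\<close> that agrees with the product of \<open>\<nu>\<close> and the volume of \<open>K\<close> on Borel sets
  lying over a single patch. The volume of the cylinder (\<open>S = [0,1]\<close>) and that of its boundary
  (\<open>S = {0,1}\<close>) are both of this kind.
\<close>

locale product_volume = closed_manifold K VK
  for K :: "('i, 'k::{t2_space, second_countable_topology}, 'e::euclidean_space) riem" and VK +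
  fixes S :: "real set" and \<nu> :: "real measure" and V :: "(real \<times> 'k) measure"
  assumes compact_S: "compact S" and sets_\<nu>: "sets \<nu> = sets borel" and finite_\<nu>: "finite_measure \<nu>"
    and AE_S: "AE x in \<nu>. x \<in> S"
    and space_V: "space V = S \<times> UNIV" and sets_V: "sets V = sets (restrict_space borel (S \<times> UNIV))"
    and local_product: "\<And>i B. i \<in> idx K \<Longrightarrow> B \<in> sets borel \<Longrightarrow> B \<subseteq> S \<times> patch K i \<Longrightarrow>
      emeasure V B = (\<integral>\<^sup>+x. emeasure VK (Pair x -` B) \<partial>\<nu>)"
begin

sublocale \<nu>: finite_measure \<nu> by (rule finite_\<nu>)
sublocale VK: finite_measure VK by (rule finite_measure_VK)
sublocale pair_sigma_finite \<nu> VK ..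

lemma space_\<nu>: "space \<nu> = UNIV"
  using sets_eq_imp_space_eq[OF sets_\<nu>] by simp

lemma sets_pair: "sets (\<nu> \<Otimes>\<^sub>M VK) = sets (borel :: (real \<times> 'k) measure)"
  unfolding sets_pair_measure_cong[OF sets_\<nu> sets_VK] by (subst borel_prod) (rule refl)

lemma closed_S: "closed S" using compact_S by (rule compact_imp_closed)

lemma cyl_borel: "S \<times> UNIV \<in> sets (borel :: (real \<times> 'k) measure)"
  by (intro borel_closed closed_Times closed_S closed_UNIV)

lemma sets_V_iff: "B \<in> sets V \<longleftrightarrow> B \<in> sets borel \<and> B \<subseteq> S \<times> UNIV"
  using cyl_borel by (auto simp: sets_V sets_restrict_space_iff)

lemma emeasure_local: "i \<in> idx K \<Longrightarrow> B \<in> sets borel \<Longrightarrow> B \<subseteq> S \<times> patch K i \<Longrightarrow>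
    emeasure V B = emeasure (\<nu> \<Otimes>\<^sub>M VK) B"
  using local_product by (simp add: VK.emeasure_pair_measure_alt sets_pair)

text \<open>
  Finitely many patches cover \<open>K\<close>; additivity reduces the claim to subsets of one patch.
\<close>

lemma emeasure_V:
  assumes "B \<in> sets borel" "B \<subseteq> S \<times> UNIV"
  shows "emeasure V B = emeasure (\<nu> \<Otimes>\<^sub>M VK) B"
proof -
  obtain T :: "('i \<times> 'e \<times> real) set" where T: "finite T"
    "\<And>i c r. (i, c, r) \<in> T \<Longrightarrow> i \<in> idx K \<and> 0 < r \<and> cball c r \<subseteq> cimage K i"
    "(\<Union>(i, c, r)\<in>T. param K i ` ball c r) = UNIV"
    by (rule finite_ball_cover) blast
  have "emeasure V B = emeasure (\<nu> \<Otimes>\<^sub>M VK) B"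
    if "finite J" "J \<subseteq> idx K" "B \<in> sets borel" "B \<subseteq> S \<times> (\<Union>i\<in>J. patch K i)" for J B
    using that
  proof (induction J arbitrary: B rule: finite_induct)
    case empty then show ?case by simp
  next
    case (insert j J)
    define A where "A = B \<inter> (UNIV \<times> patch K j)"
    have jj: "j \<in> idx K" "J \<subseteq> idx K" using insert.prems by auto
    have "(UNIV :: real set) \<times> patch K j \<in> sets borel"
      using chart(1)[OF jj(1)] by (intro borel_open open_Times) auto
    then have A: "A \<in> sets borel" "B - A \<in> sets borel" using insert.prems by (auto simp: A_def)
    have "A \<subseteq> S \<times> patch K j" "B - A \<subseteq> S \<times> (\<Union>i\<in>J. patch K i)"
      using insert.prems(3) by (auto simp: A_def)
    note AB = this
    have "A \<subseteq> S \<times> UNIV" "B - A \<subseteq> S \<times> UNIV" using AB by blast+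
    then have "emeasure V A + emeasure V (B - A) = emeasure V (A \<union> (B - A))"
      using A by (intro plus_emeasure) (auto simp: sets_V_iff)
    moreover have "emeasure (\<nu> \<Otimes>\<^sub>M VK) A + emeasure (\<nu> \<Otimes>\<^sub>M VK) (B - A) = emeasure (\<nu> \<Otimes>\<^sub>M VK) (A \<union> (B - A))"
      using A by (intro plus_emeasure) (auto simp: sets_pair)
    moreover have "A \<union> (B - A) = B" by (auto simp: A_def)
    ultimately show ?case
      using emeasure_local[OF jj(1) A(1) AB(1)] insert.IH[OF jj(2) A(2) AB(2)] by simp
  qed
  note * = this
  show ?thesis
  proof (rule *)
    show "finite (fst ` T)" using T(1) by simp
    show "fst ` T \<subseteq> idx K" using T(2) by auto
    have "p \<in> (\<Union>i\<in>fst ` T. patch K i)" for p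
    proof -
      have "p \<in> (\<Union>(i, c, r)\<in>T. param K i ` ball c r)" using T(3) by simp
      then obtain i c r where t: "(i, c, r) \<in> T" "p \<in> param K i ` ball c r" by blast
      then have "p \<in> patch K i" using T(2)[OF t(1)] param_in ball_subset_cball by blast
      then show ?thesis using t(1) by force
    qed
    then show "B \<subseteq> S \<times> (\<Union>i\<in>fst ` T. patch K i)" using assms(2) by auto
  qed (rule assms(1))
qed

lemma distr_V: "distr V borel (\<lambda>q. q) = \<nu> \<Otimes>\<^sub>M VK"
proof (rule measure_eqI)
  show "sets (distr V borel (\<lambda>q. q)) = sets (\<nu> \<Otimes>\<^sub>M VK)" by (simp add: sets_pair)
  fix B assume "B \<in> sets (distr V borel (\<lambda>q. q))"
  then have B: "B \<in> sets borel" by simp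
  have m: "(\<lambda>q. q) \<in> V \<rightarrow>\<^sub>M borel"
    using measurable_restrict_space1[of "\<lambda>q. q" borel borel "S \<times> UNIV"]
    by (simp add: measurable_cong_sets[OF sets_V refl])
  have "emeasure (distr V borel (\<lambda>q. q)) B = emeasure V (B \<inter> (S \<times> UNIV))"
    using B m by (simp add: emeasure_distr space_V)
  also have "\<dots> = emeasure (\<nu> \<Otimes>\<^sub>M VK) (B \<inter> (S \<times> UNIV))"
    using B cyl_borel by (intro emeasure_V) auto
  also have "\<dots> = emeasure (\<nu> \<Otimes>\<^sub>M VK) B"
  proof (rule emeasure_eq_AE)
    have "AE q in \<nu> \<Otimes>\<^sub>M VK. fst q \<in> S"
    proof (rule AE_pair_measure)
      have "{q \<in> space (\<nu> \<Otimes>\<^sub>M VK). fst q \<in> S} = S \<times> UNIV"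
        by (auto simp: space_pair_measure space_\<nu> space_VK)
      then show "{q \<in> space (\<nu> \<Otimes>\<^sub>M VK). fst q \<in> S} \<in> sets (\<nu> \<Otimes>\<^sub>M VK)"
        using cyl_borel by (simp add: sets_pair)
      show "AE x in \<nu>. AE y in VK. fst (x, y) \<in> S" using AE_S by auto
    qed
    then show "AE q in \<nu> \<Otimes>\<^sub>M VK. (q \<in> B \<inter> (S \<times> UNIV)) = (q \<in> B)" by eventually_elim (auto simp: mem_Times_iff)
  qed (use B cyl_borel in \<open>auto simp: sets_pair\<close>)
  finally show "emeasure (distr V borel (\<lambda>q. q)) B = emeasure (\<nu> \<Otimes>\<^sub>M VK) B" .
qed

lemma measurable_V:
  fixes h :: "real \<times> 'k \<Rightarrow> complex"
  assumes "continuous_on (S \<times> UNIV) h" shows "h \<in> borel_measurable V"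
  using borel_measurable_continuous_on_restrict[OF assms] by (simp add: measurable_cong_sets[OF sets_V refl])

text \<open>
  Fubini's theorem in both orders. Continuous functions on the compact set \<open>S \<times> K\<close> are bounded and the
  measures are finite, which gives integrability on the product.
\<close>

lemma product_integral:
  fixes h :: "real \<times> 'k \<Rightarrow> complex"
  assumes h: "continuous_on (S \<times> UNIV) h"
  shows "integrable V h"
    and "(\<integral>q. h q \<partial>V) = (\<integral>x. (\<integral>p. indicator S x *\<^sub>R h (x, p) \<partial>VK) \<partial>\<nu>)"
    and "(\<integral>q. h q \<partial>V) = (\<integral>p. (\<integral>x. indicator S x *\<^sub>R h (x, p) \<partial>\<nu>) \<partial>VK)"
proof -
  define g where "g q = indicator (S \<times> UNIV) q *\<^sub>R h q" for q
  have gm: "g \<in> borel_measurable borel"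
    using borel_measurable_continuous_on_restrict[OF h] cyl_borel
    by (subst (asm) borel_measurable_restrict_space_iff) (auto simp: g_def[abs_def])
  have "compact (h ` (S \<times> UNIV))"
    by (intro compact_continuous_image h compact_Times compact_S compact_UNIV)
  then obtain B where B: "\<And>q. q \<in> S \<times> UNIV \<Longrightarrow> norm (h q) \<le> B"
    by (meson bounded_iff compact_imp_bounded imageI)
  have gB: "norm (g q) \<le> max 0 B" for q using B[of q] by (auto simp: g_def indicator_def)
  have gm': "g \<in> borel_measurable (\<nu> \<Otimes>\<^sub>M VK)"
    using gm by (simp add: measurable_cong_sets[OF sets_pair refl])
  have fin: "finite_measure (\<nu> \<Otimes>\<^sub>M VK)"
    by (rule finite_measure_pair_measure[OF finite_measure_VK finite_\<nu>])
  interpret P: finite_measure "\<nu> \<Otimes>\<^sub>M VK" by (rule fin)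
  have gi: "integrable (\<nu> \<Otimes>\<^sub>M VK) g"
    by (rule P.integrable_const_bound[of _ "max 0 B"]) (use gB gm' in auto)
  have m: "(\<lambda>q. q) \<in> V \<rightarrow>\<^sub>M borel"
    using measurable_restrict_space1[of "\<lambda>q. q" borel borel "S \<times> UNIV"]
    by (simp add: measurable_cong_sets[OF sets_V refl])
  have hg: "h q = g q" if "q \<in> space V" for q using that by (simp add: g_def space_V)
  have "integrable V g" using gi m gm unfolding distr_V[symmetric] by (simp add: integrable_distr_eq)
  moreover have "integrable V h \<longleftrightarrow> integrable V g"
    by (rule Bochner_Integration.integrable_cong[OF refl hg])
  ultimately show "integrable V h" by simp
  have e: "(\<integral>q. h q \<partial>V) = (\<integral>q. g q \<partial>(\<nu> \<Otimes>\<^sub>M VK))"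
    unfolding distr_V[symmetric] using m gm hg
    by (simp add: integral_distr cong: Bochner_Integration.integral_cong)
  have gx: "g = (\<lambda>(x, p). indicator S x *\<^sub>R h (x, p))"
    by (auto simp: fun_eq_iff g_def indicator_times)
  have gi': "integrable (\<nu> \<Otimes>\<^sub>M VK) (\<lambda>(x, p). indicator S x *\<^sub>R h (x, p))"
    using gi unfolding gx .
  show "(\<integral>q. h q \<partial>V) = (\<integral>x. (\<integral>p. indicator S x *\<^sub>R h (x, p) \<partial>VK) \<partial>\<nu>)"
    unfolding e gx by (rule integral_fst[OF gi', symmetric])
  show "(\<integral>q. h q \<partial>V) = (\<integral>p. (\<integral>x. indicator S x *\<^sub>R h (x, p) \<partial>\<nu>) \<partial>VK)"
    unfolding e gx by (rule integral_snd[OF gi', symmetric])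
qed

end

section \<open>Differential geometry of the cylinder\<close>

lemma sum_Basis_real_prod:
  "(\<Sum>b\<in>(Basis :: (real \<times> 'e::euclidean_space) set). F b) = F (1, 0) + (\<Sum>b\<in>Basis. F (0, b))"
proof -
  have "(\<Sum>b\<in>Pair (0::real) ` (Basis :: 'e set). F b) = (\<Sum>b\<in>Basis. F (0, b))"
    by (subst sum.reindex) (auto simp: inj_on_def)
  then show ?thesis unfolding Basis_real_prod by (subst sum.insert) auto
qed

lemma sharp_zero: "posdef G \<Longrightarrow> sharp G 0 = 0"
  by (rule sharp_eqI) (auto simp: posdef_def bilinear_lzero bilinear_rzero)

locale cylinder_manifold = closed_manifold K VK
  for K :: "('i, 'k::{t2_space, second_countable_topology}, 'e::euclidean_space) riem" and VK +
  fixes f :: "real \<Rightarrow> real"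
  assumes smooth_f: "smooth_on {0..1} f" and f_pos: "\<And>x. x \<in> {0..1} \<Longrightarrow> f x > 0"
begin

abbreviation "C \<equiv> cylinder f K"

lemma cyl_sel:
  "idx C = idx K" "patch C i = {0..1} \<times> patch K i" "coord C i (x, p) = (x, coord K i p)"
  "gform C i (x, z) = (\<lambda>(s, v) (t, w). f x * (s * t + gform K i z v w))"
  by (simp_all add: cylinder_def)

lemma cyl_cimage: "cimage C i = {0..1} \<times> cimage K i"
  unfolding cimage_def cyl_sel by (force simp: cyl_sel)

lemma cyl_points: "points C = {0..1} \<times> UNIV"
  using points_UNIV by (auto simp: points_def cyl_sel)

lemma cyl_param:
  assumes "i \<in> idx K" "x \<in> {0..1}" "z \<in> cimage K i"
  shows "param C i (x, z) = (x, param K i z)"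
  unfolding param_def[of C]
proof (rule inv_into_f_eq)
  show "inj_on (coord C i) (patch C i)"
    using param_coord[OF assms(1)] by (auto simp: inj_on_def cyl_sel) metis
qed (use assms in \<open>auto simp: cyl_sel param_in coord_param\<close>)

lemma cyl_uniq: "i \<in> idx K \<Longrightarrow> uniq_deriv (cimage C i)"
  unfolding cyl_cimage by (intro uniq_deriv_Times uniq_deriv_unit_interval uniq_cimage)

text \<open>
  The sets \<open>{0..1} \<times> patch K i\<close> are relatively open and cover the cylinder.
\<close>

lemma continuous_on_cyl:
  fixes F :: "real \<times> 'k \<Rightarrow> complex"
  assumes G: "\<And>i. i \<in> idx K \<Longrightarrow> continuous_on (cimage C i) (G i)"
    and F: "\<And>i x p. i \<in> idx K \<Longrightarrow> x \<in> {0..1} \<Longrightarrow> p \<in> patch K i \<Longrightarrow> F (x, p) = G i (x, coord K i p)"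
  shows "continuous_on ({0..1} \<times> UNIV) F"
  unfolding continuous_on_eq_continuous_within
proof
  fix q :: "real \<times> 'k" assume q: "q \<in> {0..1} \<times> UNIV"
  obtain i where i: "i \<in> idx K" "snd q \<in> patch K i" using ex_chart by blast
  have "continuous_on ({0..1} \<times> patch K i) (\<lambda>q. G i (fst q, coord K i (snd q)))"
  proof (rule continuous_on_compose2[OF G[OF i(1)]])
    show "continuous_on ({0..1} \<times> patch K i) (\<lambda>q. (fst q, coord K i (snd q)))"
      by (intro continuous_intros continuous_on_compose2[OF continuous_coord[OF i(1)]]) auto
    show "(\<lambda>q. (fst q, coord K i (snd q))) ` ({0..1} \<times> patch K i) \<subseteq> cimage C i"
      by (auto simp: cyl_cimage coord_in)
  qed
  then have "continuous_on ({0..1} \<times> patch K i) F"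
    by (rule continuous_on_eq) (use F[OF i(1)] in auto)
  then have "continuous (at q within {0..1} \<times> patch K i) F"
    unfolding continuous_on_eq_continuous_within by (rule bspec) (use q i in \<open>simp add: mem_Times_iff\<close>)
  moreover have "at q within {0..1} \<times> patch K i = at q within {0..1} \<times> UNIV"
    by (rule at_within_nhd[of _ "UNIV \<times> patch K i"])
      (use i chart(1)[OF i(1)] in \<open>auto simp: mem_Times_iff intro: open_Times\<close>)
  ultimately show "continuous (at q within {0..1} \<times> UNIV) F" by simp
qed

lemma C1_cyl_D:
  assumes "C1_fun C u" "i \<in> idx K"
  shows "Ck_on 1 (cimage C i) (u \<circ> param C i)"
  using assms by (simp only: C1_fun_def cyl_sel)

text \<open>
  Unlike the partial derivative in a chart, this form of \<open>\<partial>\<^sub>x u\<close> involves no chart, so it is a function on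
  the cylinder.
\<close>

definition dx :: "(real \<times> 'k \<Rightarrow> complex) \<Rightarrow> real \<times> 'k \<Rightarrow> complex" where
  "dx u q = vector_derivative (\<lambda>t. u (t, snd q)) (at (fst q) within {0..1})"

lemma C1_cyl_derivative:
  assumes u: "C1_fun C u" and i: "i \<in> idx K" and x: "x \<in> {0..1}" and z: "z \<in> cimage K i"
  shows "((u \<circ> param C i) has_derivative
    frechet_derivative (u \<circ> param C i) (at (x, z) within cimage C i)) (at (x, z) within cimage C i)"
  by (rule Ck_on_Suc_has_derivative[OF C1_cyl_D[OF u i, unfolded One_nat_def]])
    (use x z in \<open>simp add: cyl_cimage\<close>)

lemma dx_chart:
  assumes u: "C1_fun C u" and i: "i \<in> idx K" and x: "x \<in> {0..1}" and z: "z \<in> cimage K i"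
  shows "((\<lambda>t. u (t, param K i z)) has_vector_derivative pd (cimage C i) (u \<circ> param C i) (1, 0) (x, z))
      (at x within {0..1})"
    and "pd (cimage C i) (u \<circ> param C i) (1, 0) (x, z) = dx u (x, param K i z)"
proof -
  define D where "D = frechet_derivative (u \<circ> param C i) (at (x, z) within cimage C i)"
  have D: "((u \<circ> param C i) has_derivative D) (at (x, z) within cimage C i)"
    unfolding D_def by (rule C1_cyl_derivative[OF assms])
  have lD: "linear D" by (rule has_derivative_linear[OF D])
  have "((u \<circ> param C i) has_derivative D) (at (x, z) within (\<lambda>t. (t, z)) ` {0..1})"
    by (rule has_derivative_subset[OF D]) (use z in \<open>auto simp: cyl_cimage\<close>)
  moreover have "((\<lambda>t. (t, z)) has_derivative (\<lambda>h. (h, 0))) (at x within {0..1})"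
    by (auto intro!: derivative_eq_intros)
  ultimately have "((\<lambda>t. (u \<circ> param C i) (t, z)) has_derivative (\<lambda>h. D (h, 0))) (at x within {0..1})"
    using has_derivative_in_compose[of "\<lambda>t. (t, z)" "\<lambda>h. (h, 0)" x "{0..1}"] by blast
  then have "((\<lambda>t. u (t, param K i z)) has_derivative (\<lambda>h. D (h, 0))) (at x within {0..1})"
    by (rule has_derivative_transform[OF x, rotated]) (use i z in \<open>simp add: cyl_param\<close>)
  moreover have "(\<lambda>h. D (h, 0)) = (\<lambda>h. h *\<^sub>R D (1, 0))"
  proof
    show "D (h, 0) = h *\<^sub>R D (1, 0)" for h using linear_cmul[OF lD, of h "(1, 0)"] by simp
  qed
  ultimately have "((\<lambda>t. u (t, param K i z)) has_derivative (\<lambda>h. h *\<^sub>R D (1, 0))) (at x within {0..1})"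
    by (simp only:)
  then show *: "((\<lambda>t. u (t, param K i z)) has_vector_derivative pd (cimage C i) (u \<circ> param C i) (1, 0) (x, z))
      (at x within {0..1})"
    unfolding has_vector_derivative_def pd_def D_def .
  show "pd (cimage C i) (u \<circ> param C i) (1, 0) (x, z) = dx u (x, param K i z)"
    unfolding dx_def using vector_derivative_within_cbox[of 0 1 x "\<lambda>t. u (t, param K i z)"] * x by simp
qed

lemma dx_derivative:
  assumes u: "C1_fun C u" and x: "x \<in> {0..1}"
  shows "((\<lambda>t. u (t, p)) has_vector_derivative dx u (x, p)) (at x within {0..1})"
proof -
  obtain i where i: "i \<in> idx K" "p \<in> patch K i" using ex_chart by blast
  show ?thesis using dx_chart[OF u i(1) x coord_in[OF i(2)]] by (simp add: param_coord[OF i])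
qed

text \<open>
  By composition with the embedding of the slice at fixed \<open>x\<close>. This turns the tangential part of gradients
  on the cylinder into gradients on \<open>K\<close>.
\<close>

lemma slice_pd:
  assumes u: "C1_fun C u" and i: "i \<in> idx K" and x: "x \<in> {0..1}" and z: "z \<in> cimage K i"
  shows "(((\<lambda>p. u (x, p)) \<circ> param K i) has_derivative
      (\<lambda>v. frechet_derivative (u \<circ> param C i) (at (x, z) within cimage C i) (0, v))) (at z within cimage K i)"
    and "pd (cimage K i) ((\<lambda>p. u (x, p)) \<circ> param K i) b z = pd (cimage C i) (u \<circ> param C i) (0, b) (x, z)"
proof -
  define D where "D = frechet_derivative (u \<circ> param C i) (at (x, z) within cimage C i)"
  have D: "((u \<circ> param C i) has_derivative D) (at (x, z) within cimage C i)"
    unfolding D_def by (rule C1_cyl_derivative[OF assms])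
  have "((u \<circ> param C i) has_derivative D) (at (x, z) within (Pair x) ` cimage K i)"
    by (rule has_derivative_subset[OF D]) (use x in \<open>auto simp: cyl_cimage\<close>)
  moreover have "(Pair x has_derivative (\<lambda>v. (0, v))) (at z within cimage K i)"
    by (auto intro!: derivative_eq_intros)
  ultimately have "((\<lambda>z. (u \<circ> param C i) (x, z)) has_derivative (\<lambda>v. D (0, v))) (at z within cimage K i)"
    using has_derivative_in_compose[of "Pair x" "\<lambda>v. (0, v)" z "cimage K i"] by blast
  then show *: "(((\<lambda>p. u (x, p)) \<circ> param K i) has_derivative
      (\<lambda>v. frechet_derivative (u \<circ> param C i) (at (x, z) within cimage C i) (0, v))) (at z within cimage K i)"
    unfolding D_def[symmetric]
    by (rule has_derivative_transform[OF z, rotated]) (use i x in \<open>simp add: cyl_param\<close>)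
  show "pd (cimage K i) ((\<lambda>p. u (x, p)) \<circ> param K i) b z = pd (cimage C i) (u \<circ> param C i) (0, b) (x, z)"
    using pd_eq[OF uniq_cimage[OF i] z *] by (simp add: pd_def)
qed

lemma C1_slice:
  assumes u: "C1_fun C u" and x: "x \<in> {0..1}"
  shows "C1_fun K (\<lambda>p. u (x, p))"
  unfolding C1_fun_def
proof
  fix i assume i: "i \<in> idx K"
  have "Ck_on (Suc 0) (cimage K i) ((\<lambda>p. u (x, p)) \<circ> param K i)"
  proof (rule Ck_on_SucI[OF uniq_cimage[OF i] slice_pd(1)[OF u i x]])
    fix a :: 'e assume "a \<in> Basis"
    then have "continuous_on (cimage C i) (pd (cimage C i) (u \<circ> param C i) (0, a))"
      using C1_cyl_D[OF u i] unfolding Ck_on_1 by (auto simp: Basis_real_prod)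
    then have "continuous_on (cimage K i) (\<lambda>z. pd (cimage C i) (u \<circ> param C i) (0, a) (x, z))"
      by (rule continuous_on_compose2) (use x in \<open>auto simp: cyl_cimage intro!: continuous_intros\<close>)
    then show "Ck_on 0 (cimage K i) (\<lambda>z. frechet_derivative (u \<circ> param C i) (at (x, z) within cimage C i) (0, a))"
      by (simp add: pd_def)
  qed
  then show "Ck_on 1 (cimage K i) ((\<lambda>p. u (x, p)) \<circ> param K i)" by (simp only: One_nat_def)
qed

lemma continuous_cyl_fun:
  assumes "C1_fun C u" shows "continuous_on ({0..1} \<times> UNIV) u"
  by (rule continuous_on_cyl[of "\<lambda>i. u \<circ> param C i", OF Ck_on_continuous[OF C1_cyl_D[OF assms]]])
    (auto simp: cyl_param param_coord coord_in)

lemma continuous_pd_cyl: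
  assumes "C1_fun C u" "i \<in> idx K" "a \<in> Basis"
  shows "continuous_on (cimage C i) (pd (cimage C i) (u \<circ> param C i) a)"
  using C1_cyl_D[OF assms(1,2)] assms(3) unfolding Ck_on_1 by blast

lemma continuous_dx:
  assumes u: "C1_fun C u" shows "continuous_on ({0..1} \<times> UNIV) (dx u)"
proof (rule continuous_on_cyl)
  show "continuous_on (cimage C i) (pd (cimage C i) (u \<circ> param C i) (1, 0))" if "i \<in> idx K" for i
    by (rule continuous_pd_cyl[OF u that]) (simp add: Basis_real_prod)
  show "dx u (x, p) = pd (cimage C i) (u \<circ> param C i) (1, 0) (x, coord K i p)"
    if "i \<in> idx K" "x \<in> {0..1}" "p \<in> patch K i" for i x p
    using dx_chart(2)[OF u that(1,2) coord_in[OF that(3)]] that by (simp add: param_coord)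
qed

lemma continuous_slice_grad:
  assumes u: "C1_fun C u" and v: "C1_fun C v"
  shows "continuous_on ({0..1} \<times> UNIV) (\<lambda>q. grad_inner K (\<lambda>p. u (fst q, p)) (\<lambda>p. v (fst q, p)) (snd q))"
proof (rule continuous_on_cyl)
  fix i assume i: "i \<in> idx K"
  have "continuous_on (cimage C i) (\<lambda>q. gram_inv (gform K i (snd q)) a b)" if "a \<in> Basis" "b \<in> Basis" for a b
    by (rule continuous_on_compose2[OF Ck_on_continuous[OF Ck_on_gram_inv[OF i that, of 0]]])
      (auto simp: cyl_cimage intro!: continuous_intros)
  moreover have "continuous_on (cimage C i) (pd (cimage C i) (u \<circ> param C i) (0, a))"
    "continuous_on (cimage C i) (pd (cimage C i) (v \<circ> param C i) (0, a))" if "a \<in> Basis" for a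
    using that by (auto intro!: continuous_pd_cyl u v i simp: Basis_real_prod)
  ultimately show "continuous_on (cimage C i) (\<lambda>q. \<Sum>a\<in>Basis. \<Sum>b\<in>Basis. gram_inv (gform K i (snd q)) a b *\<^sub>R
      (pd (cimage C i) (u \<circ> param C i) (0, a) q * cnj (pd (cimage C i) (v \<circ> param C i) (0, b) q)))"
    by (intro continuous_on_sum continuous_on_scaleR continuous_on_mult continuous_on_cnj) simp_all
next
  fix i and x :: real and p assume i: "i \<in> idx K" and x: "x \<in> {0..1}" and p: "p \<in> patch K i"
  show "grad_inner K (\<lambda>p'. u (fst (x, p), p')) (\<lambda>p'. v (fst (x, p), p')) (snd (x, p)) =
    (\<Sum>a\<in>Basis. \<Sum>b\<in>Basis. gram_inv (gform K i (snd (x, coord K i p))) a b *\<^sub>R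
      (pd (cimage C i) (u \<circ> param C i) (0, a) (x, coord K i p) *
       cnj (pd (cimage C i) (v \<circ> param C i) (0, b) (x, coord K i p))))"
    using grad_inner_chart[OF C1_slice[OF u x] C1_slice[OF v x] i p]
    by (simp add: chart_grad_def slice_pd(2)[OF u i x coord_in[OF p]] slice_pd(2)[OF v i x coord_in[OF p]])
qed

text \<open>
  The metric is conformal to a product, so its inverse is block diagonal. The tangential part is the
  gradient product on \<open>K\<close> of the slices, whichever chart the definition on the cylinder picks.
\<close>

lemma grad_inner_cyl:
  assumes u: "C1_fun C u" and v: "C1_fun C v" and x: "x \<in> {0..1}"
  shows "grad_inner C u v (x, p) =
    (dx u (x, p) * cnj (dx v (x, p)) + grad_inner K (\<lambda>p. u (x, p)) (\<lambda>p. v (x, p)) p) /\<^sub>R f x"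
proof -
  define i where "i = (SOME i. i \<in> idx C \<and> (x, p) \<in> patch C i)"
  have "\<exists>i. i \<in> idx C \<and> (x, p) \<in> patch C i" using ex_chart[of p] x by (auto simp: cyl_sel)
  then have "i \<in> idx C \<and> (x, p) \<in> patch C i" unfolding i_def by (rule someI_ex)
  then have i: "i \<in> idx K" "p \<in> patch K i" by (auto simp: cyl_sel)
  define z where "z = coord K i p"
  have z: "z \<in> cimage K i" "param K i z = p" using i by (auto simp: z_def coord_in param_coord)
  define G where "G = gform K i z"
  have G: "posdef G" using posdef_gform[OF i(1) z(1)] by (simp add: G_def)
  have gi: "gram_inv (gform C i (x, z)) (s, a) (t, b) = (s * t + sharp G a \<bullet> b) / f x" for s t a b
    unfolding cyl_sel G_def[symmetric] by (rule gram_inv_cyl[OF G f_pos[OF x]])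
  have "grad_inner C u v (x, p) = (\<Sum>a\<in>Basis. \<Sum>b\<in>Basis. gram_inv (gform C i (x, z)) a b *\<^sub>R
        (pd (cimage C i) (u \<circ> param C i) a (x, z) * cnj (pd (cimage C i) (v \<circ> param C i) b (x, z))))"
    unfolding grad_inner_def i_def[symmetric] Let_def cyl_sel(3) z_def by (rule refl)
  also have "\<dots> = (1 / f x) *\<^sub>R (dx u (x, p) * cnj (dx v (x, p))) +
      (\<Sum>a\<in>Basis. \<Sum>b\<in>Basis. ((sharp G a \<bullet> b) / f x) *\<^sub>R
        (pd (cimage K i) ((\<lambda>p. u (x, p)) \<circ> param K i) a z * cnj (pd (cimage K i) ((\<lambda>p. v (x, p)) \<circ> param K i) b z)))"
    using dx_chart(2)[OF u i(1) x z(1)] dx_chart(2)[OF v i(1) x z(1)]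
    by (simp add: sum_Basis_real_prod gi sharp_zero[OF G] z(2) slice_pd(2)[OF u i(1) x z(1)]
        slice_pd(2)[OF v i(1) x z(1)])
  also have "(\<Sum>a\<in>Basis. \<Sum>b\<in>Basis. ((sharp G a \<bullet> b) / f x) *\<^sub>R
        (pd (cimage K i) ((\<lambda>p. u (x, p)) \<circ> param K i) a z * cnj (pd (cimage K i) ((\<lambda>p. v (x, p)) \<circ> param K i) b z)))
      = grad_inner K (\<lambda>p. u (x, p)) (\<lambda>p. v (x, p)) p /\<^sub>R f x"
    unfolding grad_inner_chart[OF C1_slice[OF u x] C1_slice[OF v x] i] chart_grad_def z_def[symmetric]
      G_def[symmetric] gram_inv_sharp scaleR_sum_right
    by (simp add: divide_inverse mult.commute)
  finally show ?thesis by (simp add: scaleR_add_right divide_inverse)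
qed

lemma continuous_f: "continuous_on {0..1} f"
  using smooth_f unfolding smooth_on_def by (meson Ck_on_continuous)

lemma continuous_grad_inner_cyl:
  assumes u: "C1_fun C u" and v: "C1_fun C v"
  shows "continuous_on ({0..1} \<times> UNIV) (grad_inner C u v)"
proof -
  have "continuous_on ({0..1} \<times> UNIV) (\<lambda>q. f (fst q))"
    by (rule continuous_on_compose2[OF continuous_f]) (auto intro: continuous_intros)
  moreover have nz: "f (fst q) \<noteq> 0" if "q \<in> {0..1} \<times> (UNIV :: 'k set)" for q
    using f_pos[of "fst q"] that by auto
  ultimately have "continuous_on ({0..1} \<times> UNIV) (\<lambda>q. (dx u q * cnj (dx v q) +
      grad_inner K (\<lambda>p. u (fst q, p)) (\<lambda>p. v (fst q, p)) (snd q)) /\<^sub>R f (fst q))"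
    by (intro continuous_intros continuous_dx continuous_slice_grad u v ballI nz)
  then show ?thesis
    by (rule continuous_on_eq) (auto simp: grad_inner_cyl[OF u v])
qed

end

section \<open>Volumes of the cylinder and of its boundary\<close>

context product_volume
begin

lemma product_L2:
  assumes g: "continuous_on S g" and Y: "continuous_on UNIV Y"
    and h: "\<And>x p. x \<in> S \<Longrightarrow> h (x, p) = g x * Y p"
  shows "L2_fun V h"
    and "(\<integral>q. (norm (h q))\<^sup>2 \<partial>V) = (\<integral>x. indicator S x * (norm (g x))\<^sup>2 \<partial>\<nu>) * (\<integral>p. (norm (Y p))\<^sup>2 \<partial>VK)"
proof -
  have "continuous_on (S \<times> UNIV) (\<lambda>q. g (fst q) * Y (snd q))"
    by (intro continuous_on_mult continuous_on_compose2[OF g] continuous_on_compose2[OF Y] continuous_intros) auto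
  then have ch: "continuous_on (S \<times> UNIV) h" by (rule continuous_on_eq) (auto simp: h)
  then have ch2: "continuous_on (S \<times> UNIV) (\<lambda>q. complex_of_real ((norm (h q))\<^sup>2))"
    by (intro continuous_intros)
  have i: "integrable V (\<lambda>q. (norm (h q))\<^sup>2)" using product_integral(1)[OF ch2] by (simp only: complex_of_real_integrable_eq)
  then show "L2_fun V h" unfolding L2_fun_def using measurable_V[OF ch] by simp
  have "complex_of_real (\<integral>q. (norm (h q))\<^sup>2 \<partial>V) = (\<integral>q. complex_of_real ((norm (h q))\<^sup>2) \<partial>V)"
    by (rule integral_complex_of_real[symmetric])
  also have "\<dots> = (\<integral>x. (\<integral>p. indicator S x *\<^sub>R complex_of_real ((norm (h (x, p)))\<^sup>2) \<partial>VK) \<partial>\<nu>)"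
    by (rule product_integral(2)[OF ch2])
  also have "\<dots> = (\<integral>x. (\<integral>p. complex_of_real (indicator S x * (norm (g x))\<^sup>2 * (norm (Y p))\<^sup>2) \<partial>VK) \<partial>\<nu>)"
    by (intro Bochner_Integration.integral_cong refl)
      (auto simp: h norm_mult power_mult_distrib indicator_def)
  also have "\<dots> = (\<integral>x. complex_of_real (indicator S x * (norm (g x))\<^sup>2 * (\<integral>p. (norm (Y p))\<^sup>2 \<partial>VK)) \<partial>\<nu>)"
    by (simp only: integral_complex_of_real integral_mult_right_zero)
  also have "\<dots> = complex_of_real ((\<integral>x. indicator S x * (norm (g x))\<^sup>2 \<partial>\<nu>) * (\<integral>p. (norm (Y p))\<^sup>2 \<partial>VK))"
    by (simp only: integral_complex_of_real integral_mult_left_zero)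
  finally show "(\<integral>q. (norm (h q))\<^sup>2 \<partial>V) = (\<integral>x. indicator S x * (norm (g x))\<^sup>2 \<partial>\<nu>) * (\<integral>p. (norm (Y p))\<^sup>2 \<partial>VK)"
    by (simp only: of_real_eq_iff)
qed

end

context cylinder_manifold
begin

text \<open>
  The density of the volume of the cylinder with respect to \<open>dx\<close> times the volume of \<open>K\<close>, that is
  \<open>f\<^sup>N\<^sup>/\<^sup>2\<close> with \<open>N\<close> the dimension of the cylinder.
\<close>

definition cyl_weight :: "real \<Rightarrow> real" where "cyl_weight x = sqrt (f x ^ (DIM('e) + 1))"
definition cyl_axis :: "real measure" where "cyl_axis = density lborel (\<lambda>x. ennreal (indicator {0..1} x * cyl_weight x))"

lemma cyl_weight_pos: "x \<in> {0..1} \<Longrightarrow> 0 < cyl_weight x"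
  using f_pos by (simp add: cyl_weight_def)

lemma continuous_cyl_weight: "continuous_on {0..1} cyl_weight"
  unfolding cyl_weight_def by (intro continuous_intros continuous_f)

lemma cyl_weight_measurable: "(\<lambda>x. indicator {0..1} x * cyl_weight x) \<in> borel_measurable borel"
  using borel_measurable_continuous_on_restrict[OF continuous_cyl_weight]
  by (subst (asm) borel_measurable_restrict_space_iff) (auto simp: mult.commute)

lemma cyl_weight_nonneg: "0 \<le> indicator {0..1} x * cyl_weight x"
  using cyl_weight_pos[of x] by (auto simp: indicator_def less_imp_le)

lemma finite_cyl_axis: "finite_measure cyl_axis"
proof
  have "integrable lborel (\<lambda>x. indicator {0..1} x *\<^sub>R cyl_weight x)"
    by (intro borel_integrable_compact continuous_cyl_weight) auto
  then have "(\<integral>\<^sup>+x. ennreal (indicator {0..1} x * cyl_weight x) \<partial>lborel) < \<infinity>"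
    using cyl_weight_nonneg by (subst (asm) integrable_iff_bounded) (simp add: abs_of_nonneg)
  then show "emeasure cyl_axis (space cyl_axis) \<noteq> \<infinity>"
    unfolding cyl_axis_def using cyl_weight_measurable by (subst emeasure_density) auto
qed

lemma integral_cyl_axis:
  fixes g :: "real \<Rightarrow> 'z::euclidean_space"
  assumes g: "continuous_on {0..1} g"
  shows "(\<integral>x. indicator {0..1} x *\<^sub>R g x \<partial>cyl_axis) = integral {0..1} (\<lambda>x. cyl_weight x *\<^sub>R g x)"
proof -
  have gm: "(\<lambda>x. indicator {0..1} x *\<^sub>R g x) \<in> borel_measurable borel"
    using borel_measurable_continuous_on_restrict[OF g]
    by (subst (asm) borel_measurable_restrict_space_iff) auto
  have "(\<integral>x. indicator {0..1} x *\<^sub>R g x \<partial>cyl_axis) =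
      (\<integral>x. (indicator {0..1} x * cyl_weight x) *\<^sub>R (indicator {0..1} x *\<^sub>R g x) \<partial>lborel)"
    unfolding cyl_axis_def
    by (rule integral_density) (use gm cyl_weight_measurable cyl_weight_nonneg in auto)
  also have "\<dots> = (LINT x:{0..1}|lborel. cyl_weight x *\<^sub>R g x)"
    unfolding set_lebesgue_integral_def
    by (intro Bochner_Integration.integral_cong) (auto simp: indicator_def)
  also have "\<dots> = integral {0..1} (\<lambda>x. cyl_weight x *\<^sub>R g x)"
    by (rule set_borel_integral_eq_integral(2), unfold set_integrable_def)
      (intro borel_integrable_compact continuous_intros continuous_cyl_weight g, simp)
  finally show ?thesis .
qed

lemma vdens_cyl:
  assumes i: "i \<in> idx K" and x: "x \<in> {0..1}" and z: "z \<in> cimage K i"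
  shows "vdens C i (x, z) = cyl_weight x * vdens K i z"
proof -
  have "bilinear (gform K i z)" using posdef_gform[OF i z] by (simp add: posdef_def)
  then have "gram_det (gform C i (x, z)) = f x ^ (DIM('e) + 1) * gram_det (gform K i z)"
    unfolding cyl_sel by (rule gram_det_cyl)
  then show ?thesis by (simp only: vdens_def cyl_weight_def real_sqrt_mult)
qed

lemma measurable_cimage_vdens:
  assumes i: "i \<in> idx K"
  shows "(\<lambda>z. indicator (cimage K i) z * vdens K i z) \<in> borel_measurable borel"
  using measurable_vdens[OF i] chart(2)[OF i]
  by (subst (asm) borel_measurable_restrict_space_iff) (auto simp: mult.commute)

text \<open>
  The factor \<open>indicator (cimage K i)\<close> makes the integrand measurable on the whole space, since
  \<open>vdens K i\<close> is only controlled on the image of the chart.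
\<close>

lemma nn_integral_vdens_cmult:
  assumes i: "i \<in> idx K" and B: "B \<in> sets borel" "B \<subseteq> patch K i"
  shows "(\<integral>\<^sup>+z. c * (ennreal (indicator (cimage K i) z * vdens K i z) * indicator (coord K i ` B) z) \<partial>lborel)
    = c * emeasure VK B"
proof -
  have "coord K i ` B = param K i -` B \<inter> space (restrict_space borel (cimage K i))"
    using B(2) i by (auto simp: space_restrict_space param_coord coord_in subset_iff)
      (metis coord_param image_eqI vimageI)
  also have "\<dots> \<in> sets (restrict_space borel (cimage K i))"
    by (rule measurable_sets[OF _ B(1)])
      (rule borel_measurable_continuous_on_restrict[OF continuous_param[OF i]])
  finally have "coord K i ` B \<in> sets borel"
    using chart(2)[OF i] by (subst (asm) sets_restrict_space_iff) auto
  then have "(\<lambda>z. ennreal (indicator (cimage K i) z * vdens K i z) * indicator (coord K i ` B) z)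
      \<in> borel_measurable lborel"
    using measurable_cimage_vdens[OF i] by simp
  then have "(\<integral>\<^sup>+z. c * (ennreal (indicator (cimage K i) z * vdens K i z) * indicator (coord K i ` B) z) \<partial>lborel)
      = c * (\<integral>\<^sup>+z. ennreal (indicator (cimage K i) z * vdens K i z) * indicator (coord K i ` B) z \<partial>lborel)"
    by (rule nn_integral_cmult)
  also have "(\<integral>\<^sup>+z. ennreal (indicator (cimage K i) z * vdens K i z) * indicator (coord K i ` B) z \<partial>lborel)
      = emeasure VK B"
    unfolding emeasure_VK_chart[OF i B]
    by (intro nn_integral_cong) (use B(2) in \<open>auto simp: indicator_def coord_in\<close>)
  finally show ?thesis .
qed

text \<open>
  In a chart the density of the cylinder is \<open>cyl_weight x\<close> times that of \<open>K\<close>, and the Lebesgue measure on the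
  product is the product of the Lebesgue measures.
\<close>

lemma cylinder_volume_product:
  assumes VM: "riemannian_volume C VM"
  shows "product_volume K VK {0..1} cyl_axis VM"
proof (intro product_volume.intro product_volume_axioms.intro closed_manifold_axioms)
  have sp: "space VM = {0..1} \<times> UNIV" and st: "sets VM = sets (restrict_space borel ({0..1} \<times> UNIV))"
    using VM by (auto simp: riemannian_volume_def cyl_points)
  show "compact {0..1::real}" by simp
  show "sets cyl_axis = sets borel" by (simp add: cyl_axis_def)
  show "finite_measure cyl_axis" by (rule finite_cyl_axis)
  show "AE x in cyl_axis. x \<in> {0..1}"
    unfolding cyl_axis_def using cyl_weight_measurable by (subst AE_density) (auto simp: indicator_def)
  show "space VM = {0..1} \<times> UNIV" by (rule sp)
  show "sets VM = sets (restrict_space borel ({0..1} \<times> UNIV))" by (rule st)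
  fix i and B :: "(real \<times> 'k) set" assume i: "i \<in> idx K" and B: "B \<in> sets borel" "B \<subseteq> {0..1} \<times> patch K i"
  have cl: "{0..1::real} \<times> (UNIV :: 'k set) \<in> sets borel"
    by (intro borel_closed closed_Times) auto
  have "B \<in> sets VM" using B cl by (auto simp: st sets_restrict_space_iff)
  then have "emeasure VM B = (\<integral>\<^sup>+q. ennreal (vdens C i q) * indicator (coord C i ` B) q \<partial>lborel)"
    using VM B(2) i unfolding riemannian_volume_def by (simp add: cyl_sel)
  also have "\<dots> = (\<integral>\<^sup>+q. ennreal (indicator {0..1} (fst q) * cyl_weight (fst q)) *
      (ennreal (indicator (cimage K i) (snd q) * vdens K i (snd q)) * indicator (coord C i ` B) q) \<partial>lborel)"
  proof (intro nn_integral_cong)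
    fix q :: "real \<times> 'e"
    show "ennreal (vdens C i q) * indicator (coord C i ` B) q =
      ennreal (indicator {0..1} (fst q) * cyl_weight (fst q)) *
      (ennreal (indicator (cimage K i) (snd q) * vdens K i (snd q)) * indicator (coord C i ` B) q)"
    proof (cases "q \<in> coord C i ` B")
      case True
      then have q: "fst q \<in> {0..1}" "snd q \<in> cimage K i" using B(2) by (auto simp: cyl_sel coord_in)
      then have "vdens C i q = cyl_weight (fst q) * vdens K i (snd q)"
        using vdens_cyl[OF i q] by simp
      then show ?thesis using q cyl_weight_pos[OF q(1)] by (simp add: ennreal_mult' less_imp_le mult.assoc)
    qed simp
  qed
  also have "\<dots> = (\<integral>\<^sup>+q. ennreal (indicator {0..1} (fst q) * cyl_weight (fst q)) *
      (ennreal (indicator (cimage K i) (snd q) * vdens K i (snd q)) * indicator (coord C i ` B) q)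
        \<partial>(lborel \<Otimes>\<^sub>M lborel))"
    by (simp only: lborel_prod)
  also have "\<dots> = (\<integral>\<^sup>+x. \<integral>\<^sup>+z. ennreal (indicator {0..1} x * cyl_weight x) *
      (ennreal (indicator (cimage K i) z * vdens K i z) * indicator (coord C i ` B) (x, z)) \<partial>lborel \<partial>lborel)"
  proof -
    note v = measurable_cimage_vdens[OF i]
    have cB: "coord C i ` B \<in> sets borel"
    proof -
      have "continuous_on ({0..1} \<times> cimage K i) (\<lambda>q. (fst q, param K i (snd q)))"
        by (intro continuous_intros continuous_on_compose2[OF continuous_param[OF i]]) auto
      then have "(\<lambda>q. (fst q, param K i (snd q))) \<in> restrict_space borel ({0..1} \<times> cimage K i) \<rightarrow>\<^sub>M borel"
        by (rule borel_measurable_continuous_on_restrict)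
      then have "(\<lambda>q. (fst q, param K i (snd q))) -` B \<inter> space (restrict_space borel ({0..1} \<times> cimage K i))
          \<in> sets (restrict_space borel ({0..1} \<times> cimage K i))"
        using B(1) by (rule measurable_sets)
      also have "(\<lambda>q. (fst q, param K i (snd q))) -` B \<inter> space (restrict_space borel ({0..1} \<times> cimage K i)) = coord C i ` B"
      proof -
        have mem: "(x, z) \<in> coord C i ` B \<longleftrightarrow> x \<in> {0..1} \<and> z \<in> cimage K i \<and> (x, param K i z) \<in> B" for x z
        proof
          assume "(x, z) \<in> coord C i ` B"
          then obtain p where p: "(x, p) \<in> B" "z = coord K i p" by (auto simp: cyl_sel)
          then show "x \<in> {0..1} \<and> z \<in> cimage K i \<and> (x, param K i z) \<in> B"
            using B(2) i by (auto simp: coord_in param_coord)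
        next
          assume a: "x \<in> {0..1} \<and> z \<in> cimage K i \<and> (x, param K i z) \<in> B"
          then have "(x, z) = coord C i (x, param K i z)" using i by (simp add: cyl_sel coord_param)
          then show "(x, z) \<in> coord C i ` B" using a by blast
        qed
        show ?thesis
        proof (rule Set.set_eqI)
          fix q :: "real \<times> 'e"
          obtain x z where q: "q = (x, z)" by (cases q)
          show "q \<in> (\<lambda>q. (fst q, param K i (snd q))) -` B \<inter> space (restrict_space borel ({0..1} \<times> cimage K i))
              \<longleftrightarrow> q \<in> coord C i ` B"
            unfolding q mem by (auto simp: space_restrict_space)
        qed
      qed
      finally show ?thesis
        using borel_closed[OF closed_atLeastAtMost, of 0 "1::real"] chart(2)[OF i]
        by (subst (asm) sets_restrict_space_iff) (auto simp: borel_Times)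
    qed
    have "(\<lambda>q. ennreal (indicator {0..1} (fst q) * cyl_weight (fst q)) *
      (ennreal (indicator (cimage K i) (snd q) * vdens K i (snd q)) * indicator (coord C i ` B) q))
      \<in> borel_measurable (lborel \<Otimes>\<^sub>M lborel)"
    proof -
      have 1: "(\<lambda>q. indicator {0..1} (fst q) * cyl_weight (fst q)) \<in> borel_measurable (borel \<Otimes>\<^sub>M borel)"
        by (rule measurable_compose[OF measurable_fst cyl_weight_measurable])
      have 2: "(\<lambda>q. indicator (cimage K i) (snd q) * vdens K i (snd q)) \<in> borel_measurable (borel \<Otimes>\<^sub>M borel)"
        by (rule measurable_compose[OF measurable_snd v])
      have 3: "(indicator (coord C i ` B) :: real \<times> 'e \<Rightarrow> ennreal) \<in> borel_measurable (borel \<Otimes>\<^sub>M borel)"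
        using cB by (intro borel_measurable_indicator) (subst borel_prod)
      have s: "sets (lborel \<Otimes>\<^sub>M lborel) = sets (borel \<Otimes>\<^sub>M (borel :: 'e measure))"
        by (intro sets_pair_measure_cong) auto
      show ?thesis
        unfolding measurable_cong_sets[OF s refl]
        by (intro borel_measurable_times_ennreal measurable_compose[OF 1 measurable_ennreal]
          measurable_compose[OF 2 measurable_ennreal] 3)
    qed
    from lborel.nn_integral_fst[OF this] show ?thesis by simp
  qed
  also have "\<dots> = (\<integral>\<^sup>+x. ennreal (indicator {0..1} x * cyl_weight x) * emeasure VK (Pair x -` B) \<partial>lborel)"
  proof (intro nn_integral_cong)
    fix x :: real
    have "B \<in> sets (borel \<Otimes>\<^sub>M borel)" using B(1) by (subst borel_prod)
    then have Bx: "Pair x -` B \<in> sets borel" by (rule sets_Pair1)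
    have Bp: "Pair x -` B \<subseteq> patch K i" using B(2) by auto
    have ix: "indicator (coord C i ` B) (x, z) = (indicator (coord K i ` (Pair x -` B)) z :: ennreal)" for z
    proof -
      have "(x, z) \<in> coord C i ` B \<longleftrightarrow> z \<in> coord K i ` (Pair x -` B)"
      proof
        assume "z \<in> coord K i ` (Pair x -` B)"
        then obtain p where "(x, p) \<in> B" "(x, z) = coord C i (x, p)" by (auto simp: cyl_sel)
        then show "(x, z) \<in> coord C i ` B" by (metis image_eqI)
      qed (auto simp: cyl_sel)
      then show ?thesis by (simp only: indicator_def)
    qed
    have "(\<integral>\<^sup>+z. ennreal (indicator {0..1} x * cyl_weight x) *
      (ennreal (indicator (cimage K i) z * vdens K i z) * indicator (coord C i ` B) (x, z)) \<partial>lborel) =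
      (\<integral>\<^sup>+z. ennreal (indicator {0..1} x * cyl_weight x) *
      (ennreal (indicator (cimage K i) z * vdens K i z) * indicator (coord K i ` (Pair x -` B)) z) \<partial>lborel)"
      by (simp only: ix)
    also have "\<dots> = ennreal (indicator {0..1} x * cyl_weight x) * emeasure VK (Pair x -` B)"
      by (rule nn_integral_vdens_cmult[OF i Bx Bp])
    finally show "(\<integral>\<^sup>+z. ennreal (indicator {0..1} x * cyl_weight x) *
      (ennreal (indicator (cimage K i) z * vdens K i z) * indicator (coord C i ` B) (x, z)) \<partial>lborel) =
      ennreal (indicator {0..1} x * cyl_weight x) * emeasure VK (Pair x -` B)" .
  qed
  also have "\<dots> = (\<integral>\<^sup>+x. emeasure VK (Pair x -` B) \<partial>cyl_axis)"
    unfolding cyl_axis_def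
  proof (rule nn_integral_density[symmetric])
    interpret VK: finite_measure VK by (rule finite_measure_VK)
    have "B \<in> sets (borel \<Otimes>\<^sub>M VK)"
      unfolding sets_pair_measure_cong[OF refl sets_VK] using B(1) by (subst borel_prod)
    then show "(\<lambda>x. emeasure VK (Pair x -` B)) \<in> borel_measurable lborel"
      unfolding measurable_lborel2 by (rule VK.measurable_emeasure_Pair)
  qed (use cyl_weight_measurable in simp)
  finally show "emeasure VM B = (\<integral>\<^sup>+x. emeasure VK (Pair x -` B) \<partial>cyl_axis)" .
qed

text \<open>
  The boundary component at \<open>x\<close> carries the metric \<open>f x\<close> times that of \<open>K\<close>, which scales the volume of \<open>K\<close>
  by this factor.
\<close>

definition bdry_weight :: "real \<Rightarrow> real" where "bdry_weight x = sqrt (f x ^ DIM('e))"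
definition bdry_axis :: "real measure" where "bdry_axis = distr (point_measure {0, 1} (\<lambda>x. ennreal (bdry_weight x))) borel (\<lambda>x. x)"

lemma bdry_weight_pos: "x \<in> {0..1} \<Longrightarrow> 0 < bdry_weight x"
  using f_pos by (simp add: bdry_weight_def)

lemma integral_bdry_axis:
  fixes g :: "real \<Rightarrow> real"
  assumes "g \<in> borel_measurable borel"
  shows "(\<integral>x. g x \<partial>bdry_axis) = bdry_weight 0 * g 0 + bdry_weight 1 * g 1"
proof -
  have "(\<integral>x. g x \<partial>bdry_axis) = (\<integral>x. g x \<partial>point_measure {0, 1} (\<lambda>x. ennreal (bdry_weight x)))"
    unfolding bdry_axis_def using assms by (intro integral_distr) (auto simp: point_measure_def)
  also have "\<dots> = bdry_weight 0 * g 0 + bdry_weight 1 * g 1"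
    using bdry_weight_pos by (subst lebesgue_integral_point_measure_finite) (auto simp: less_imp_le)
  finally show ?thesis .
qed

text \<open>
  A set over one patch of \<open>K\<close> meets two patches of the boundary, one in each component, and is split
  accordingly.
\<close>

lemma boundary_volume_product:
  assumes VB: "riemannian_volume (cylinder_boundary f K) VB"
  shows "product_volume K VK {0, 1} bdry_axis VB"
proof (intro product_volume.intro product_volume_axioms.intro closed_manifold_axioms)
  define CB where "CB = cylinder_boundary f K"
  have sel: "idx CB = {0, 1} \<times> idx K" "patch CB (j, i) = {j} \<times> patch K i" "coord CB (j, i) (x, p) = coord K i p"
    "gform CB (j, i) z = (\<lambda>v w. f j * gform K i z v w)" for i j x p z
    by (simp_all add: CB_def cylinder_boundary_def cylinder_def)
  have "points CB = {0, 1} \<times> UNIV" using ex_chart by (fastforce simp: points_def sel)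
  then have sp: "space VB = {0, 1} \<times> UNIV" and st: "sets VB = sets (restrict_space borel ({0, 1} \<times> UNIV))"
    using VB by (auto simp: riemannian_volume_def CB_def)
  show "compact {0, 1::real}" by simp
  show "sets bdry_axis = sets borel" by (simp add: bdry_axis_def)
  have nnB: "(\<integral>\<^sup>+x. g x \<partial>bdry_axis) = ennreal (bdry_weight 0) * g 0 + ennreal (bdry_weight 1) * g 1" if "g \<in> borel_measurable borel" for g
  proof -
    have "(\<integral>\<^sup>+x. g x \<partial>bdry_axis) = (\<integral>\<^sup>+x. g x \<partial>point_measure {0, 1} (\<lambda>x. ennreal (bdry_weight x)))"
      unfolding bdry_axis_def using that by (intro nn_integral_distr) (auto simp: point_measure_def)
    then show ?thesis by (subst (asm) nn_integral_point_measure_finite) auto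
  qed
  have eB: "emeasure bdry_axis A = ennreal (bdry_weight 0) * indicator A 0 + ennreal (bdry_weight 1) * indicator A 1"
    if A: "A \<in> sets borel" for A
  proof -
    have "emeasure bdry_axis A = (\<integral>\<^sup>+x. indicator A x \<partial>bdry_axis)"
      by (rule nn_integral_indicator[symmetric]) (simp add: bdry_axis_def A)
    also have "\<dots> = ennreal (bdry_weight 0) * indicator A 0 + ennreal (bdry_weight 1) * indicator A 1"
      by (rule nnB) (use A in simp)
    finally show ?thesis .
  qed
  show "finite_measure bdry_axis"
  proof
    have "space bdry_axis = UNIV" by (simp add: bdry_axis_def)
    then show "emeasure bdry_axis (space bdry_axis) \<noteq> \<infinity>" using eB[of UNIV] by simp
  qed
  show "AE x in bdry_axis. x \<in> {0, 1}"
  proof (rule AE_I[of _ _ "- {0, 1}"])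
    show "emeasure bdry_axis (- {0, 1}) = 0"
      using eB[of "- {0, 1}"] by simp
    show "- {0, 1} \<in> sets bdry_axis" by (simp add: bdry_axis_def)
  qed auto
  show "space VB = {0, 1} \<times> UNIV" by (rule sp)
  show "sets VB = sets (restrict_space borel ({0, 1} \<times> UNIV))" by (rule st)
  fix i and B :: "(real \<times> 'k) set" assume i: "i \<in> idx K" and B: "B \<in> sets borel" "B \<subseteq> {0, 1} \<times> patch K i"
  have cl: "{0, 1::real} \<times> (UNIV :: 'k set) \<in> sets borel" "{j} \<times> (UNIV :: 'k set) \<in> sets borel" for j :: real
    by (intro borel_closed closed_Times; simp)+
  have "B \<in> sets (borel \<Otimes>\<^sub>M borel)" using B(1) by (subst borel_prod)
  then have Bx: "Pair x -` B \<in> sets borel" for x by (rule sets_Pair1)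
  define Bj where "Bj j = B \<inter> ({j} \<times> UNIV)" for j
  have Bj: "Bj j \<in> sets VB" if "j \<in> {0, 1}" for j
    using B cl that by (auto simp: st sets_restrict_space_iff Bj_def)
  have part: "emeasure VB (Bj j) = ennreal (bdry_weight j) * emeasure VK (Pair j -` B)" if j: "j \<in> {0, 1}" for j
  proof -
    have Bp: "Pair j -` B \<subseteq> patch K i" using B(2) by auto
    have "(j, i) \<in> idx CB" "Bj j \<subseteq> patch CB (j, i)" using i j B(2) by (auto simp: sel Bj_def)
    then have "emeasure VB (Bj j) = (\<integral>\<^sup>+z. ennreal (vdens CB (j, i) z) * indicator (coord CB (j, i) ` Bj j) z \<partial>lborel)"
      using VB Bj[OF j] unfolding riemannian_volume_def CB_def by blast
    also have "coord CB (j, i) ` Bj j = coord K i ` (Pair j -` B)"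
      by (auto simp: Bj_def sel image_iff) (force simp: sel)+
    also have "(\<integral>\<^sup>+z. ennreal (vdens CB (j, i) z) * indicator (coord K i ` (Pair j -` B)) z \<partial>lborel) =
        (\<integral>\<^sup>+z. ennreal (bdry_weight j) * (ennreal (indicator (cimage K i) z * vdens K i z) * indicator (coord K i ` (Pair j -` B)) z) \<partial>lborel)"
    proof (intro nn_integral_cong)
      fix z :: 'e
      have "gram_det (gform CB (j, i) z) = f j ^ DIM('e) * gram_det (gform K i z)"
        unfolding sel by (rule gram_det_scale)
      then have "vdens CB (j, i) z = bdry_weight j * vdens K i z" by (simp only: vdens_def bdry_weight_def real_sqrt_mult)
      moreover have "0 \<le> bdry_weight j" using bdry_weight_pos[of j] j by auto
      moreover have "z \<in> cimage K i" if "z \<in> coord K i ` (Pair j -` B)" using that Bp coord_in by blast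
      ultimately show "ennreal (vdens CB (j, i) z) * indicator (coord K i ` (Pair j -` B)) z =
          ennreal (bdry_weight j) * (ennreal (indicator (cimage K i) z * vdens K i z) * indicator (coord K i ` (Pair j -` B)) z)"
        by (cases "z \<in> coord K i ` (Pair j -` B)") (simp_all add: ennreal_mult')
    qed
    also have "\<dots> = ennreal (bdry_weight j) * emeasure VK (Pair j -` B)"
      by (rule nn_integral_vdens_cmult[OF i Bx Bp])
    finally show ?thesis .
  qed
  have "B = Bj 0 \<union> Bj 1" using B(2) by (auto simp: Bj_def)
  moreover have "emeasure VB (Bj 0) + emeasure VB (Bj 1) = emeasure VB (Bj 0 \<union> Bj 1)"
    by (rule plus_emeasure) (use Bj in \<open>auto simp: Bj_def\<close>)
  moreover have "(\<lambda>x. emeasure VK (Pair x -` B)) \<in> borel_measurable borel"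
  proof -
    interpret VK: finite_measure VK by (rule finite_measure_VK)
    have "B \<in> sets (borel \<Otimes>\<^sub>M VK)"
      unfolding sets_pair_measure_cong[OF refl sets_VK] using B(1) by (subst borel_prod)
    then show ?thesis by (rule VK.measurable_emeasure_Pair)
  qed
  ultimately show "emeasure VB B = (\<integral>\<^sup>+x. emeasure VK (Pair x -` B) \<partial>bdry_axis)"
    using part[of 0] part[of 1] nnB by simp
qed

end

section \<open>The ordinary differential equation in the axial variable\<close>

text \<open>
  The successive Picard corrections for \<open>y' = R z\<close>, \<open>z' = Q y\<close>, \<open>y(0) = 0\<close>, \<open>z(0) = 1\<close>; the solution is their
  sum.
\<close>

primrec picard :: "(real \<Rightarrow> real) \<Rightarrow> (real \<Rightarrow> real) \<Rightarrow> nat \<Rightarrow> (real \<Rightarrow> real) \<times> (real \<Rightarrow> real)" where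
  "picard R Q 0 = (\<lambda>x. 0, \<lambda>x. 1)"
| "picard R Q (Suc k) =
     (\<lambda>x. integral {0..x} (\<lambda>t. R t * snd (picard R Q k) t),
      \<lambda>x. integral {0..x} (\<lambda>t. Q t * fst (picard R Q k) t))"

lemma picard_bound_step:
  fixes g h :: "real \<Rightarrow> real"
  assumes x: "x \<in> {0..1}" and cont: "continuous_on {0..1} g" "continuous_on {0..1} h"
    and g: "\<And>t. t \<in> {0..1} \<Longrightarrow> 0 \<le> g t \<and> g t \<le> C"
    and h: "\<And>t. t \<in> {0..1} \<Longrightarrow> 0 \<le> h t \<and> h t \<le> C ^ k * t ^ k / fact k"
  shows "0 \<le> integral {0..x} (\<lambda>t. g t * h t)"
    and "integral {0..x} (\<lambda>t. g t * h t) \<le> C ^ Suc k * x ^ Suc k / fact (Suc k)"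
proof -
  have int: "(\<lambda>t. g t * h t) integrable_on {0..x}"
    using x by (intro integrable_continuous_interval continuous_intros continuous_on_subset[OF cont(1)]
        continuous_on_subset[OF cont(2)]) auto
  show "0 \<le> integral {0..x} (\<lambda>t. g t * h t)"
    using x g h by (intro integral_nonneg[OF int]) auto
  have "((\<lambda>t. C ^ Suc k * t ^ k / fact k) has_integral
      C ^ Suc k * x ^ Suc k / fact (Suc k) - C ^ Suc k * 0 ^ Suc k / fact (Suc k)) {0..x}"
  proof (rule fundamental_theorem_of_calculus)
    show "0 \<le> x" using x by simp
    fix t :: real
    have cancel: "a * (n * b) / (n * d) = a * b / d" if "n \<noteq> 0" for a b d n :: real
      using that by simp
    have "((\<lambda>t. C ^ Suc k * t ^ Suc k / fact (Suc k)) has_real_derivative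
        C ^ Suc k * (real (Suc k) * t ^ k) / (real (Suc k) * fact k)) (at t within {0..x})"
      by (rule DERIV_cong[OF DERIV_cdivide[OF DERIV_cmult[OF DERIV_pow]]]) (simp del: of_nat_Suc power_Suc)
    then show "((\<lambda>t. C ^ Suc k * t ^ Suc k / fact (Suc k)) has_vector_derivative C ^ Suc k * t ^ k / fact k)
        (at t within {0..x})"
      unfolding has_real_derivative_iff_has_vector_derivative[symmetric]
      by (rule DERIV_cong) (rule cancel, simp)
  qed
  then have "((\<lambda>t. C ^ Suc k * t ^ k / fact k) has_integral C ^ Suc k * x ^ Suc k / fact (Suc k)) {0..x}"
    by simp
  moreover have "g t * h t \<le> C ^ Suc k * t ^ k / fact k" if "t \<in> {0..x}" for t
  proof -
    have "g t * h t \<le> C * (C ^ k * t ^ k / fact k)"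
      using x that g[of t] h[of t] by (intro mult_mono) auto
    then show ?thesis by simp
  qed
  ultimately show "integral {0..x} (\<lambda>t. g t * h t) \<le> C ^ Suc k * x ^ Suc k / fact (Suc k)"
    using has_integral_le[OF integrable_integral[OF int]] by blast
qed

text \<open>
  The corrections are bounded by \<open>C\<^sup>k x\<^sup>k / k!\<close>, so the series and its derivative converge uniformly. For
  nonnegative coefficients all corrections are nonnegative, which gives the sign of the solution at once.
\<close>

lemma linear_system_solution:
  fixes R Q :: "real \<Rightarrow> real"
  assumes cont: "continuous_on {0..1} R" "continuous_on {0..1} Q"
    and nn: "\<And>x. x \<in> {0..1} \<Longrightarrow> 0 \<le> R x" "\<And>x. x \<in> {0..1} \<Longrightarrow> 0 \<le> Q x"
  obtains y z where "y 0 = 0" "z 0 = (1::real)"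
    "\<And>x. x \<in> {0..1} \<Longrightarrow> (y has_real_derivative R x * z x) (at x within {0..1})"
    "\<And>x. x \<in> {0..1} \<Longrightarrow> (z has_real_derivative Q x * y x) (at x within {0..1})"
    "\<And>x. x \<in> {0..1} \<Longrightarrow> 0 \<le> y x" "\<And>x. x \<in> {0..1} \<Longrightarrow> 1 \<le> z x"
proof -
  define u where "u k = fst (picard R Q k)" for k
  define v where "v k = snd (picard R Q k)" for k
  have u0: "u 0 = (\<lambda>x. 0)" and v0: "v 0 = (\<lambda>x. 1)" by (auto simp: u_def v_def)
  have uS: "u (Suc k) = (\<lambda>x. integral {0..x} (\<lambda>t. R t * v k t))"
    and vS: "v (Suc k) = (\<lambda>x. integral {0..x} (\<lambda>t. Q t * u k t))" for k
    by (auto simp: u_def v_def)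
  have "bounded (R ` {0..1})" "bounded (Q ` {0..1})"
    by (auto intro!: compact_imp_bounded compact_continuous_image cont)
  then obtain C1 C2 where "\<And>x. x \<in> {0..1} \<Longrightarrow> norm (R x) \<le> C1" "\<And>x. x \<in> {0..1} \<Longrightarrow> norm (Q x) \<le> C2"
    unfolding bounded_iff by (meson imageI)
  then obtain C where CR: "\<And>x. x \<in> {0..1} \<Longrightarrow> 0 \<le> R x \<and> R x \<le> C"
    and CQ: "\<And>x. x \<in> {0..1} \<Longrightarrow> 0 \<le> Q x \<and> Q x \<le> C"
    using nn by (metis le_max_iff_disj real_norm_def abs_of_nonneg)
  have C0: "C \<ge> 0" using CR[of 0] by simp
  have deriv: "continuous_on {0..1} (u k) \<and> continuous_on {0..1} (v k)" for k
  proof (induction k)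
    case 0 then show ?case by (simp add: u0 v0)
  next
    case (Suc k)
    then have "continuous_on {0..1} (\<lambda>t. R t * v k t)" "continuous_on {0..1} (\<lambda>t. Q t * u k t)"
      by (auto intro: continuous_intros cont)
    then show ?case unfolding uS vS
      by (auto intro!: indefinite_integral_continuous_1 integrable_continuous_interval)
  qed
  have bounds: "0 \<le> u k x \<and> u k x \<le> C ^ k * x ^ k / fact k \<and> 0 \<le> v k x \<and> v k x \<le> C ^ k * x ^ k / fact k"
    if "x \<in> {0..1}" for x k
    using that
  proof (induction k arbitrary: x)
    case 0 then show ?case by (simp add: u0 v0)
  next
    case (Suc k)
    show ?case
      unfolding uS vS using Suc deriv CR CQ cont
      by (intro conjI picard_bound_step) auto
  qed
  \<comment> \<open>Shifted by one: the derivative of a correction involves the preceding one.\<close>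
  define u' where "u' k = (case k of 0 \<Rightarrow> (\<lambda>x. 0) | Suc k \<Rightarrow> (\<lambda>x. R x * v k x))" for k
  define v' where "v' k = (case k of 0 \<Rightarrow> (\<lambda>x. 0) | Suc k \<Rightarrow> (\<lambda>x. Q x * u k x))" for k
  have du: "(u k has_real_derivative u' k x) (at x within {0..1})"
    and dv: "(v k has_real_derivative v' k x) (at x within {0..1})" if "x \<in> {0..1}" for k x
  proof -
    have "continuous_on {0..1} (\<lambda>t. R t * v k t)" "continuous_on {0..1} (\<lambda>t. Q t * u k t)" for k
      using deriv by (auto intro: continuous_intros cont)
    then show "(u k has_real_derivative u' k x) (at x within {0..1})"
      "(v k has_real_derivative v' k x) (at x within {0..1})"
      using that by (cases k; auto simp: u0 v0 uS vS u'_def v'_def intro!: integral_has_real_derivative)+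
  qed
  define M where "M k = (case k of 0 \<Rightarrow> 0 | Suc k \<Rightarrow> C * (C ^ k / fact k))" for k
  have sumC: "summable (\<lambda>k. C ^ k / fact k)"
    using summable_exp_generic[of C] by (simp add: field_simps)
  have "summable (\<lambda>k. M (Suc k))" using summable_mult[OF sumC, of C] by (simp add: M_def)
  then have sumM: "summable M" by (rule summable_Suc_iff[THEN iffD1])
  have le: "C ^ k * x ^ k / fact k \<le> C ^ k / fact k" if "x \<in> {0..1}" for x :: real and k
    using that C0 by (auto simp: divide_simps intro!: mult_left_le power_le_one)
  have uv_le: "u k x \<le> C ^ k / fact k" "v k x \<le> C ^ k / fact k" if "x \<in> {0..1}" for k x
    using bounds[OF that, of k] le[OF that, of k] by linarith+
  have Mb: "norm (u' k x) \<le> M k \<and> norm (v' k x) \<le> M k" if x: "x \<in> {0..1}" for k x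
  proof (cases k)
    case (Suc j)
    have "R x * v j x \<le> C * (C ^ j / fact j)" "Q x * u j x \<le> C * (C ^ j / fact j)"
      using bounds[OF x, of j] uv_le[OF x, of j] CR[OF x] CQ[OF x] by (intro mult_mono; simp)+
    moreover have "0 \<le> R x * v j x" "0 \<le> Q x * u j x"
      using bounds[OF x, of j] CR[OF x] CQ[OF x] by auto
    ultimately show ?thesis by (simp add: Suc u'_def v'_def M_def)
  qed (simp add: u'_def v'_def M_def)
  have uc: "uniform_limit {0..1} (\<lambda>n x. \<Sum>i<n. u' i x) (\<lambda>x. suminf (\<lambda>i. u' i x)) sequentially"
    and vc: "uniform_limit {0..1} (\<lambda>n x. \<Sum>i<n. v' i x) (\<lambda>x. suminf (\<lambda>i. v' i x)) sequentially"
    by (rule Weierstrass_m_test[OF _ sumM], use Mb in auto)+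
  have u00: "u k 0 = 0" and v00: "v k 0 = (if k = 0 then 1 else 0)" for k
    by (cases k; simp add: u0 v0 uS vS)+
  have zero: "0 \<in> {0..1::real}" by simp
  obtain y where y: "\<And>x. x \<in> {0..1} \<Longrightarrow> (\<lambda>n. u n x) sums y x"
      "\<And>x. x \<in> {0..1} \<Longrightarrow> (y has_real_derivative suminf (\<lambda>i. u' i x)) (at x within {0..1})"
    using has_field_derivative_series[of "{0..1}" u u' _ 0, OF _ du uc zero] by (auto simp del: atLeastAtMost_iff simp: u00)
  have "summable (\<lambda>n. v n 0)" by (simp add: v00)
  then obtain z where z: "\<And>x. x \<in> {0..1} \<Longrightarrow> (\<lambda>n. v n x) sums z x"
      "\<And>x. x \<in> {0..1} \<Longrightarrow> (z has_real_derivative suminf (\<lambda>i. v' i x)) (at x within {0..1})"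
    using has_field_derivative_series[of "{0..1}" v v' _ 0, OF _ dv vc zero] by (auto simp del: atLeastAtMost_iff)
  have su: "suminf (\<lambda>i. u' i x) = R x * z x" if "x \<in> {0..1}" for x
  proof -
    have "(\<lambda>i. u' (Suc i) x) sums (R x * z x)" using z(1)[OF that] by (simp add: u'_def sums_mult)
    then have "(\<lambda>i. u' i x) sums (R x * z x + u' 0 x)" by (rule sums_Suc)
    then show ?thesis by (simp add: sums_iff u'_def)
  qed
  have sv: "suminf (\<lambda>i. v' i x) = Q x * y x" if "x \<in> {0..1}" for x
  proof -
    have "(\<lambda>i. v' (Suc i) x) sums (Q x * y x)" using y(1)[OF that] by (simp add: v'_def sums_mult)
    then have "(\<lambda>i. v' i x) sums (Q x * y x + v' 0 x)" by (rule sums_Suc)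
    then show ?thesis by (simp add: sums_iff v'_def)
  qed
  show ?thesis
  proof (rule that[of y z])
    show "y 0 = 0" using y(1)[of 0] by (simp add: u00 sums_iff)
    have "(\<lambda>n. v n 0) sums 1" unfolding v00 using sums_If_finite[of "\<lambda>k. k = 0" "\<lambda>k. 1::real"] by simp
    then show "z 0 = 1" using z(1)[of 0] sums_unique2 by auto
    fix x :: real assume x: "x \<in> {0..1}"
    show "(y has_real_derivative R x * z x) (at x within {0..1})" using y(2)[OF x] su[OF x] by simp
    show "(z has_real_derivative Q x * y x) (at x within {0..1})" using z(2)[OF x] sv[OF x] by simp
    show "0 \<le> y x" using sums_le[OF _ sums_zero y(1)[OF x]] bounds[OF x] by auto
    have "sum (\<lambda>n. v n x) {0} \<le> suminf (\<lambda>n. v n x)"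
      using z(1)[OF x] bounds[OF x] by (intro sum_le_suminf) (auto simp: sums_iff)
    then show "1 \<le> z x" using z(1)[OF x] by (simp add: v0 sums_iff)
  qed
qed

lemma deriv_nonneg_mono_unit:
  fixes F :: "real \<Rightarrow> real"
  assumes "\<And>x. x \<in> {0..1} \<Longrightarrow> (F has_real_derivative F' x) (at x within {0..1})"
    and "\<And>x. x \<in> {0..1} \<Longrightarrow> 0 \<le> F' x" and "0 \<le> s" "s \<le> t" "t \<le> 1"
  shows "F s \<le> F t"
proof -
  have "(F' has_integral F t - F s) {s..t}"
    using assms
    by (intro fundamental_theorem_of_calculus)
      (auto simp: has_real_derivative_iff_has_vector_derivative[symmetric] intro: has_field_derivative_subset[where s="{0..1}"])
  then show ?thesis using has_integral_nonneg[of F' "F t - F s" "{s..t}"] assms by auto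
qed

text \<open>
  Here \<open>z = y' / R\<close>, and \<open>Q\<close> is comparable with \<open>k\<^sup>2 R\<close>. The derivative of \<open>z\<^sup>2 - a k\<^sup>2 y\<^sup>2\<close> is
  \<open>2 z y (Q - a k\<^sup>2 R) \<ge> 0\<close>, and with \<open>b\<close> in place of \<open>a\<close> it is nonpositive. The lower bound for \<open>z\<close> means
  \<open>y' \<ge> r0 \<surd>a k y\<close>; integrating \<open>2 y y'\<close> bounds \<open>\<integral> y\<^sup>2\<close>, and integrating \<open>y'\<close> over \<open>[x, 1]\<close> shows that \<open>y\<close> is
  small away from \<open>1\<close>. The upper bound for \<open>z\<close> limits the slope to a multiple of \<open>k\<close>, so that \<open>y\<close> cannot
  drop from \<open>1\<close> too quickly.
\<close>

lemma growing_solution: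
  fixes R Q :: "real \<Rightarrow> real"
  assumes pos: "0 < r0" "0 < a" "0 < b" "1 \<le> k"
    and cont: "continuous_on {0..1} R" "continuous_on {0..1} Q"
    and R: "\<And>x. x \<in> {0..1} \<Longrightarrow> r0 \<le> R x \<and> R x \<le> r1"
    and Q: "\<And>x. x \<in> {0..1} \<Longrightarrow> a * k\<^sup>2 * R x \<le> Q x \<and> Q x \<le> b * k\<^sup>2 * R x"
  obtains y z where "y 0 = 0" "y 1 = (1::real)"
    "\<And>x. x \<in> {0..1} \<Longrightarrow> (y has_real_derivative R x * z x) (at x within {0..1})"
    "\<And>x. x \<in> {0..1} \<Longrightarrow> (z has_real_derivative Q x * y x) (at x within {0..1})"
    "\<And>x. x \<in> {0..1} \<Longrightarrow> 0 \<le> y x"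
    "integral {0..1} (\<lambda>x. (y x)\<^sup>2) \<le> 1 / (2 * (r0 * sqrt a) * k)"
    "\<And>x. x \<in> {0..1} \<Longrightarrow> 1 - r1 * sqrt (1 / r0\<^sup>2 + b) * k * (1 - x) \<le> y x"
    "\<And>x. x \<in> {0..1/2} \<Longrightarrow> y x \<le> 1 / (1 + r0 * sqrt a * k / 2)"
proof -
  have R0: "0 < R x" if "x \<in> {0..1}" for x using R[OF that] pos by linarith
  have Q0: "0 \<le> Q x" if "x \<in> {0..1}" for x
  proof -
    have "0 \<le> a * k\<^sup>2 * R x" using R0[OF that] pos by simp
    then show ?thesis using Q[OF that] by linarith
  qed
  obtain Y Z where Y0: "Y 0 = 0" and Z0: "Z 0 = (1::real)"
    and dY: "\<And>x. x \<in> {0..1} \<Longrightarrow> (Y has_real_derivative R x * Z x) (at x within {0..1})"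
    and dZ: "\<And>x. x \<in> {0..1} \<Longrightarrow> (Z has_real_derivative Q x * Y x) (at x within {0..1})"
    and Ynn: "\<And>x. x \<in> {0..1} \<Longrightarrow> 0 \<le> Y x" and Z1: "\<And>x. x \<in> {0..1} \<Longrightarrow> 1 \<le> Z x"
    using linear_system_solution[OF cont] R0 Q0 less_imp_le by metis
  have RZ: "r0 \<le> R x * Z x" if "x \<in> {0..1}" for x
    using mult_mono[of r0 "R x" 1 "Z x"] R[OF that] Z1[OF that] pos by auto
  have "Y 0 - r0 * 0 \<le> Y 1 - r0 * 1"
    using RZ by (intro deriv_nonneg_mono_unit[of "\<lambda>x. Y x - r0 * x" "\<lambda>x. R x * Z x - r0"])
      (auto intro!: derivative_eq_intros dY)
  then have Y1: "r0 \<le> Y 1" using Y0 by simp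
  define D where "D = Y 1"
  have D: "0 < D" "r0 \<le> D" using Y1 pos by (auto simp: D_def)
  define y where "y x = Y x / D" for x
  define z where "z x = Z x / D" for x
  have dy: "(y has_real_derivative R x * z x) (at x within {0..1})" if "x \<in> {0..1}" for x
    unfolding y_def z_def using DERIV_cdivide[OF dY[OF that], of D] by simp
  have dz: "(z has_real_derivative Q x * y x) (at x within {0..1})" if "x \<in> {0..1}" for x
    unfolding y_def z_def using DERIV_cdivide[OF dZ[OF that], of D] by simp
  have ynn: "0 \<le> y x" if "x \<in> {0..1}" for x using Ynn[OF that] D by (simp add: y_def)
  have znn: "0 \<le> z x" if "x \<in> {0..1}" for x using Z1[OF that] D by (simp add: z_def)
  have y0: "y 0 = 0" and y1: "y 1 = 1" using Y0 D by (auto simp: y_def D_def)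
  have z0: "z 0 = 1 / D" by (simp add: z_def Z0)
  have mono: "y s \<le> y t" if "0 \<le> s" "s \<le> t" "t \<le> 1" for s t
  proof (rule deriv_nonneg_mono_unit[where F=y and F'="\<lambda>x. R x * z x"])
    fix x :: real assume x: "x \<in> {0..1}"
    show "(y has_real_derivative R x * z x) (at x within {0..1})" by (rule dy[OF x])
    show "0 \<le> R x * z x" using R0[OF x] znn[OF x] by simp
  qed (use that in auto)
  have yle: "y x \<le> 1" if "x \<in> {0..1}" for x using mono[of x 1] that y1 by simp
  have cy: "continuous_on {0..1} y"
    using dy by (intro DERIV_continuous_on) auto
  have lower: "a * k\<^sup>2 * (y x)\<^sup>2 \<le> (z x)\<^sup>2" if x: "x \<in> {0..1}" for x
  proof -
    have "(z 0)\<^sup>2 - a * k\<^sup>2 * (y 0)\<^sup>2 \<le> (z x)\<^sup>2 - a * k\<^sup>2 * (y x)\<^sup>2"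
    proof (rule deriv_nonneg_mono_unit[where F="\<lambda>x. (z x)\<^sup>2 - a * k\<^sup>2 * (y x)\<^sup>2" and F'="\<lambda>t. 2 * z t * y t * (Q t - a * k\<^sup>2 * R t)"])
      fix t :: real assume t: "t \<in> {0..1}"
      show "((\<lambda>x. (z x)\<^sup>2 - a * k\<^sup>2 * (y x)\<^sup>2) has_real_derivative
          2 * z t * y t * (Q t - a * k\<^sup>2 * R t)) (at t within {0..1})"
        by (rule DERIV_cong[OF DERIV_diff[OF DERIV_power[OF dz[OF t], of 2] DERIV_cmult[OF DERIV_power[OF dy[OF t], of 2]]]]) (simp add: algebra_simps)
      show "0 \<le> 2 * z t * y t * (Q t - a * k\<^sup>2 * R t)"
        using znn[OF t] ynn[OF t] Q[OF t] by simp
    qed (use x in auto)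
    then have "(z 0)\<^sup>2 \<le> (z x)\<^sup>2 - a * k\<^sup>2 * (y x)\<^sup>2" using y0 by simp
    then show ?thesis using zero_le_power2[of "z 0"] by linarith
  qed
  have upper: "(z x)\<^sup>2 \<le> 1 / D\<^sup>2 + b * k\<^sup>2 * (y x)\<^sup>2" if x: "x \<in> {0..1}" for x
  proof -
    have "b * k\<^sup>2 * (y 0)\<^sup>2 - (z 0)\<^sup>2 \<le> b * k\<^sup>2 * (y x)\<^sup>2 - (z x)\<^sup>2"
    proof (rule deriv_nonneg_mono_unit[where F="\<lambda>x. b * k\<^sup>2 * (y x)\<^sup>2 - (z x)\<^sup>2" and F'="\<lambda>t. 2 * z t * y t * (b * k\<^sup>2 * R t - Q t)"])
      fix t :: real assume t: "t \<in> {0..1}"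
      show "((\<lambda>x. b * k\<^sup>2 * (y x)\<^sup>2 - (z x)\<^sup>2) has_real_derivative
          2 * z t * y t * (b * k\<^sup>2 * R t - Q t)) (at t within {0..1})"
        by (rule DERIV_cong[OF DERIV_diff[OF DERIV_cmult[OF DERIV_power[OF dy[OF t], of 2]] DERIV_power[OF dz[OF t], of 2]]]) (simp add: algebra_simps)
      show "0 \<le> 2 * z t * y t * (b * k\<^sup>2 * R t - Q t)"
        using znn[OF t] ynn[OF t] Q[OF t] by simp
    qed (use x in auto)
    then show ?thesis using y0 z0 by (simp add: power_divide)
  qed
  define c where "c = r0 * sqrt a"
  have c0: "0 < c" using pos by (simp add: c_def)
  have grow: "c * k * y x \<le> R x * z x" if x: "x \<in> {0..1}" for x
  proof -
    have "(sqrt a * k * y x)\<^sup>2 \<le> (z x)\<^sup>2" using lower[OF x] pos by (simp add: power_mult_distrib)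
    then have "sqrt a * k * y x \<le> z x" using znn[OF x] by (rule power2_le_imp_le)
    then have "r0 * (sqrt a * k * y x) \<le> R x * z x"
      using R[OF x] pos ynn[OF x] by (intro mult_mono) auto
    then show ?thesis by (simp add: c_def mult_ac)
  qed
  show ?thesis
  proof (rule that[OF y0 y1 dy dz ynn])
    have "((\<lambda>x. 2 * y x * (R x * z x)) has_integral (y 1)\<^sup>2 - (y 0)\<^sup>2) {0..1}"
      by (rule fundamental_theorem_of_calculus)
        (auto simp: has_real_derivative_iff_has_vector_derivative[symmetric] intro!: derivative_eq_intros dy)
    then have I: "((\<lambda>x. 2 * y x * (R x * z x)) has_integral 1) {0..1}" by (simp add: y0 y1)
    have J: "((\<lambda>x. 2 * c * k * (y x)\<^sup>2) has_integral 2 * c * k * integral {0..1} (\<lambda>x. (y x)\<^sup>2)) {0..1}"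
      by (intro has_integral_mult_right integrable_integral integrable_continuous_interval continuous_intros cy)
    have "2 * c * k * integral {0..1} (\<lambda>x. (y x)\<^sup>2) \<le> 1"
    proof (rule has_integral_le[OF J I])
      fix x :: real assume x: "x \<in> {0..1}"
      have "2 * y x * (c * k * y x) \<le> 2 * y x * (R x * z x)"
        using grow[OF x] ynn[OF x] by (intro mult_left_mono) auto
      then show "2 * c * k * (y x)\<^sup>2 \<le> 2 * y x * (R x * z x)" by (simp add: power2_eq_square mult_ac)
    qed
    then show "integral {0..1} (\<lambda>x. (y x)\<^sup>2) \<le> 1 / (2 * (r0 * sqrt a) * k)"
      using c0 pos by (simp add: c_def[symmetric] field_simps)
  next
    fix x :: real assume x: "x \<in> {0..1}"
    define E where "E = sqrt (1 / r0\<^sup>2 + b)"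
    have zb: "R t * z t \<le> r1 * E * k" if t: "t \<in> {0..1}" for t
    proof -
      have "(z t)\<^sup>2 \<le> 1 / D\<^sup>2 + b * k\<^sup>2 * (y t)\<^sup>2" by (rule upper[OF t])
      also have "\<dots> \<le> 1 / r0\<^sup>2 * k\<^sup>2 + b * k\<^sup>2 * 1"
      proof (rule add_mono)
        have "1 / D\<^sup>2 \<le> 1 / r0\<^sup>2" using D pos by (intro divide_left_mono power_mono) auto
        also have "\<dots> \<le> 1 / r0\<^sup>2 * k\<^sup>2" using pos by (simp add: divide_right_mono)
        finally show "1 / D\<^sup>2 \<le> 1 / r0\<^sup>2 * k\<^sup>2" .
        show "b * k\<^sup>2 * (y t)\<^sup>2 \<le> b * k\<^sup>2 * 1"
          using yle[OF t] ynn[OF t] pos by (intro mult_left_mono power_le_one) auto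
      qed
      also have "\<dots> = (E * k)\<^sup>2"
        using pos by (simp add: E_def power_mult_distrib add_nonneg_nonneg algebra_simps)
      finally have "z t \<le> E * k" by (rule power2_le_imp_le) (use pos in \<open>auto simp: E_def\<close>)
      then have "R t * z t \<le> r1 * (E * k)"
        using R[OF t] znn[OF t] R0[OF t] by (intro mult_mono) auto
      then show ?thesis by simp
    qed
    have "r1 * E * k * x - y x \<le> r1 * E * k * 1 - y 1"
      using x zb by (intro deriv_nonneg_mono_unit[of "\<lambda>x. r1 * E * k * x - y x" "\<lambda>x. r1 * E * k - R x * z x"])
        (auto intro!: derivative_eq_intros dy)
    then show "1 - r1 * sqrt (1 / r0\<^sup>2 + b) * k * (1 - x) \<le> y x"
      by (simp add: E_def y1 algebra_simps)
  next
    fix x :: real assume x: "x \<in> {0..1/2}"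
    define s where "s = y x"
    have s0: "0 \<le> s" using ynn[of x] x by (simp add: s_def)
    have xx: "x \<in> {0..1}" using x by auto
    have int: "((\<lambda>t. R t * z t) has_integral y 1 - y x) {x..1}"
      using x dy by (intro fundamental_theorem_of_calculus)
        (auto simp: has_real_derivative_iff_has_vector_derivative[symmetric]
          intro: has_field_derivative_subset[where s="{0..1}"])
    have "((\<lambda>t. c * k * s) has_integral (1 - x) *\<^sub>R (c * k * s)) {x..1}"
      using has_integral_const_real[of "c * k * s" x 1] x by simp
    from has_integral_le[OF this int]
    have "(1 - x) *\<^sub>R (c * k * s) \<le> y 1 - y x"
    proof -
      have "c * k * s \<le> R t * z t" if "t \<in> {x..1}" for t
      proof -
        have t: "t \<in> {0..1}" using that x by auto
        have "c * k * s \<le> c * k * y t"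
          using mono[of x t] that x c0 pos by (intro mult_left_mono) (auto simp: s_def)
        then show ?thesis using grow[OF t] by linarith
      qed
      then show ?thesis using has_integral_le[OF \<open>((\<lambda>t. c * k * s) has_integral (1 - x) *\<^sub>R (c * k * s)) {x..1}\<close> int] by blast
    qed
    moreover have "1/2 * (c * k * s) \<le> (1 - x) * (c * k * s)"
      using x s0 c0 pos by (intro mult_right_mono) auto
    ultimately have "s * (1 + c * k / 2) \<le> 1" by (simp add: y1 s_def algebra_simps)
    moreover have "0 < 1 + c * k / 2" using c0 pos by (simp add: add_pos_nonneg)
    ultimately show "y x \<le> 1 / (1 + r0 * sqrt a * k / 2)"
      unfolding c_def[symmetric] s_def[symmetric] by (simp add: pos_le_divide_eq)
  qed
qed

text \<open>
  The solution is \<open>A y0 + B y\<close>, where \<open>y\<close> grows towards \<open>1\<close> and \<open>y0\<close> is the reflection of the growing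
  solution for the reflected coefficients. For the lower bound take the end with the larger of \<open>|A|\<close> and
  \<open>|B|\<close>: on an interval of length \<open>1 / (4 C k)\<close> there, the large profile is at least \<open>3/4\<close> and the other one
  at most \<open>1/4\<close>, so that \<open>|w|\<close> is at least half of the larger modulus.
\<close>

lemma two_point_solution:
  fixes R Q :: "real \<Rightarrow> real" and A B :: complex
  assumes pos: "0 < r0" "0 < a" "0 < b" "1 \<le> k"
    and cont: "continuous_on {0..1} R" "continuous_on {0..1} Q"
    and R: "\<And>x. x \<in> {0..1} \<Longrightarrow> r0 \<le> R x \<and> R x \<le> r1"
    and Q: "\<And>x. x \<in> {0..1} \<Longrightarrow> a * k\<^sup>2 * R x \<le> Q x \<and> Q x \<le> b * k\<^sup>2 * R x"
    and c: "c = r0 * sqrt a" and C: "C = r1 * sqrt (1 / r0\<^sup>2 + b)"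
    and k: "6 \<le> c * k" "1 \<le> 2 * C * k"
  obtains w z :: "real \<Rightarrow> complex" where "w 0 = A" "w 1 = B"
    "\<And>x. x \<in> {0..1} \<Longrightarrow> (w has_vector_derivative R x *\<^sub>R z x) (at x within {0..1})"
    "\<And>x. x \<in> {0..1} \<Longrightarrow> (z has_vector_derivative Q x *\<^sub>R w x) (at x within {0..1})"
    "((cmod A)\<^sup>2 + (cmod B)\<^sup>2) / (32 * C) / k \<le> integral {0..1} (\<lambda>x. (cmod (w x))\<^sup>2)"
    "integral {0..1} (\<lambda>x. (cmod (w x))\<^sup>2) \<le> ((cmod A)\<^sup>2 + (cmod B)\<^sup>2) / c / k"
proof -
  obtain y z where y: "y 0 = 0" "y 1 = (1::real)"
    and dy: "\<And>x. x \<in> {0..1} \<Longrightarrow> (y has_real_derivative R x * z x) (at x within {0..1})"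
    and dz: "\<And>x. x \<in> {0..1} \<Longrightarrow> (z has_real_derivative Q x * y x) (at x within {0..1})"
    and ynn: "\<And>x. x \<in> {0..1} \<Longrightarrow> 0 \<le> y x"
    and yint: "integral {0..1} (\<lambda>x. (y x)\<^sup>2) \<le> 1 / (2 * c * k)"
    and ylow: "\<And>x. x \<in> {0..1} \<Longrightarrow> 1 - C * k * (1 - x) \<le> y x"
    and yup: "\<And>x. x \<in> {0..1/2} \<Longrightarrow> y x \<le> 1 / (1 + c * k / 2)"
    unfolding c C by (rule growing_solution[OF pos cont R Q]) (auto simp: mult_ac)
  have refl: "continuous_on {0..1} (\<lambda>x. h (1 - x))" if "continuous_on {0..1} h" for h :: "real \<Rightarrow> real"
    by (rule continuous_on_compose2[OF that]) (auto intro: continuous_intros)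
  obtain y' z' where y': "y' 0 = 0" "y' 1 = (1::real)"
    and dy': "\<And>x. x \<in> {0..1} \<Longrightarrow> (y' has_real_derivative R (1 - x) * z' x) (at x within {0..1})"
    and dz': "\<And>x. x \<in> {0..1} \<Longrightarrow> (z' has_real_derivative Q (1 - x) * y' x) (at x within {0..1})"
    and ynn': "\<And>x. x \<in> {0..1} \<Longrightarrow> 0 \<le> y' x"
    and yint': "integral {0..1} (\<lambda>x. (y' x)\<^sup>2) \<le> 1 / (2 * c * k)"
    and ylow': "\<And>x. x \<in> {0..1} \<Longrightarrow> 1 - C * k * (1 - x) \<le> y' x"
    and yup': "\<And>x. x \<in> {0..1/2} \<Longrightarrow> y' x \<le> 1 / (1 + c * k / 2)"
    unfolding c C by (rule growing_solution[OF pos refl[OF cont(1)] refl[OF cont(2)], of r1])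
      (use R Q in \<open>auto simp: mult_ac\<close>)
  have c0: "0 < c" using pos by (simp add: c)
  have "0 < r1" using R[of 0] pos by auto
  moreover have "0 < 1 / r0\<^sup>2 + b" using pos by (intro add_nonneg_pos) auto
  ultimately have C0: "0 < C" by (simp add: C)
  define y0 where "y0 x = y' (1 - x)" for x
  define z0 where "z0 x = - z' (1 - x)" for x
  have rd: "((\<lambda>x. h (1 - x)) has_real_derivative - h' (1 - x)) (at x within {0..1})"
    if "\<And>x. x \<in> {0..1} \<Longrightarrow> (h has_real_derivative h' x) (at x within {0..1})" "x \<in> {0..1}"
    for h h' :: "real \<Rightarrow> real" and x
  proof -
    have "(h has_real_derivative h' (1 - x)) (at (1 - x) within (\<lambda>x. 1 - x) ` {0..1})"
      by (rule has_field_derivative_subset[OF that(1)]) (use that(2) in auto)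
    moreover have "((\<lambda>x::real. 1 - x) has_real_derivative - 1) (at x within {0..1})"
      by (auto intro!: derivative_eq_intros)
    ultimately show ?thesis
      using DERIV_image_chain[of h "h' (1 - x)" "\<lambda>x. 1 - x" x "{0..1}" "-1"] by (simp add: o_def)
  qed
  have dy0: "(y0 has_real_derivative R x * z0 x) (at x within {0..1})" if "x \<in> {0..1}" for x
    using rd[OF dy' that] by (simp add: y0_def[abs_def] z0_def)
  have dz0: "(z0 has_real_derivative Q x * y0 x) (at x within {0..1})" if "x \<in> {0..1}" for x
    using DERIV_minus[OF rd[OF dz' that]] by (simp add: y0_def z0_def[abs_def])
  have ynn0: "0 \<le> y0 x" if "x \<in> {0..1}" for x using ynn'[of "1 - x"] that by (simp add: y0_def)
  have cy: "continuous_on {0..1} y" "continuous_on {0..1} y'" "continuous_on {0..1} y0"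
    by (rule DERIV_continuous_on[OF dy], assumption, rule DERIV_continuous_on[OF dy'], assumption,
      rule DERIV_continuous_on[OF dy0], assumption)
  have yint0: "integral {0..1} (\<lambda>x. (y0 x)\<^sup>2) \<le> 1 / (2 * c * k)"
  proof -
    have "((\<lambda>x. (y' x)\<^sup>2) has_integral integral {0..1} (\<lambda>x. (y' x)\<^sup>2)) (cbox 0 1)"
      using cy by (auto simp: cbox_interval intro!: integrable_integral integrable_continuous_interval continuous_intros)
    from has_integral_affinity[OF this, of "-1" 1]
    have "((\<lambda>x. (y0 x)\<^sup>2) has_integral integral {0..1} (\<lambda>x. (y' x)\<^sup>2)) {0..1}"
      by (simp add: y0_def cbox_interval image_image)
    then show ?thesis using yint' by (metis integral_unique)
  qed
  define w where "w x = A * of_real (y0 x) + B * of_real (y x)" for x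
  define v where "v x = A * of_real (z0 x) + B * of_real (z x)" for x
  have vd: "((\<lambda>x. A * of_real (g x) + B * of_real (h x)) has_vector_derivative
       A * of_real g' + B * of_real h') (at x within {0..1})"
    if "(g has_real_derivative g') (at x within {0..1})" "(h has_real_derivative h') (at x within {0..1})"
    for g h g' h' x
    using that
    by (intro has_vector_derivative_add has_vector_derivative_mult_right has_vector_derivative_of_real)
  have dw: "(w has_vector_derivative R x *\<^sub>R v x) (at x within {0..1})" if "x \<in> {0..1}" for x
    using vd[OF dy0[OF that] dy[OF that]] by (simp add: w_def[abs_def] v_def scaleR_conv_of_real algebra_simps)
  have dv: "(v has_vector_derivative Q x *\<^sub>R w x) (at x within {0..1})" if "x \<in> {0..1}" for x
    using vd[OF dz0[OF that] dz[OF that]] by (simp add: v_def[abs_def] w_def scaleR_conv_of_real algebra_simps)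
  have cw: "continuous_on {0..1} w" unfolding w_def by (intro continuous_intros cy)
  have iw: "(\<lambda>x. (cmod (w x))\<^sup>2) integrable_on {0..1}"
    by (intro integrable_continuous_interval continuous_intros cw)
  show ?thesis
  proof (rule that[of w v])
    show "w 0 = A" "w 1 = B" by (simp_all add: w_def y y' y0_def)
    show "integral {0..1} (\<lambda>x. (cmod (w x))\<^sup>2) \<le> ((cmod A)\<^sup>2 + (cmod B)\<^sup>2) / c / k"
    proof -
      have i: "(\<lambda>x. (y x)\<^sup>2) integrable_on {0..1}" "(\<lambda>x. (y0 x)\<^sup>2) integrable_on {0..1}"
        by (auto intro!: integrable_continuous_interval continuous_intros cy)
      have I: "((\<lambda>x. 2 * (cmod A)\<^sup>2 * (y0 x)\<^sup>2 + 2 * (cmod B)\<^sup>2 * (y x)\<^sup>2) has_integral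
         2 * (cmod A)\<^sup>2 * integral {0..1} (\<lambda>x. (y0 x)\<^sup>2) + 2 * (cmod B)\<^sup>2 * integral {0..1} (\<lambda>x. (y x)\<^sup>2)) {0..1}"
        using i by (intro has_integral_add has_integral_mult_right integrable_integral)
      have sq: "(p + q)\<^sup>2 \<le> 2 * p\<^sup>2 + 2 * q\<^sup>2" for p q :: real
        using zero_le_power2[of "p - q"] by (simp add: power2_eq_square algebra_simps)
      have w2: "(cmod (w x))\<^sup>2 \<le> 2 * (cmod A)\<^sup>2 * (y0 x)\<^sup>2 + 2 * (cmod B)\<^sup>2 * (y x)\<^sup>2" for x
      proof -
        have "cmod (w x) \<le> cmod A * \<bar>y0 x\<bar> + cmod B * \<bar>y x\<bar>"
          unfolding w_def by (rule order_trans[OF norm_triangle_ineq]) (simp add: norm_mult)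
        then have "(cmod (w x))\<^sup>2 \<le> (cmod A * \<bar>y0 x\<bar> + cmod B * \<bar>y x\<bar>)\<^sup>2"
          by (rule power_mono) simp
        also have "\<dots> \<le> 2 * (cmod A * \<bar>y0 x\<bar>)\<^sup>2 + 2 * (cmod B * \<bar>y x\<bar>)\<^sup>2"
          by (rule sq)
        finally show ?thesis by (simp add: power_mult_distrib)
      qed
      have "integral {0..1} (\<lambda>x. (cmod (w x))\<^sup>2) \<le>
          2 * (cmod A)\<^sup>2 * integral {0..1} (\<lambda>x. (y0 x)\<^sup>2) + 2 * (cmod B)\<^sup>2 * integral {0..1} (\<lambda>x. (y x)\<^sup>2)"
        by (rule has_integral_le[OF integrable_integral[OF iw] I w2])
      also have "\<dots> \<le> 2 * (cmod A)\<^sup>2 * (1 / (2 * c * k)) + 2 * (cmod B)\<^sup>2 * (1 / (2 * c * k))"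
        by (intro add_mono mult_left_mono yint yint0) auto
      also have "\<dots> = ((cmod A)\<^sup>2 + (cmod B)\<^sup>2) / c / k" using c0 pos by (simp add: field_simps)
      finally show ?thesis .
    qed
    have core: "((cmod A)\<^sup>2 + (cmod B)\<^sup>2) / (32 * C) / k \<le> integral {0..1} (\<lambda>x. (cmod (w x))\<^sup>2)"
      if S: "{s..t} \<subseteq> {0..1}" "t - s = 1 / (4 * C * k)"
        and P: "(cmod A)\<^sup>2 + (cmod B)\<^sup>2 \<le> 2 * (cmod P)\<^sup>2"
        and low: "\<And>x. x \<in> {s..t} \<Longrightarrow> cmod P / 2 \<le> cmod (w x)" for s t P
    proof -
      have "0 \<le> t - s" unfolding S(2) using C0 pos by simp
      then have st: "s \<le> t" by simp
      have "((\<lambda>x. (cmod P / 2)\<^sup>2) has_integral (t - s) *\<^sub>R (cmod P / 2)\<^sup>2) {s..t}"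
        using has_integral_const_real[of "(cmod P / 2)\<^sup>2" s t] st by simp
      moreover have iw': "(\<lambda>x. (cmod (w x))\<^sup>2) integrable_on {s..t}"
        by (rule integrable_on_subinterval[OF iw S(1)])
      ultimately have "(t - s) *\<^sub>R (cmod P / 2)\<^sup>2 \<le> integral {s..t} (\<lambda>x. (cmod (w x))\<^sup>2)"
        using low by (intro has_integral_le[OF _ integrable_integral]) (auto intro!: power_mono)
      also have "\<dots> \<le> integral {0..1} (\<lambda>x. (cmod (w x))\<^sup>2)"
        by (rule integral_subset_le[OF S(1) iw' iw]) auto
      finally have "1 / (4 * C * k) * ((cmod P)\<^sup>2 / 4) \<le> integral {0..1} (\<lambda>x. (cmod (w x))\<^sup>2)"
        by (simp add: S(2) power_divide)
      moreover have "((cmod A)\<^sup>2 + (cmod B)\<^sup>2) / (32 * C) / k \<le> 2 * (cmod P)\<^sup>2 / (32 * C) / k"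
        using P C0 pos by (intro divide_right_mono) auto
      moreover have "2 * (cmod P)\<^sup>2 / (32 * C) / k = 1 / (4 * C * k) * ((cmod P)\<^sup>2 / 4)"
        using C0 pos by (simp add: field_simps)
      ultimately show ?thesis by linarith
    qed
    define d where "d = 1 / (4 * C * k)"
    have d: "0 < d" "d \<le> 1/2" "C * k * d = 1/4"
      using C0 pos k by (auto simp: d_def field_simps)
    have quarter: "1 / (1 + c * k / 2) \<le> 1/4" using k by (simp add: field_simps)
    show "((cmod A)\<^sup>2 + (cmod B)\<^sup>2) / (32 * C) / k \<le> integral {0..1} (\<lambda>x. (cmod (w x))\<^sup>2)"
    proof (cases "cmod A \<le> cmod B")
      case True
      show ?thesis
      proof (rule core[of "1 - d" 1 B])
        have "(cmod A)\<^sup>2 \<le> (cmod B)\<^sup>2" using True by (simp add: power_mono)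
        then show "(cmod A)\<^sup>2 + (cmod B)\<^sup>2 \<le> 2 * (cmod B)\<^sup>2" by simp
        fix x assume x: "x \<in> {1 - d..1}"
        then have x1: "x \<in> {0..1}" "1 - x \<in> {0..1/2}" using d by auto
        have "C * k * (1 - x) \<le> C * k * d" using x C0 pos by (intro mult_left_mono) auto
        then have "3/4 \<le> y x" using ylow[OF x1(1)] d by linarith
        then have 1: "cmod B * (3/4) \<le> cmod (B * of_real (y x))" using mult_left_mono[of "3/4" "y x" "cmod B"] ynn[OF x1(1)] by (simp add: norm_mult)
        have "y0 x \<le> 1/4" using yup'[OF x1(2)] quarter by (simp add: y0_def)
        then have "cmod A * \<bar>y0 x\<bar> \<le> cmod B * (1/4)" using True ynn0[OF x1(1)] by (intro mult_mono) auto
        then have 2: "cmod (A * of_real (y0 x)) \<le> cmod B * (1/4)" by (simp add: norm_mult)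
        show "cmod B / 2 \<le> cmod (w x)"
          using norm_diff_ineq[of "B * of_real (y x)" "A * of_real (y0 x)"] 1 2
          by (simp add: w_def add.commute)
      qed (use d in \<open>auto simp: d_def\<close>)
    next
      case False
      show ?thesis
      proof (rule core[of 0 d A])
        have "(cmod B)\<^sup>2 \<le> (cmod A)\<^sup>2" using False by (simp add: power_mono)
        then show "(cmod A)\<^sup>2 + (cmod B)\<^sup>2 \<le> 2 * (cmod A)\<^sup>2" by simp
        fix x assume x: "x \<in> {0..d}"
        then have x1: "1 - x \<in> {0..1}" "x \<in> {0..1/2}" "x \<in> {0..1}" using d by auto
        have "C * k * x \<le> C * k * d" using x C0 pos by (intro mult_left_mono) auto
        then have "3/4 \<le> y0 x" using ylow'[OF x1(1)] d by (simp add: y0_def)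
        then have 1: "cmod A * (3/4) \<le> cmod (A * of_real (y0 x))" using mult_left_mono[of "3/4" "y0 x" "cmod A"] ynn0[OF x1(3)] by (simp add: norm_mult)
        have "y x \<le> 1/4" using yup[OF x1(2)] quarter by simp
        then have "cmod B * \<bar>y x\<bar> \<le> cmod A * (1/4)" using False ynn[OF x1(3)] by (intro mult_mono) auto
        then have 2: "cmod (B * of_real (y x)) \<le> cmod A * (1/4)" by (simp add: norm_mult)
        show "cmod A / 2 \<le> cmod (w x)"
          using norm_diff_ineq[of "A * of_real (y0 x)" "B * of_real (y x)"] 1 2
          by (simp add: w_def)
      qed (use d in \<open>auto simp: d_def\<close>)
    qed
  qed (use dw dv in auto)
qed

text \<open>
  The equations express the derivatives of \<open>w\<close> and \<open>z\<close> by functions of the same class, so each of them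
  gains one order of differentiability at a time.
\<close>

lemma linear_system_smooth:
  fixes w z :: "real \<Rightarrow> complex"
  assumes "smooth_on {0..1} R" "smooth_on {0..1} Q"
    and "\<And>x. x \<in> {0..1} \<Longrightarrow> (w has_vector_derivative R x *\<^sub>R z x) (at x within {0..1})"
    and "\<And>x. x \<in> {0..1} \<Longrightarrow> (z has_vector_derivative Q x *\<^sub>R w x) (at x within {0..1})"
  shows "smooth_on {0..1} w" "smooth_on {0..1} z"
proof -
  have U: "uniq_deriv {0..1::real}" by (rule uniq_deriv_unit_interval)
  have "Ck_on n {0..1} w \<and> Ck_on n {0..1} z" for n
  proof (induction n)
    case 0
    then show ?case
      using continuous_on_vector_derivative[OF assms(3)] continuous_on_vector_derivative[OF assms(4)] by simp
  next
    case (Suc n)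
    have RQ: "Ck_on n {0..1} R" "Ck_on n {0..1} Q" using assms(1,2) by (auto simp: smooth_on_def)
    show ?case
    proof
      show "Ck_on (Suc n) {0..1} w"
        by (rule Ck_on_SucI[OF U assms(3)[unfolded has_vector_derivative_def]])
          (use Suc RQ in \<open>auto intro!: Ck_on_scaleR U\<close>)
      show "Ck_on (Suc n) {0..1} z"
        by (rule Ck_on_SucI[OF U assms(4)[unfolded has_vector_derivative_def]])
          (use Suc RQ in \<open>auto intro!: Ck_on_scaleR U\<close>)
    qed
  qed
  then show "smooth_on {0..1} w" "smooth_on {0..1} z" by (auto simp: smooth_on_def)
qed

section \<open>Separated solutions and uniqueness\<close>

lemma smooth_on_diff:
  assumes "uniq_deriv S" "smooth_on S u" "smooth_on S v"
  shows "smooth_on S (\<lambda>z. u z - v z :: complex)"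
  unfolding smooth_on_def
proof
  fix k
  have "Ck_on k S (\<lambda>z. u z + - v z)"
    using assms unfolding smooth_on_def
    by (intro Ck_on_add bounded_linear.Ck_on[OF bounded_linear_minus[OF bounded_linear_ident]]) auto
  then show "Ck_on k S (\<lambda>z. u z - v z)" by simp
qed

lemma L2_fun_diff:
  assumes "L2_fun V u" "L2_fun V v" shows "L2_fun V (\<lambda>p. u p - v p)"
  unfolding L2_fun_def
proof
  have m: "u \<in> borel_measurable V" "v \<in> borel_measurable V" using assms by (auto simp: L2_fun_def)
  then show mm: "(\<lambda>p. u p - v p) \<in> borel_measurable V" by simp
  have i: "integrable V (\<lambda>p. 2 * (norm (u p))\<^sup>2 + 2 * (norm (v p))\<^sup>2)"
    using assms by (auto simp: L2_fun_def)
  show "integrable V (\<lambda>p. (norm (u p - v p))\<^sup>2)"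
  proof (rule Bochner_Integration.integrable_bound[OF i])
    show "(\<lambda>p. (norm (u p - v p))\<^sup>2) \<in> borel_measurable V" using mm by simp
    show "AE p in V. norm ((norm (u p - v p))\<^sup>2) \<le> norm (2 * (norm (u p))\<^sup>2 + 2 * (norm (v p))\<^sup>2)"
    proof (rule AE_I2)
      fix p
      have "(norm (u p - v p))\<^sup>2 \<le> (norm (u p) + norm (v p))\<^sup>2"
        by (rule power_mono[OF norm_triangle_ineq4]) simp
      also have "\<dots> \<le> 2 * (norm (u p))\<^sup>2 + 2 * (norm (v p))\<^sup>2"
        using zero_le_power2[of "norm (u p) - norm (v p)"] by (simp add: power2_eq_square algebra_simps)
      finally show "norm ((norm (u p - v p))\<^sup>2) \<le> norm (2 * (norm (u p))\<^sup>2 + 2 * (norm (v p))\<^sup>2)" by simp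
    qed
  qed
qed

context closed_manifold
begin

lemma grad_inner_cmult_left:
  assumes "C1_fun K u" "C1_fun K v"
  shows "grad_inner K (\<lambda>p. c * u p) v p = c * grad_inner K u v p"
proof -
  obtain i where i: "i \<in> idx K" "p \<in> patch K i" using ex_chart by blast
  define z where "z = coord K i p"
  have z: "z \<in> cimage K i" using i by (simp add: z_def coord_in)
  have c: "C1_fun K (\<lambda>p. c * u p)"
    using C1_fun_mult[OF _ assms(1), of "\<lambda>p. c"] Ck_on_const[OF uniq_cimage, of _ 1 c]
    by (simp add: C1_fun_def o_def del: Ck_on.simps)
  have "((\<lambda>y. c * (u \<circ> param K i) y) has_derivative
      (\<lambda>h. c * frechet_derivative (u \<circ> param K i) (at z within cimage K i) h)) (at z within cimage K i)"
    by (intro has_derivative_mult_right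
        Ck_on_Suc_has_derivative[OF C1_fun_D[OF assms(1) i(1), unfolded One_nat_def] z])
  then have "((\<lambda>p. c * u p) \<circ> param K i has_derivative
      (\<lambda>h. c * frechet_derivative (u \<circ> param K i) (at z within cimage K i) h)) (at z within cimage K i)"
    by (simp only: o_def)
  from pd_eq[OF uniq_cimage[OF i(1)] z this]
  have "pd (cimage K i) ((\<lambda>p. c * u p) \<circ> param K i) a z = c * pd (cimage K i) (u \<circ> param K i) a z" for a
    by (simp only: pd_def)
  then show ?thesis
    using grad_inner_chart[OF c assms(2) i] grad_inner_chart[OF assms i]
    by (simp add: chart_grad_def z_def[symmetric] sum_distrib_left mult_ac)
qed

end

locale cylinder_volume = cylinder_manifold K VK f
  for K :: "('i, 'k::{t2_space, second_countable_topology}, 'e::euclidean_space) riem" and VK f +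
  fixes VM VB :: "(real \<times> 'k) measure"
  assumes VM: "riemannian_volume (cylinder f K) VM"
    and VB: "riemannian_volume (cylinder_boundary f K) VB"
begin

sublocale M: product_volume K VK "{0..1}" cyl_axis VM
  by (rule cylinder_volume_product[OF VM])

sublocale B: product_volume K VK "{0, 1}" bdry_axis VB
  by (rule boundary_volume_product[OF VB])

lemma finite_VM: "finite_measure VM"
proof
  have "integrable VM (\<lambda>q. 1 :: complex)" by (rule M.product_integral(1)) simp
  then show "emeasure VM (space VM) \<noteq> \<infinity>"
    by (subst (asm) integrable_iff_bounded) (simp add: less_top)
qed

lemma product_smooth:
  assumes w: "smooth_on {0..1} w" and Y: "smooth_fun K Y"
  shows "smooth_fun C (\<lambda>q. w (fst q) * Y (snd q))"
  unfolding smooth_fun_def smooth_on_def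
proof (intro ballI allI)
  fix i k assume "i \<in> idx C"
  then have i: "i \<in> idx K" by (simp add: cyl_sel)
  have wk: "Ck_on k {0..1} w" using w by (simp add: smooth_on_def)
  have Yk: "Ck_on k (cimage K i) (Y \<circ> param K i)"
    using Y i unfolding smooth_on_def smooth_fun_def by blast
  have "Ck_on k (cimage C i) (\<lambda>q. w (fst q) * (Y \<circ> param K i) (snd q))"
    unfolding cyl_cimage
    by (rule Ck_on_mult[OF uniq_deriv_Times[OF uniq_deriv_unit_interval uniq_cimage[OF i]]
        Ck_on_fst[OF uniq_deriv_unit_interval uniq_cimage[OF i] wk]
        Ck_on_snd[OF uniq_deriv_unit_interval uniq_cimage[OF i] Yk]])
  then show "Ck_on k (cimage C i) ((\<lambda>q. w (fst q) * Y (snd q)) \<circ> param C i)"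
    by (rule Ck_on_cong_imp[rotated]) (use i in \<open>auto simp: cyl_cimage cyl_param\<close>)
qed

lemma integrable_grad_inner:
  "C1_fun C u \<Longrightarrow> C1_fun C v \<Longrightarrow> integrable VM (grad_inner C u v)"
  by (rule M.product_integral(1)[OF continuous_grad_inner_cyl])

text \<open>
  With \<open>u = w Y\<close> and \<open>z = P w'\<close>, where \<open>P = cyl_weight / f\<close>, the integrand \<open>\<langle>\<nabla>u, \<nabla>v\<rangle> - \<omega> u cnj v\<close> is the sum of
  \<open>A = (z cnj (\<partial>\<^sub>x v) + z' cnj v) Y / cyl_weight\<close> and
  \<open>E = (w / f) (\<langle>\<nabla>Y, \<nabla>v(x, \<cdot>)\<rangle>\<^sub>K - m Y cnj v)\<close>. The integral of \<open>cyl_weight A\<close> over \<open>x\<close> vanishes by the fundamental theorem of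
  calculus, as \<open>v\<close> vanishes at both ends, and the integral of \<open>E\<close> over \<open>K\<close> vanishes by Green's formula.
\<close>

lemma separated_weak_solution:
  fixes w z :: "real \<Rightarrow> complex"
  assumes Y: "has_laplacian K Y (\<lambda>p. - of_real m * Y p)" and w_smooth: "smooth_on {0..1} w"
    and w: "\<And>x. x \<in> {0..1} \<Longrightarrow> (w has_vector_derivative (f x / cyl_weight x) *\<^sub>R z x) (at x within {0..1})"
    and z: "\<And>x. x \<in> {0..1} \<Longrightarrow> (z has_vector_derivative (cyl_weight x / f x * (m - \<omega> * f x)) *\<^sub>R w x) (at x within {0..1})"
    and v: "C1_fun C v" and v0: "\<And>p. v (0, p) = 0" and v1: "\<And>p. v (1, p) = 0"
  shows "energy C VM (\<lambda>q. w (fst q) * Y (snd q)) v =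
    of_real \<omega> * L2_inner VM (\<lambda>q. w (fst q) * Y (snd q)) v"
proof -
  define u where "u q = w (fst q) * Y (snd q)" for q
  have sY: "smooth_fun K Y" using Y by (simp add: has_laplacian_def)
  have Y1: "C1_fun K Y" by (rule smooth_fun_imp_C1_fun[OF sY])
  have u1: "C1_fun C u"
    unfolding u_def[abs_def] by (rule smooth_fun_imp_C1_fun[OF product_smooth[OF w_smooth sY]])
  have cY: "continuous_on UNIV Y" by (rule continuous_C1_fun[OF Y1])
  have cw: "continuous_on {0..1} w" by (rule continuous_on_vector_derivative[OF w])
  have cz: "continuous_on {0..1} z" by (rule continuous_on_vector_derivative[OF z])
  have lift: "continuous_on ({0..1} \<times> (UNIV :: 'k set)) (\<lambda>q. g (fst q))" if "continuous_on {0..1} g"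
    for g :: "real \<Rightarrow> 'z::topological_space"
    by (rule continuous_on_compose2[OF that]) (auto intro: continuous_intros)
  have cYs: "continuous_on ({0..1} \<times> UNIV) (\<lambda>q :: real \<times> 'k. Y (snd q))"
    by (rule continuous_on_compose2[OF cY]) (auto intro: continuous_intros)
  have nz: "f x \<noteq> 0" "cyl_weight x \<noteq> 0" if "x \<in> {0..1}" for x
    using f_pos[OF that] cyl_weight_pos[OF that] by auto
  define q where "q x = cyl_weight x / f x * (m - \<omega> * f x)" for x
  have cq: "continuous_on {0..1} q"
    unfolding q_def using nz by (intro continuous_intros continuous_cyl_weight continuous_f) auto
  have dxu: "dx u (x, p) = (f x / cyl_weight x) *\<^sub>R z x * Y p" if x: "x \<in> {0..1}" for x p
  proof -
    have "((\<lambda>t. u (t, p)) has_vector_derivative (f x / cyl_weight x) *\<^sub>R z x * Y p) (at x within {0..1})"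
      unfolding u_def fst_conv snd_conv by (rule has_vector_derivative_mult_left[OF w[OF x]])
    then show ?thesis
      unfolding dx_def using vector_derivative_within_cbox[of 0 1 x "\<lambda>t. u (t, p)"] x by simp
  qed
  define A where "A s = (z (fst s) * cnj (dx v s) + q (fst s) *\<^sub>R w (fst s) * cnj (v s)) * Y (snd s) /\<^sub>R cyl_weight (fst s)" for s
  define D where "D s = grad_inner K (\<lambda>p. Y p) (\<lambda>p. v (fst s, p)) (snd s) - of_real m * (Y (snd s) * cnj (v s))" for s
  define E where "E s = (w (fst s) /\<^sub>R f (fst s)) * D s" for s
  have gYv: "continuous_on ({0..1} \<times> UNIV) (\<lambda>s. grad_inner K (\<lambda>p. Y p) (\<lambda>p. v (fst s, p)) (snd s))"
  proof -
    have "smooth_on {0..1} (\<lambda>x :: real. 1 :: complex)"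
      unfolding smooth_on_def by (intro allI Ck_on_const uniq_deriv_unit_interval)
    then have "C1_fun C (\<lambda>q. 1 * Y (snd q))"
      using product_smooth[OF _ sY] smooth_fun_imp_C1_fun by blast
    from continuous_slice_grad[OF this v] show ?thesis by simp
  qed
  have cA: "continuous_on ({0..1} \<times> UNIV) A"
    unfolding A_def using nz
    by (intro continuous_intros lift[OF cz] lift[OF cw] lift[OF cq] lift[OF continuous_cyl_weight]
        continuous_dx[OF v] continuous_cyl_fun[OF v] cYs) auto
  have cE: "continuous_on ({0..1} \<times> UNIV) E"
    unfolding E_def D_def using nz
    by (intro continuous_intros lift[OF cw] lift[OF continuous_f] gYv continuous_cyl_fun[OF v] cYs) auto
  have cu: "continuous_on ({0..1} \<times> UNIV) u" by (rule continuous_cyl_fun[OF u1])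
  have "(\<integral>s. A s \<partial>VM) = (\<integral>p. (\<integral>x. indicator {0..1} x *\<^sub>R A (x, p) \<partial>cyl_axis) \<partial>VK)"
    by (rule M.product_integral(3)[OF cA])
  also have "\<dots> = (\<integral>p. 0 \<partial>VK)"
  proof (intro Bochner_Integration.integral_cong refl)
    fix p
    have "continuous_on {0..1} (\<lambda>x. A (x, p))"
      by (rule continuous_on_compose2[OF cA]) (auto intro: continuous_intros)
    then have "(\<integral>x. indicator {0..1} x *\<^sub>R A (x, p) \<partial>cyl_axis) = integral {0..1} (\<lambda>x. cyl_weight x *\<^sub>R A (x, p))"
      by (rule integral_cyl_axis)
    also have "\<dots> = integral {0..1} (\<lambda>x. (z x * cnj (dx v (x, p)) + q x *\<^sub>R w x * cnj (v (x, p))) * Y p)"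
      by (intro Henstock_Kurzweil_Integration.integral_cong) (use nz in \<open>simp add: A_def\<close>)
    also have "\<dots> = 0"
    proof (rule integral_unique)
      have "((\<lambda>x. (z x * cnj (dx v (x, p)) + q x *\<^sub>R w x * cnj (v (x, p))) * Y p) has_integral
          z 1 * cnj (v (1, p)) * Y p - z 0 * cnj (v (0, p)) * Y p) {0..1}"
      proof (rule fundamental_theorem_of_calculus)
        fix x :: real assume x: "x \<in> {0..1}"
        have "((\<lambda>x. z x * cnj (v (x, p))) has_vector_derivative
            z x * cnj (dx v (x, p)) + q x *\<^sub>R w x * cnj (v (x, p))) (at x within {0..1})"
          by (intro has_vector_derivative_mult z[OF x, folded q_def] has_vector_derivative_cnj dx_derivative[OF v x])
        then show "((\<lambda>x. z x * cnj (v (x, p)) * Y p) has_vector_derivative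
            (z x * cnj (dx v (x, p)) + q x *\<^sub>R w x * cnj (v (x, p))) * Y p) (at x within {0..1})"
          by (rule has_vector_derivative_mult_left)
      qed simp
      then show "((\<lambda>x. (z x * cnj (dx v (x, p)) + q x *\<^sub>R w x * cnj (v (x, p))) * Y p) has_integral 0) {0..1}"
        by (simp add: v0 v1)
    qed
    finally show "(\<integral>x. indicator {0..1} x *\<^sub>R A (x, p) \<partial>cyl_axis) = 0" .
  qed
  finally have A0: "(\<integral>s. A s \<partial>VM) = 0" by simp
  have "(\<integral>s. E s \<partial>VM) = (\<integral>x. (\<integral>p. indicator {0..1} x *\<^sub>R E (x, p) \<partial>VK) \<partial>cyl_axis)"
    by (rule M.product_integral(2)[OF cE])
  also have "\<dots> = (\<integral>x. 0 \<partial>cyl_axis)"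
  proof (intro Bochner_Integration.integral_cong refl)
    fix x :: real
    show "(\<integral>p. indicator {0..1} x *\<^sub>R E (x, p) \<partial>VK) = 0"
    proof (cases "x \<in> {0..1}")
      case True
      have vx: "C1_fun K (\<lambda>p. v (x, p))" by (rule C1_slice[OF v True])
      have "(\<integral>p. D (x, p) \<partial>VK) = (\<integral>p. grad_inner K Y (\<lambda>p. v (x, p)) p \<partial>VK) - (\<integral>p. of_real m * (Y p * cnj (v (x, p))) \<partial>VK)"
        unfolding D_def fst_conv snd_conv
        by (intro Bochner_Integration.integral_diff integrable_continuous continuous_grad_inner Y1 vx
            continuous_intros cY continuous_C1_fun[OF vx])
      also have "\<dots> = 0" using green[OF Y vx] by simp
      finally show ?thesis using True by (simp add: E_def)
    qed simp
  qed
  finally have E0: "(\<integral>s. E s \<partial>VM) = 0" by simp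
  have split: "grad_inner C u v s - of_real \<omega> * (u s * cnj (v s)) = A s + E s" if "s \<in> space VM" for s
  proof -
    obtain x p where s: "s = (x, p)" by (cases s)
    have x: "x \<in> {0..1}" using that by (simp add: s M.space_V)
    have vx: "C1_fun K (\<lambda>p. v (x, p))" by (rule C1_slice[OF v x])
    have "grad_inner C u v (x, p) = ((f x / cyl_weight x) *\<^sub>R z x * Y p * cnj (dx v (x, p)) +
        w x * grad_inner K Y (\<lambda>p. v (x, p)) p) /\<^sub>R f x"
      unfolding grad_inner_cyl[OF u1 v x] dxu[OF x]
      using grad_inner_cmult_left[OF Y1 vx, of "w x" p] by (simp add: u_def)
    then show ?thesis
      using nz[OF x] unfolding s
      by (simp add: A_def E_def D_def u_def q_def scaleR_conv_of_real field_simps)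
  qed
  have "(\<integral>s. grad_inner C u v s - of_real \<omega> * (u s * cnj (v s)) \<partial>VM) = (\<integral>s. A s + E s \<partial>VM)"
    by (rule Bochner_Integration.integral_cong[OF refl split])
  also have "\<dots> = (\<integral>s. A s \<partial>VM) + (\<integral>s. E s \<partial>VM)"
    by (intro Bochner_Integration.integral_add M.product_integral(1) cA cE)
  finally have "(\<integral>s. grad_inner C u v s - of_real \<omega> * (u s * cnj (v s)) \<partial>VM) = 0"
    by (simp add: A0 E0)
  moreover have "integrable VM (\<lambda>s. of_real \<omega> * (u s * cnj (v s)))"
    by (intro M.product_integral(1) continuous_intros cu continuous_cyl_fun v)
  ultimately show ?thesis
    using integrable_grad_inner[OF u1 v]
    by (simp add: Bochner_Integration.integral_diff energy_def L2_inner_def u_def[abs_def])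
qed

lemma grad_inner_cyl_diff_left:
  assumes u: "C1_fun C u" and u': "C1_fun C u'" and x: "x \<in> {0..1}"
  shows "grad_inner C (\<lambda>q. u q - u' q) v (x, p) = grad_inner C u v (x, p) - grad_inner C u' v (x, p)"
proof -
  define i where "i = (SOME i. i \<in> idx C \<and> (x, p) \<in> patch C i)"
  have "\<exists>i. i \<in> idx C \<and> (x, p) \<in> patch C i" using ex_chart[of p] x by (auto simp: cyl_sel)
  then have "i \<in> idx C \<and> (x, p) \<in> patch C i" unfolding i_def by (rule someI_ex)
  then have i: "i \<in> idx K" "p \<in> patch K i" by (auto simp: cyl_sel)
  define y where "y = coord C i (x, p)"
  have y: "y = (x, coord K i p)" by (simp add: y_def cyl_sel)
  have y': "y \<in> cimage C i" using i x by (simp add: y cyl_cimage coord_in)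
  have "((\<lambda>t. (u \<circ> param C i) t - (u' \<circ> param C i) t) has_derivative
      (\<lambda>h. frechet_derivative (u \<circ> param C i) (at y within cimage C i) h -
           frechet_derivative (u' \<circ> param C i) (at y within cimage C i) h)) (at y within cimage C i)"
    unfolding y by (intro has_derivative_diff C1_cyl_derivative u u' i x coord_in)
  then have "((\<lambda>q. u q - u' q) \<circ> param C i has_derivative
      (\<lambda>h. frechet_derivative (u \<circ> param C i) (at y within cimage C i) h -
           frechet_derivative (u' \<circ> param C i) (at y within cimage C i) h)) (at y within cimage C i)"
    by (simp only: o_def)
  from pd_eq[OF cyl_uniq[OF i(1)] y' this]
  have "pd (cimage C i) ((\<lambda>q. u q - u' q) \<circ> param C i) a y =
      pd (cimage C i) (u \<circ> param C i) a y - pd (cimage C i) (u' \<circ> param C i) a y" for a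
    by (simp only: pd_def)
  then show ?thesis
    unfolding grad_inner_def i_def[symmetric] Let_def y_def[symmetric]
    by (simp add: left_diff_distrib scaleR_diff_right sum_subtractf)
qed

lemma energy_diff_left:
  assumes "C1_fun C u" "C1_fun C u'" "C1_fun C v"
  shows "energy C VM (\<lambda>q. u q - u' q) v = energy C VM u v - energy C VM u' v"
proof -
  have "energy C VM (\<lambda>q. u q - u' q) v = (\<integral>q. grad_inner C u v q - grad_inner C u' v q \<partial>VM)"
    unfolding energy_def
    by (rule Bochner_Integration.integral_cong[OF refl])
      (auto simp: M.space_V grad_inner_cyl_diff_left assms)
  then show ?thesis
    unfolding energy_def using integrable_grad_inner assms by (simp add: Bochner_Integration.integral_diff)
qed

text \<open>
  Subtracting the same smooth function from \<open>\<Phi>\<close> and from all members of the sequence leaves all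
  differences unchanged, and the convergence conditions depend only on these.
\<close>

lemma H1_approx_diff:
  assumes U: "H1_approx C VM \<Phi> U" and u: "smooth_fun C u"
  shows "H1_approx C VM (\<lambda>q. \<Phi> q - u q) (\<lambda>k q. U k q - u q)"
  unfolding H1_approx_def
proof (intro conjI)
  have u1: "C1_fun C u" by (rule smooth_fun_imp_C1_fun[OF u])
  have "continuous_on ({0..1} \<times> UNIV) (\<lambda>q. complex_of_real ((norm (u q))\<^sup>2))"
    by (intro continuous_intros continuous_cyl_fun u1)
  from M.product_integral(1)[OF this] have "L2_fun VM u"
    unfolding L2_fun_def using M.measurable_V[OF continuous_cyl_fun[OF u1]]
    by (simp only: complex_of_real_integrable_eq simp_thms)
  then show "L2_fun VM (\<lambda>q. \<Phi> q - u q)" using U by (intro L2_fun_diff) (auto simp: H1_approx_def)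
  have "smooth_fun C (\<lambda>q. U k q - u q)" for k
    unfolding smooth_fun_def
  proof
    fix i assume i: "i \<in> idx C"
    have "smooth_on (cimage C i) (U k \<circ> param C i)" "smooth_on (cimage C i) (u \<circ> param C i)"
      using U u i unfolding H1_approx_def smooth_fun_def by blast+
    moreover have "uniq_deriv (cimage C i)" using i cyl_uniq by (simp add: cyl_sel)
    ultimately have "smooth_on (cimage C i) (\<lambda>z. (U k \<circ> param C i) z - (u \<circ> param C i) z)"
      by (intro smooth_on_diff)
    then show "smooth_on (cimage C i) ((\<lambda>q. U k q - u q) \<circ> param C i)" by (simp only: o_def)
  qed
  then show "\<forall>k. smooth_fun C (\<lambda>q. U k q - u q)" by (rule allI)
  show "(\<lambda>k. L2_norm VM (\<lambda>p. U k p - u p - (\<Phi> p - u p))) \<longlonglongrightarrow> 0" using U by (simp add: H1_approx_def)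
  show "\<forall>e>0. \<exists>N. \<forall>k\<ge>N. \<forall>l\<ge>N. norm (energy C VM (\<lambda>p. U k p - u p - (U l p - u p)) (\<lambda>p. U k p - u p - (U l p - u p))) < e"
    using U by (simp add: H1_approx_def)
qed

lemma L2_inner_diff_left:
  assumes \<Phi>: "L2_fun VM \<Phi>" and u: "C1_fun C u" and v: "C1_fun C v"
  shows "L2_inner VM (\<lambda>q. \<Phi> q - u q) v = L2_inner VM \<Phi> v - L2_inner VM u v"
proof -
  interpret finite_measure VM by (rule finite_VM)
  have cv: "continuous_on ({0..1} \<times> UNIV) v" by (rule continuous_cyl_fun[OF v])
  have "compact (v ` ({0..1} \<times> UNIV))"
    by (intro compact_continuous_image cv compact_Times compact_UNIV) simp
  then obtain B where B: "\<And>q. q \<in> {0..1} \<times> UNIV \<Longrightarrow> norm (v q) \<le> B"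
    by (meson bounded_iff compact_imp_bounded imageI)
  have "integrable VM (\<lambda>q. B * (1 + (norm (\<Phi> q))\<^sup>2))" using \<Phi> by (simp add: L2_fun_def)
  then have i1: "integrable VM (\<lambda>q. \<Phi> q * cnj (v q))"
  proof (rule Bochner_Integration.integrable_bound)
    show "(\<lambda>q. \<Phi> q * cnj (v q)) \<in> borel_measurable VM"
      using \<Phi> M.measurable_V[OF continuous_on_cnj[OF cv]] unfolding L2_fun_def
      by (intro borel_measurable_times) auto
    show "AE q in VM. norm (\<Phi> q * cnj (v q)) \<le> norm (B * (1 + (norm (\<Phi> q))\<^sup>2))"
    proof (rule AE_I2)
      fix q assume "q \<in> space VM"
      then have b: "norm (v q) \<le> B" using B by (simp add: M.space_V)
      then have B0: "0 \<le> B" using norm_ge_zero[of "v q"] by linarith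
      have "norm (\<Phi> q) \<le> 1 + (norm (\<Phi> q))\<^sup>2"
        using zero_le_power2[of "norm (\<Phi> q) - 1/2"] by (simp add: power2_eq_square algebra_simps)
      then have "norm (\<Phi> q) * norm (v q) \<le> (1 + (norm (\<Phi> q))\<^sup>2) * B" using b by (intro mult_mono) auto
      then show "norm (\<Phi> q * cnj (v q)) \<le> norm (B * (1 + (norm (\<Phi> q))\<^sup>2))"
        using B0 by (simp add: norm_mult abs_mult mult.commute)
    qed
  qed
  have i2: "integrable VM (\<lambda>q. u q * cnj (v q))"
    by (intro M.product_integral(1) continuous_intros continuous_cyl_fun u v)
  show ?thesis
    unfolding L2_inner_def left_diff_distrib by (rule Bochner_Integration.integral_diff[OF i1 i2])
qed

text \<open>
  The difference \<open>\<Phi> - u\<close> is a solution with vanishing boundary values; it is zero because \<open>\<omega>\<close> is not in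
  the spectrum.
\<close>

lemma dirichlet_solution_unique:
  assumes nspec: "\<omega> \<notin> dirichlet_spectrum f K VM VB"
    and \<Phi>: "dirichlet_solution f K VM VB \<omega> \<psi> \<Phi>"
    and u: "smooth_fun C u" and bdry: "\<And>p. u (0, p) = \<psi> (0, p)" "\<And>p. u (1, p) = \<psi> (1, p)"
    and weak: "\<And>v. test_fun f K v \<Longrightarrow> energy C VM u v = of_real \<omega> * L2_inner VM u v"
  shows "AE q in VM. \<Phi> q = u q"
proof -
  define d where "d q = \<Phi> q - u q" for q
  have u1: "C1_fun C u" by (rule smooth_fun_imp_C1_fun[OF u])
  have "dirichlet_solution f K VM VB \<omega> (\<lambda>q. 0) d"
    unfolding dirichlet_solution_def
  proof (intro conjI allI impI)
    obtain U where U: "H1_approx C VM \<Phi> U" "(\<lambda>k. L2_norm VB (\<lambda>q. U k q - \<psi> q)) \<longlonglongrightarrow> 0"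
      using \<Phi> by (auto simp: dirichlet_solution_def has_trace_def)
    have "L2_norm VB (\<lambda>q. U k q - u q - 0) = L2_norm VB (\<lambda>q. U k q - \<psi> q)" for k
      unfolding L2_norm_def
      by (intro arg_cong[where f=sqrt] Bochner_Integration.integral_cong refl) (auto simp: B.space_V bdry)
    then have "(\<lambda>k. L2_norm VB (\<lambda>q. U k q - u q - 0)) \<longlonglongrightarrow> 0" using U(2) by simp
    then show "has_trace f K VM VB d (\<lambda>q. 0)"
      unfolding has_trace_def d_def[abs_def]
      using H1_approx_diff[OF U(1) u] by (auto simp: L2_fun_def)
    fix v assume v: "test_fun f K v"
    have v1: "C1_fun C v" using v by (simp add: test_fun_def smooth_fun_imp_C1_fun)
    obtain U' where U': "H1_approx C VM \<Phi> U'"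
      "(\<lambda>k. energy C VM (U' k) v) \<longlonglongrightarrow> of_real \<omega> * L2_inner VM \<Phi> v"
      using \<Phi> v unfolding dirichlet_solution_def H1_energy_def by blast
    have sU: "C1_fun C (U' k)" for k
      using U'(1) by (simp add: H1_approx_def smooth_fun_imp_C1_fun)
    have L: "L2_fun VM \<Phi>" using U'(1) by (simp add: H1_approx_def)
    have "(\<lambda>k. energy C VM (U' k) v - energy C VM u v) \<longlonglongrightarrow> of_real \<omega> * L2_inner VM \<Phi> v - energy C VM u v"
      by (intro tendsto_diff U'(2) tendsto_const)
    moreover have "of_real \<omega> * L2_inner VM \<Phi> v - energy C VM u v = of_real \<omega> * L2_inner VM d v"
      unfolding d_def[abs_def] L2_inner_diff_left[OF L u1 v1] weak[OF v] by (simp add: right_diff_distrib)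
    ultimately have "(\<lambda>k. energy C VM (\<lambda>q. U' k q - u q) v) \<longlonglongrightarrow> of_real \<omega> * L2_inner VM d v"
      by (simp add: energy_diff_left[OF sU u1 v1])
    then show "H1_energy C VM d v (of_real \<omega> * L2_inner VM d v)"
      unfolding H1_energy_def using H1_approx_diff[OF U'(1) u] by (auto simp: d_def[abs_def])
  qed
  then have "AE q in VM. d q = 0" using nspec by (auto simp: dirichlet_spectrum_def)
  then show ?thesis by (simp add: d_def)
qed

lemma test_fun_boundary:
  assumes "test_fun f K v" shows "v (0, p) = 0" "v (1, p) = 0"
proof -
  have s: "closure {q \<in> points C. v q \<noteq> 0} \<subseteq> {0<..<1} \<times> UNIV"
    using assms by (simp add: test_fun_def Let_def)
  have "v (x, p) = 0" if "x \<in> {0..1}" "x \<notin> {0<..<1}" for x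
  proof (rule ccontr)
    assume "v (x, p) \<noteq> 0"
    then have "(x, p) \<in> {q \<in> points C. v q \<noteq> 0}" using that by (simp add: cyl_points)
    then have "(x, p) \<in> {0<..<1} \<times> UNIV" by (rule subsetD[OF s subsetD[OF closure_subset]])
    then show False using that by simp
  qed
  then show "v (0, p) = 0" "v (1, p) = 0" by auto
qed

end

section \<open>Norms of the solutions\<close>

context cylinder_volume
begin

lemma L2_norm_separated:
  assumes w: "continuous_on {0..1} w" and Y: "continuous_on UNIV Y" and Y1: "(\<integral>p. (norm (Y p))\<^sup>2 \<partial>VK) = 1"
  shows "L2_norm VM (\<lambda>q. w (fst q) * Y (snd q)) = sqrt (integral {0..1} (\<lambda>x. cyl_weight x * (cmod (w x))\<^sup>2))"
proof -
  have c: "continuous_on {0..1} (\<lambda>x. (cmod (w x))\<^sup>2)" by (intro continuous_intros w)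
  have "(\<integral>q. (norm (w (fst q) * Y (snd q)))\<^sup>2 \<partial>VM) = (\<integral>x. indicator {0..1} x * (norm (w x))\<^sup>2 \<partial>cyl_axis)"
    by (subst M.product_L2(2)[OF w Y]) (simp_all add: Y1)
  also have "\<dots> = integral {0..1} (\<lambda>x. cyl_weight x * (cmod (w x))\<^sup>2)"
    using integral_cyl_axis[OF c] by simp
  finally show ?thesis by (simp only: L2_norm_def)
qed

lemma boundary_L2_norm:
  assumes \<phi>: "\<And>p. \<phi> (0, p) = a * Y p" "\<And>p. \<phi> (1, p) = b * Y p"
    and Y: "continuous_on UNIV Y" and Y1: "(\<integral>p. (norm (Y p))\<^sup>2 \<partial>VK) = 1"
  shows "(L2_norm VB \<phi>)\<^sup>2 = bdry_weight 0 * (cmod a)\<^sup>2 + bdry_weight 1 * (cmod b)\<^sup>2"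
proof -
  define g where "g x = (if x = 0 then a else b)" for x :: real
  have g: "continuous_on {0, 1} g" by (rule continuous_on_finite) simp
  have "(\<integral>q. (norm (\<phi> q))\<^sup>2 \<partial>VB) = (\<integral>x. indicator {0, 1} x * (norm (g x))\<^sup>2 \<partial>bdry_axis)"
    by (subst B.product_L2(2)[OF g Y]) (auto simp: g_def \<phi> Y1)
  also have "\<dots> = bdry_weight 0 * (cmod a)\<^sup>2 + bdry_weight 1 * (cmod b)\<^sup>2"
    by (subst integral_bdry_axis) (auto simp: g_def)
  finally have e: "(\<integral>q. (norm (\<phi> q))\<^sup>2 \<partial>VB) = bdry_weight 0 * (cmod a)\<^sup>2 + bdry_weight 1 * (cmod b)\<^sup>2" .
  have "0 \<le> (\<integral>q. (norm (\<phi> q))\<^sup>2 \<partial>VB)" by simp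
  then show ?thesis unfolding L2_norm_def e[symmetric] by (rule real_sqrt_pow2)
qed

text \<open>
  The bounds of \<open>two_point_solution\<close> apply uniformly in large \<open>m\<close>: for \<open>m \<ge> 2 |\<omega>| max f\<close> one has
  \<open>m / 2 \<le> m - \<omega> f \<le> 2 m\<close>. The normalisation of \<open>\<phi>\<close> bounds \<open>|A|\<^sup>2 + |B|\<^sup>2\<close> from both sides.
\<close>

lemma solution_norm_bounds:
  assumes nspec: "\<omega> \<notin> dirichlet_spectrum f K VM VB"
  obtains c1 c2 m0 :: real where "0 < c1" "0 < c2" "0 < m0"
    "\<And>m Y \<phi> \<Phi>. \<lbrakk>m0 \<le> m; has_laplacian K Y (\<lambda>p. - of_real m * Y p); (\<integral>p. (norm (Y p))\<^sup>2 \<partial>VK) = 1;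
      \<phi> \<in> mode_space Y; L2_norm VB \<phi> = 1; dirichlet_solution f K VM VB \<omega> \<phi> \<Phi>\<rbrakk> \<Longrightarrow>
      c1 / m powr (1/4) \<le> L2_norm VM \<Phi> \<and> L2_norm VM \<Phi> \<le> c2 / m powr (1/4)"
proof -
  define N where "N = real (DIM('e) + 1)"
  define R where "R x = f x / cyl_weight x" for x
  have nz: "0 < f x" "0 < cyl_weight x" if "x \<in> {0..1}" for x
    using f_pos[OF that] cyl_weight_pos[OF that] by auto
  have cyl_weightf: "cyl_weight x = f x powr (N / 2)" if "x \<in> {0..1}" for x
  proof -
    have "cyl_weight x = (f x powr N) powr (1/2)"
      using nz[OF that] by (simp add: cyl_weight_def N_def powr_half_sqrt powr_realpow del: power_Suc of_nat_Suc of_nat_add)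
    then show ?thesis by (simp add: powr_powr)
  qed
  have Rf: "R x = f x powr (1 - N / 2)" if "x \<in> {0..1}" for x
    using nz[OF that] by (simp add: R_def cyl_weightf[OF that] powr_diff)
  have sf: "Ck_on k {0..1} f" for k using smooth_f by (simp add: smooth_on_def)
  have spow: "Ck_on k {0..1} (\<lambda>x. f x powr s)" for k s
    by (rule Ck_on_powr[OF uniq_deriv_unit_interval sf f_pos])
  have sR: "smooth_on {0..1} R"
    unfolding smooth_on_def using Ck_on_cong_imp[OF Rf[symmetric] spow] by blast
  have cR: "continuous_on {0..1} R" using sR Ck_on_continuous unfolding smooth_on_def by blast
  have sQ: "smooth_on {0..1} (\<lambda>x. cyl_weight x / f x * (m - \<omega> * f x))" for m
    unfolding smooth_on_def
  proof
    fix k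
    have "Ck_on k {0..1} (\<lambda>x. f x powr (N / 2 - 1) * (m + (- \<omega>) * f x))"
      by (intro Ck_on_mult Ck_on_add Ck_on_const uniq_deriv_unit_interval spow sf)
    then show "Ck_on k {0..1} (\<lambda>x. cyl_weight x / f x * (m - \<omega> * f x))"
      by (rule Ck_on_cong_imp[rotated]) (use nz in \<open>auto simp: cyl_weightf powr_diff less_imp_le simp del: atLeastAtMost_iff\<close>)
  qed
  have ext: "\<exists>l h. 0 < l \<and> (\<forall>x\<in>{0..1}. l \<le> g x \<and> g x \<le> h)"
    if g: "continuous_on {0..1} g" and pos: "\<And>x. x \<in> {0..1} \<Longrightarrow> 0 < g x" for g :: "real \<Rightarrow> real"
  proof -
    obtain x0 where x0: "x0 \<in> {0..1}" "\<forall>x\<in>{0..1}. g x0 \<le> g x"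
      using continuous_attains_inf[OF compact_Icc _ g] by auto
    obtain x1 where x1: "x1 \<in> {0..1}" "\<forall>x\<in>{0..1}. g x \<le> g x1"
      using continuous_attains_sup[OF compact_Icc _ g] by auto
    show ?thesis using x0 x1 pos by blast
  qed
  have Rpos: "0 < R x" if "x \<in> {0..1}" for x using nz[OF that] by (simp add: R_def)
  obtain r0 r1 where r: "0 < r0" "\<And>x. x \<in> {0..1} \<Longrightarrow> r0 \<le> R x \<and> R x \<le> r1"
    using ext[OF cR Rpos] by blast
  obtain m1 m2 where m: "0 < m1" "\<And>x. x \<in> {0..1} \<Longrightarrow> m1 \<le> cyl_weight x \<and> cyl_weight x \<le> m2"
    using ext[OF continuous_cyl_weight cyl_weight_pos] by blast
  obtain f1 f2 where f12: "0 < f1" "\<And>x. x \<in> {0..1} \<Longrightarrow> f1 \<le> f x \<and> f x \<le> f2"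
    using ext[OF continuous_f f_pos] by blast
  have r1: "0 < r1" using r(1) r(2)[of 0] by simp
  have m2: "0 < m2" using m(1) m(2)[of 0] by simp
  have f2: "0 < f2" using f12(1) f12(2)[of 0] by simp
  \<comment> \<open>\<open>Q / R = (m - \<omega> f) / R\<^sup>2\<close> lies between \<open>a m\<close> and \<open>b m\<close>.\<close>
  define a where "a = 1 / (2 * r1\<^sup>2)"
  define b where "b = 2 / r0\<^sup>2"
  have ab: "0 < a" "0 < b" using r1 r by (auto simp: a_def b_def)
  define c where "c = r0 * sqrt a"
  define D where "D = r1 * sqrt (1 / r0\<^sup>2 + b)"
  have c0: "0 < c" using r ab by (simp add: c_def)
  have D0: "0 < D"
  proof -
    have "0 < 1 / r0\<^sup>2 + b" using ab by (intro add_nonneg_pos) auto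
    then show ?thesis using r1 by (simp add: D_def)
  qed
  define b1 where "b1 = min (bdry_weight 0) (bdry_weight 1)"
  define b2 where "b2 = max (bdry_weight 0) (bdry_weight 1)"
  have bp: "0 < b1" "0 < b2" using bdry_weight_pos[of 0] bdry_weight_pos[of 1] by (auto simp: b1_def b2_def)
  \<comment> \<open>From \<open>k = k0\<close> on, the intervals at the two ends do not overlap and the far profile is at most \<open>1/4\<close> there.\<close>
  define k0 where "k0 = 1 + 6 / c + 1 / (2 * D)"
  define m0 where "m0 = max (k0\<^sup>2) (2 * \<bar>\<omega>\<bar> * f2)"
  define c1 where "c1 = sqrt (m1 / (b2 * (32 * D)))"
  define c2 where "c2 = sqrt (m2 / (b1 * c))"
  have k0: "1 \<le> k0" "6 / c \<le> k0" "1 / (2 * D) \<le> k0" using c0 D0 by (auto simp: k0_def add_nonneg_nonneg)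
  show ?thesis
  proof (rule that[of c1 c2 m0])
    show "0 < c1" "0 < c2" using m m2 bp c0 D0 by (auto simp: c1_def c2_def)
    have "0 < k0\<^sup>2" using k0 by simp
    then show "0 < m0" by (simp add: m0_def less_max_iff_disj)
    fix m Y \<phi> \<Phi>
    assume mm: "m0 \<le> m" and Y: "has_laplacian K Y (\<lambda>p. - of_real m * Y p)"
      and Y1: "(\<integral>p. (norm (Y p))\<^sup>2 \<partial>VK) = 1" and \<phi>: "\<phi> \<in> mode_space Y" and \<phi>1: "L2_norm VB \<phi> = 1"
      and \<Phi>: "dirichlet_solution f K VM VB \<omega> \<phi> \<Phi>"
    have m_pos: "0 < m" using mm \<open>0 < m0\<close> by linarith
    define k where "k = sqrt m"
    have k2: "k\<^sup>2 = m" using m_pos by (simp add: k_def)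
    have "sqrt (k0\<^sup>2) \<le> k" unfolding k_def using mm by (intro real_sqrt_le_mono) (simp add: m0_def)
    then have kk0: "k0 \<le> k" using k0 by simp
    have k1: "1 \<le> k" "6 \<le> c * k" "1 \<le> 2 * D * k"
    proof -
      show "1 \<le> k" using kk0 k0 by simp
      have "6 / c \<le> k" using kk0 k0 by linarith
      then show "6 \<le> c * k" using c0 by (simp add: field_simps)
      have "1 / (2 * D) \<le> k" using kk0 k0 by linarith
      then show "1 \<le> 2 * D * k" using D0 by (simp add: field_simps)
    qed
    define Q where "Q x = cyl_weight x / f x * (m - \<omega> * f x)" for x
    have Qb: "a * k\<^sup>2 * R x \<le> Q x \<and> Q x \<le> b * k\<^sup>2 * R x" if x: "x \<in> {0..1}" for x
    proof -
      have Rx: "0 < R x" "r0 \<le> R x" "R x \<le> r1" using r x by fastforce+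
      have "\<bar>\<omega> * f x\<bar> \<le> \<bar>\<omega>\<bar> * f2"
        using f12(2)[OF x] nz[OF x] by (simp add: abs_mult mult_left_mono)
      also have "\<dots> \<le> m / 2" using mm by (simp add: m0_def)
      finally have wf: "m / 2 \<le> m - \<omega> * f x" "m - \<omega> * f x \<le> 2 * m" using m_pos by linarith+
      have Qx: "Q x = (m - \<omega> * f x) / (R x)\<^sup>2 * R x"
        using nz[OF x] by (simp add: Q_def R_def power2_eq_square)
      have "a * m \<le> (m / 2) / (R x)\<^sup>2"
      proof -
        have "(R x)\<^sup>2 \<le> r1\<^sup>2" using Rx by (intro power_mono) auto
        then have "(m / 2) / r1\<^sup>2 \<le> (m / 2) / (R x)\<^sup>2" using m_pos Rx by (intro divide_left_mono) auto
        then show ?thesis by (simp add: a_def)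
      qed
      also have "\<dots> \<le> (m - \<omega> * f x) / (R x)\<^sup>2" using wf by (intro divide_right_mono) auto
      finally have l: "a * m \<le> (m - \<omega> * f x) / (R x)\<^sup>2" .
      have "(m - \<omega> * f x) / (R x)\<^sup>2 \<le> (2 * m) / (R x)\<^sup>2" using wf by (intro divide_right_mono) auto
      also have "\<dots> \<le> (2 * m) / r0\<^sup>2"
        using Rx r m_pos by (intro divide_left_mono power_mono) auto
      finally have u: "(m - \<omega> * f x) / (R x)\<^sup>2 \<le> b * m" by (simp add: b_def)
      show ?thesis unfolding Qx k2 using l u Rx by (intro conjI mult_right_mono) auto
    qed
    obtain A B where AB: "\<And>p. \<phi> (0, p) = A * Y p" "\<And>p. \<phi> (1, p) = B * Y p"
      using \<phi> by (auto simp: mode_space_def)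
    have sQ': "smooth_on {0..1} Q" unfolding Q_def by (rule sQ)
    then have cQ: "continuous_on {0..1} Q" using Ck_on_continuous unfolding smooth_on_def by blast
    obtain w z :: "real \<Rightarrow> complex" where w0: "w 0 = A" "w 1 = B"
      and dw: "\<And>x. x \<in> {0..1} \<Longrightarrow> (w has_vector_derivative R x *\<^sub>R z x) (at x within {0..1})"
      and dz: "\<And>x. x \<in> {0..1} \<Longrightarrow> (z has_vector_derivative Q x *\<^sub>R w x) (at x within {0..1})"
      and low: "((cmod A)\<^sup>2 + (cmod B)\<^sup>2) / (32 * D) / k \<le> integral {0..1} (\<lambda>x. (cmod (w x))\<^sup>2)"
      and up: "integral {0..1} (\<lambda>x. (cmod (w x))\<^sup>2) \<le> ((cmod A)\<^sup>2 + (cmod B)\<^sup>2) / c / k"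
      by (rule two_point_solution[OF r(1) ab k1(1) cR cQ r(2) Qb c_def D_def k1(2,3), of A B]) blast+
    have sw: "smooth_on {0..1} w" by (rule linear_system_smooth(1)[OF sR sQ' dw dz])
    have cw: "continuous_on {0..1} w" by (rule continuous_on_vector_derivative[OF dw])
    have sY: "smooth_fun K Y" using Y by (simp add: has_laplacian_def)
    have cY: "continuous_on UNIV Y" by (rule continuous_C1_fun[OF smooth_fun_imp_C1_fun[OF sY]])
    define u where "u q = w (fst q) * Y (snd q)" for q
    have su: "smooth_fun C u" unfolding u_def[abs_def] by (rule product_smooth[OF sw sY])
    have ae: "AE q in VM. \<Phi> q = u q"
    proof (rule dirichlet_solution_unique[OF nspec \<Phi> su])
      show "u (0, p) = \<phi> (0, p)" "u (1, p) = \<phi> (1, p)" for p by (simp_all add: u_def w0 AB)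
      fix v assume v: "test_fun f K v"
      have "C1_fun C v" using v by (simp add: test_fun_def smooth_fun_imp_C1_fun)
      then show "energy C VM u v = of_real \<omega> * L2_inner VM u v"
        unfolding u_def[abs_def]
        by (intro separated_weak_solution[OF Y sw dw[unfolded R_def] dz[unfolded Q_def]] test_fun_boundary[OF v])
    qed
    have "L2_norm VM \<Phi> = L2_norm VM u"
    proof -
      have m\<Phi>: "\<Phi> \<in> borel_measurable VM"
        using \<Phi> by (auto simp: dirichlet_solution_def has_trace_def H1_approx_def L2_fun_def)
      have mu: "u \<in> borel_measurable VM"
        by (rule M.measurable_V[OF continuous_cyl_fun[OF smooth_fun_imp_C1_fun[OF su]]])
      have "(\<integral>q. (norm (\<Phi> q))\<^sup>2 \<partial>VM) = (\<integral>q. (norm (u q))\<^sup>2 \<partial>VM)"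
        by (rule integral_cong_AE) (use m\<Phi> mu ae in auto)
      then show ?thesis by (simp only: L2_norm_def)
    qed
    then have norm: "L2_norm VM \<Phi> = sqrt (integral {0..1} (\<lambda>x. cyl_weight x * (cmod (w x))\<^sup>2))"
      unfolding u_def[abs_def] using L2_norm_separated[OF cw cY Y1] by simp
    define s where "s = (cmod A)\<^sup>2 + (cmod B)\<^sup>2"
    have one: "bdry_weight 0 * (cmod A)\<^sup>2 + bdry_weight 1 * (cmod B)\<^sup>2 = 1"
      using boundary_L2_norm[OF AB cY Y1] \<phi>1 by simp
    have "b1 * s \<le> 1"
    proof -
      have "b1 * (cmod A)\<^sup>2 \<le> bdry_weight 0 * (cmod A)\<^sup>2" "b1 * (cmod B)\<^sup>2 \<le> bdry_weight 1 * (cmod B)\<^sup>2"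
        by (auto simp: b1_def intro!: mult_right_mono)
      then show ?thesis using one by (simp add: s_def distrib_left)
    qed
    then have s_up: "s \<le> 1 / b1" using bp by (simp add: field_simps)
    have "1 \<le> b2 * s"
    proof -
      have "bdry_weight 0 * (cmod A)\<^sup>2 \<le> b2 * (cmod A)\<^sup>2" "bdry_weight 1 * (cmod B)\<^sup>2 \<le> b2 * (cmod B)\<^sup>2"
        by (auto simp: b2_def intro!: mult_right_mono)
      then show ?thesis using one by (simp add: s_def distrib_left)
    qed
    then have s_low: "1 / b2 \<le> s" using bp by (simp add: field_simps)
    have i2: "(\<lambda>x. cyl_weight x * (cmod (w x))\<^sup>2) integrable_on {0..1}"
      and i3: "(\<lambda>x. c' * (cmod (w x))\<^sup>2) integrable_on {0..1}" for c'
      by (intro integrable_continuous_interval continuous_intros cw continuous_cyl_weight)+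
    define I where "I = integral {0..1} (\<lambda>x. (cmod (w x))\<^sup>2)"
    define J where "J = integral {0..1} (\<lambda>x. cyl_weight x * (cmod (w x))\<^sup>2)"
    have "m1 * I \<le> J"
      unfolding I_def J_def integral_mult_right[symmetric]
      by (rule integral_le) (use i2 i3 m(2) in \<open>auto intro!: mult_right_mono\<close>)
    have "J \<le> m2 * I"
      unfolding I_def J_def integral_mult_right[symmetric]
      by (rule integral_le) (use i2 i3 m(2) in \<open>auto intro!: mult_right_mono\<close>)
    have k_pos: "0 < k" using k1 by linarith
    have "c1\<^sup>2 / k = m1 * (1 / b2 / (32 * D) / k)"
      using m bp D0 by (simp add: c1_def)
    also have "\<dots> \<le> m1 * (s / (32 * D) / k)"
      using m s_low D0 k_pos by (intro mult_left_mono divide_right_mono) auto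
    also have "\<dots> \<le> m1 * I" using m low by (intro mult_left_mono) (auto simp: I_def s_def)
    finally have lowJ: "c1\<^sup>2 / k \<le> J" using \<open>m1 * I \<le> J\<close> by linarith
    have "m2 * I \<le> m2 * (s / c / k)" using m2 up by (intro mult_left_mono) (auto simp: I_def s_def)
    also have "\<dots> \<le> m2 * (1 / b1 / c / k)"
      using m2 s_up c0 k_pos by (intro mult_left_mono divide_right_mono) auto
    also have "\<dots> = c2\<^sup>2 / k" using m2 bp c0 by (simp add: c2_def)
    finally have upJ: "J \<le> c2\<^sup>2 / k" using \<open>J \<le> m2 * I\<close> by linarith
    have quart: "sqrt k = m powr (1/4)"
    proof -
      have "sqrt k = (m powr (1/2)) powr (1/2)" using m_pos by (simp add: k_def powr_half_sqrt)
      then show ?thesis by (simp add: powr_powr)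
    qed
    have "c1 / sqrt k = sqrt (c1\<^sup>2 / k)" "c2 / sqrt k = sqrt (c2\<^sup>2 / k)"
      using \<open>0 < c1\<close> \<open>0 < c2\<close> by (simp_all add: real_sqrt_divide)
    then show "c1 / m powr (1/4) \<le> L2_norm VM \<Phi> \<and> L2_norm VM \<Phi> \<le> c2 / m powr (1/4)"
      unfolding norm J_def[symmetric] quart[symmetric] using lowJ upJ by simp
  qed
qed

end

theorem theorem3p1:
  fixes n :: nat
    and K :: "('i, 'k::{t2_space, second_countable_topology}, 'e::euclidean_space) riem"
    and f :: "real \<Rightarrow> real"
    and VK :: "'k measure"
    and VM VB :: "(real \<times> 'k) measure"
    and \<omega> :: real
    and \<mu> :: "nat \<Rightarrow> real"
    and Y :: "nat \<Rightarrow> 'k \<Rightarrow> complex"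
    and l_minus l_plus :: "nat \<Rightarrow> real"
    and \<phi>_minus \<phi>_plus \<Phi>_minus \<Phi>_plus :: "nat \<Rightarrow> real \<times> 'k \<Rightarrow> complex"
  assumes "n \<ge> 2" and "DIM('e) = n - 1"
    and "closed_connected_riemannian_manifold K"
    and "smooth_on {0..1} f" and "\<forall>x\<in>{0..1}. f x > 0"
    and "riemannian_volume K VK"
    and "riemannian_volume (cylinder f K) VM"
    and "riemannian_volume (cylinder_boundary f K) VB"
    and "\<omega> \<notin> dirichlet_spectrum f K VM VB"
    and "\<mu> 0 = 0" and "0 < \<mu> 1" and "mono \<mu>" and "filterlim \<mu> at_top sequentially"
    and "orthonormal_basis VK Y"
    and "\<forall>m. has_laplacian K (Y m) (\<lambda>p. - of_real (\<mu> m) * Y m p)"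
    and "\<forall>m. l_minus m < l_plus m"
    and "\<forall>m. normalised_DN_eigenfunction f K VM VB \<omega> (Y m) (l_minus m) (\<phi>_minus m)"
    and "\<forall>m. normalised_DN_eigenfunction f K VM VB \<omega> (Y m) (l_plus m) (\<phi>_plus m)"
    and "\<forall>m. dirichlet_solution f K VM VB \<omega> (\<phi>_minus m) (\<Phi>_minus m)"
    and "\<forall>m. dirichlet_solution f K VM VB \<omega> (\<phi>_plus m) (\<Phi>_plus m)"
    and "(n = 2 \<and> \<omega> \<noteq> 0) \<or> n \<ge> 3"
  shows "\<exists>c1 c2 :: real. \<exists>m0 :: nat. 0 < c1 \<and> c1 < c2 \<and> 0 < m0 \<and>
    (\<forall>m\<ge>m0.
       c1 / \<mu> m powr (1/4) \<le> L2_norm VM (\<Phi>_minus m) \<and> L2_norm VM (\<Phi>_minus m) \<le> c2 / \<mu> m powr (1/4) \<and>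
       c1 / \<mu> m powr (1/4) \<le> L2_norm VM (\<Phi>_plus m) \<and> L2_norm VM (\<Phi>_plus m) \<le> c2 / \<mu> m powr (1/4))"
proof -
  interpret cylinder_volume K VK f VM VB
    by unfold_locales (use assms in auto)
  have Y1: "(\<integral>p. (norm (Y m p))\<^sup>2 \<partial>VK) = 1" for m
  proof -
    have "L2_inner VK (Y m) (Y m) = 1" using assms(14) by (simp add: orthonormal_basis_def)
    then have "(\<integral>p. complex_of_real ((norm (Y m p))\<^sup>2) \<partial>VK) = 1"
      by (simp only: L2_inner_def complex_norm_square)
    then have "complex_of_real (\<integral>p. (norm (Y m p))\<^sup>2 \<partial>VK) = complex_of_real 1"
      by (simp only: integral_complex_of_real of_real_1)
    then show ?thesis by (simp only: of_real_eq_iff)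
  qed
  obtain c1 c2 a0 :: real where c: "0 < c1" "0 < c2" "0 < a0"
    and bounds: "\<And>m Y \<phi> \<Phi>. \<lbrakk>a0 \<le> m; has_laplacian K Y (\<lambda>p. - of_real m * Y p); (\<integral>p. (norm (Y p))\<^sup>2 \<partial>VK) = 1;
      \<phi> \<in> mode_space Y; L2_norm VB \<phi> = 1; dirichlet_solution f K VM VB \<omega> \<phi> \<Phi>\<rbrakk> \<Longrightarrow>
      c1 / m powr (1/4) \<le> L2_norm VM \<Phi> \<and> L2_norm VM \<Phi> \<le> c2 / m powr (1/4)"
    by (rule solution_norm_bounds[OF assms(9)]) blast
  have "eventually (\<lambda>m. a0 \<le> \<mu> m) sequentially"
    using assms(13) by (simp add: filterlim_at_top)
  then obtain m0 where m0: "\<And>m. m \<ge> m0 \<Longrightarrow> a0 \<le> \<mu> m" unfolding eventually_sequentially by blast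
  have both: "c1 / \<mu> m powr (1/4) \<le> L2_norm VM (\<Phi>_minus m) \<and> L2_norm VM (\<Phi>_minus m) \<le> (c1 + c2) / \<mu> m powr (1/4) \<and>
       c1 / \<mu> m powr (1/4) \<le> L2_norm VM (\<Phi>_plus m) \<and> L2_norm VM (\<Phi>_plus m) \<le> (c1 + c2) / \<mu> m powr (1/4)"
    if m: "m \<ge> Suc m0" for m
  proof -
    have a: "a0 \<le> \<mu> m" using m0[of m] m by simp
    have "c2 / \<mu> m powr (1/4) \<le> (c1 + c2) / \<mu> m powr (1/4)" using c by (intro divide_right_mono) auto
    moreover have "c1 / \<mu> m powr (1/4) \<le> L2_norm VM (\<Phi>_minus m) \<and> L2_norm VM (\<Phi>_minus m) \<le> c2 / \<mu> m powr (1/4)"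
      by (rule bounds[OF a _ Y1, where \<phi>="\<phi>_minus m"])
        (use assms in \<open>auto simp: normalised_DN_eigenfunction_def\<close>)
    moreover have "c1 / \<mu> m powr (1/4) \<le> L2_norm VM (\<Phi>_plus m) \<and> L2_norm VM (\<Phi>_plus m) \<le> c2 / \<mu> m powr (1/4)"
      by (rule bounds[OF a _ Y1, where \<phi>="\<phi>_plus m"])
        (use assms in \<open>auto simp: normalised_DN_eigenfunction_def\<close>)
    ultimately show ?thesis by linarith
  qed
  show ?thesis
    \<comment> \<open>\<open>c1 + c2\<close> makes the upper constant strictly larger.\<close>
    by (rule exI[of _ c1], rule exI[of _ "c1 + c2"], rule exI[of _ "Suc m0"]) (use c both in auto)
qed

end
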